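(* Let $\Gamma_1$ be any metric graph, let $\Gamma_2$ be a loop, and let $\Gamma=\Gamma_1\wedge\Gamma_2$ be an arbitrary wedge sum, with wedge point $q$. Let $r,d$ be nonnegative integers such that $W^r_d(\Gamma_1)$ is nonempty. Then $$w^r_d(\Gamma_1)\ \le\ w^r_{d+1}(\Gamma)\ \le\ w^{r-1}_d(\Gamma_1),$$ where the second inequality is asserted for $r\ge 1$ (so that $w^{r-1}_d(\Gamma_1)$ is defined).
   Context: A metric graph $\Gamma$ is a compact connected metric space in which every point has a neighborhood isometric to a star-shaped set (equivalently, a finite connected graph with positive edge lengths, viewed as a length space). A loop is a metric graph isometric to a circle of some positive length. For metric graphs $\Gamma_1,\Gamma_2$ and points $p\in\Gamma_1$, $p'\in\Gamma_2$, the wedge sum of $\Gamma_1$ and $\Gamma_2$ is the metric graph obtained by gluing $\Gamma_1$ and $\Gamma_2$ via the identification $p\sim p'$; the common image of $p$ and $p'$ is the wedge point. A divisor on $\Gamma$ is an element of the free abelian group $\operatorname{Div}(\Gamma)$ on the points of $\Gamma$; its degree is the sum of its coefficients, and it is effective if all coefficients are nonnegative. For a continuous piecewise linear function $f:\Gamma\to\mathbb{R}$ with integer slopes, $\operatorname{div}(f)=\sum_v \operatorname{ord}_v(f)\, v$, where $\operatorname{ord}_v(f)$ is the sum of the incoming slopes of $f$ at $v$; such divisors are called principal. Two divisors are linearly equivalent if their difference is principal. $\operatorname{Pic}^d(\Gamma)$ is the set of linear equivalence classes of divisors of degree $d$. The rank $r(D)$ is $-1$ if $D$ is not equivalent to an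 effective divisor, and otherwise is the largest nonnegative integer $r$ such that for every effective divisor $E$ of degree $r$ the divisor $D-E$ is equivalent to an effective divisor. For nonnegative integers $r,d$, $W^r_d(\Gamma)\subseteq \operatorname{Pic}^d(\Gamma)$ is the set of classes of divisors of degree $d$ and rank at least $r$. If $W^r_d(\Gamma)$ is nonempty, the Brill-Noether rank $w^r_d(\Gamma)$ is the largest integer $k$ such that for every effective divisor $E$ on $\Gamma$ of degree $r+k$ there exists a divisor $D$ of degree $d$ and rank at least $r$ such that $D-E$ is effective. If $W^r_d(\Gamma)$ is empty, $w^r_d(\Gamma)=-1$. *)

theory Defs
  imports "HOL-Analysis.Analysis" "HOL-Algebra.Free_Abelian_Groups"
begin

section \<open>Metric graphs\<close>

definition is_isometry :: "'a metric \<Rightarrow> 'b metric \<Rightarrow> ('a \<Rightarrow> 'b) \<Rightarrow> bool" where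
  "is_isometry X Y \<phi> \<longleftrightarrow> \<phi> ` mspace X = mspace Y \<and>
     (\<forall>x\<in>mspace X. \<forall>y\<in>mspace X. mdist Y (\<phi> x) (\<phi> y) = mdist X x y)"

definition isometric :: "'a metric \<Rightarrow> 'b metric \<Rightarrow> bool" where
  "isometric X Y \<longleftrightarrow> (\<exists>\<phi>. is_isometry X Y \<phi>)"

text \<open>The star-shaped set of valence \<open>n\<close> and radius \<open>\<rho>\<close>, that is
  \<open>n\<close> copies of the interval \<open>[0,\<rho>)\<close> glued at \<open>0\<close>, with the path metric.
  The centre is \<open>(0, 0)\<close> and the point at distance \<open>t > 0\<close> from it on branch \<open>k\<close>
  is \<open>(k, t)\<close>; the absolute values in the distance of points on different
  branches only serve nonnegativity outside the carrier. For \<open>n = 0\<close> the star is a single point.\<close>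

definition star_dist :: "nat \<times> real \<Rightarrow> nat \<times> real \<Rightarrow> real" where
  "star_dist x y = (if fst x = fst y then \<bar>snd x - snd y\<bar> else \<bar>snd x\<bar> + \<bar>snd y\<bar>)"

definition star :: "nat \<Rightarrow> real \<Rightarrow> (nat \<times> real) metric" where
  "star n \<rho> = metric (insert (0, 0) ({..<n} \<times> {0<..<\<rho>}), star_dist)"

lemma Metric_space_star: "Metric_space (insert (0, 0) ({..<n} \<times> {0<..<\<rho>})) star_dist"
  by unfold_locales (auto simp: star_dist_def split: if_splits)

lemma mspace_star: "mspace (star n \<rho>) = insert (0, 0) ({..<n} \<times> {0<..<\<rho>})"
  and mdist_star: "mdist (star n \<rho>) = star_dist"
  by (simp_all add: star_def Metric_space.mspace_metric Metric_space.mdist_metric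
      Metric_space_star)

definition star_chart ::
  "'a metric \<Rightarrow> 'a \<Rightarrow> nat \<Rightarrow> real \<Rightarrow> (nat \<times> real \<Rightarrow> 'a) \<Rightarrow> bool" where
  "star_chart \<Gamma> v n \<rho> \<phi> \<longleftrightarrow> \<rho> > 0 \<and> \<phi> (0, 0) = v \<and>
     (\<exists>U. openin (mtopology_of \<Gamma>) U \<and> is_isometry (star n \<rho>) (submetric \<Gamma> U) \<phi>)"

text \<open>Only the local metric structure matters for divisors, so the distance between
  far apart points is not required to be a path length. The graph with a single vertex
  and no edges is included.\<close>

definition metric_graph :: "'a metric \<Rightarrow> bool" where
  "metric_graph \<Gamma> \<longleftrightarrow> mspace \<Gamma> \<noteq> {} \<and>
     compact_space (mtopology_of \<Gamma>) \<and> connected_space (mtopology_of \<Gamma>) \<and>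
     (\<forall>v\<in>mspace \<Gamma>. \<exists>n \<rho> \<phi>. star_chart \<Gamma> v n \<rho> \<phi>)"

text \<open>The circle of length \<open>L\<close> is \<open>\<real> / L\<int>\<close> with arc length distance; its points are
  represented by the numbers in \<open>[0,L)\<close>, for which \<open>L - \<bar>x - y\<bar> > 0\<close>. The outer absolute
  value is there because \<open>Metric_space\<close> wants nonnegativity on the whole type.\<close>

definition circle_dist :: "real \<Rightarrow> real \<Rightarrow> real \<Rightarrow> real" where
  "circle_dist L x y = min \<bar>x - y\<bar> \<bar>L - \<bar>x - y\<bar>\<bar>"

definition circle :: "real \<Rightarrow> real metric" where
  "circle L = metric ({0..<L}, circle_dist L)"

lemma Metric_space_circle: "Metric_space {0..<L} (circle_dist L)"
  by unfold_locales (auto simp: circle_dist_def min_def abs_if split: if_splits)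

lemma mspace_circle: "mspace (circle L) = {0..<L}"
  and mdist_circle: "mdist (circle L) = circle_dist L"
  by (simp_all add: circle_def Metric_space.mspace_metric Metric_space.mdist_metric
      Metric_space_circle)

definition loop :: "'a metric \<Rightarrow> bool" where
  "loop \<Gamma> \<longleftrightarrow> metric_graph \<Gamma> \<and> (\<exists>L>0. isometric \<Gamma> (circle L))"

text \<open>The wedge sum of \<open>\<Gamma>1\<close> and \<open>\<Gamma>2\<close> along \<open>p \<sim> p'\<close>. The wedge point is
  represented by \<open>Inl p\<close>, so \<open>Inr p'\<close> is left out of the carrier.\<close>

fun wedge_dist ::
  "'a metric \<Rightarrow> 'a \<Rightarrow> 'b metric \<Rightarrow> 'b \<Rightarrow> 'a + 'b \<Rightarrow> 'a + 'b \<Rightarrow> real" where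
  "wedge_dist \<Gamma>1 p \<Gamma>2 p' (Inl x) (Inl y) = mdist \<Gamma>1 x y"
| "wedge_dist \<Gamma>1 p \<Gamma>2 p' (Inr x) (Inr y) = mdist \<Gamma>2 x y"
| "wedge_dist \<Gamma>1 p \<Gamma>2 p' (Inl x) (Inr y) = mdist \<Gamma>1 x p + mdist \<Gamma>2 p' y"
| "wedge_dist \<Gamma>1 p \<Gamma>2 p' (Inr x) (Inl y) = mdist \<Gamma>2 x p' + mdist \<Gamma>1 p y"

definition wedge :: "'a metric \<Rightarrow> 'a \<Rightarrow> 'b metric \<Rightarrow> 'b \<Rightarrow> ('a + 'b) metric" where
  "wedge \<Gamma>1 p \<Gamma>2 p' =
     metric (Inl ` mspace \<Gamma>1 \<union> Inr ` (mspace \<Gamma>2 - {p'}), wedge_dist \<Gamma>1 p \<Gamma>2 p')"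

lemma Metric_space_wedge:
  assumes p: "p \<in> mspace \<Gamma>1" and p': "p' \<in> mspace \<Gamma>2"
  shows "Metric_space (Inl ` mspace \<Gamma>1 \<union> Inr ` (mspace \<Gamma>2 - {p'})) (wedge_dist \<Gamma>1 p \<Gamma>2 p')"
proof
  fix x y z
  show "0 \<le> wedge_dist \<Gamma>1 p \<Gamma>2 p' x y"
    by (cases x; cases y) simp_all
  show "wedge_dist \<Gamma>1 p \<Gamma>2 p' x y = wedge_dist \<Gamma>1 p \<Gamma>2 p' y x"
    by (cases x; cases y) (simp_all add: mdist_commute)
  assume x: "x \<in> Inl ` mspace \<Gamma>1 \<union> Inr ` (mspace \<Gamma>2 - {p'})"
    and y: "y \<in> Inl ` mspace \<Gamma>1 \<union> Inr ` (mspace \<Gamma>2 - {p'})"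
  show "wedge_dist \<Gamma>1 p \<Gamma>2 p' x y = 0 \<longleftrightarrow> x = y"
  proof -
    have pos: "mdist \<Gamma>2 p' b > 0" "mdist \<Gamma>2 b p' > 0" if "b \<in> mspace \<Gamma>2" "b \<noteq> p'" for b
      using that p' by (metis less_eq_real_def mdist_nonneg mdist_zero)+
    have "mdist \<Gamma>1 a p + mdist \<Gamma>2 p' b \<noteq> 0" "mdist \<Gamma>2 b p' + mdist \<Gamma>1 p a \<noteq> 0"
      if "b \<in> mspace \<Gamma>2" "b \<noteq> p'" for a b
      using pos[OF that] mdist_nonneg[of \<Gamma>1 a p] mdist_nonneg[of \<Gamma>1 p a] by linarith+
    then show ?thesis
      using x y by auto
  qed
  assume z: "z \<in> Inl ` mspace \<Gamma>1 \<union> Inr ` (mspace \<Gamma>2 - {p'})"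
  note t1 = mdist_triangle[where m = \<Gamma>1] and t2 = mdist_triangle[where m = \<Gamma>2]
  note c = mdist_commute[of \<Gamma>1] mdist_commute[of \<Gamma>2]
  show "wedge_dist \<Gamma>1 p \<Gamma>2 p' x z
      \<le> wedge_dist \<Gamma>1 p \<Gamma>2 p' x y + wedge_dist \<Gamma>1 p \<Gamma>2 p' y z"
  proof (cases x; cases y; cases z)
    fix a b c assume e: "x = Inl a" "y = Inl b" "z = Inl c"
    then show ?thesis using x y z by (auto intro: t1)
  next
    fix a b c assume e: "x = Inr a" "y = Inr b" "z = Inr c"
    then show ?thesis using x y z by (auto intro: t2)
  next
    fix a b c assume e: "x = Inl a" "y = Inl b" "z = Inr c"
    then show ?thesis using x y z t1[of a b p] p by auto
  next
    fix a b c assume e: "x = Inl a" "y = Inr b" "z = Inl c"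
    then show ?thesis
      using x y z t1[of a p c] p by (auto intro: order_trans[OF _ add_mono])
  next
    fix a b c assume e: "x = Inl a" "y = Inr b" "z = Inr c"
    then show ?thesis using x y z t2[of p' b c] p' by auto
  next
    fix a b c assume e: "x = Inr a" "y = Inl b" "z = Inl c"
    then show ?thesis using x y z t1[of p b c] p by auto
  next
    fix a b c assume e: "x = Inr a" "y = Inl b" "z = Inr c"
    then show ?thesis
      using x y z t2[of a p' c] p' by (auto intro: order_trans[OF _ add_mono])
  next
    fix a b c assume e: "x = Inr a" "y = Inr b" "z = Inl c"
    then show ?thesis using x y z t2[of a b p'] p' by auto
  qed
qed

lemma
  assumes "p \<in> mspace \<Gamma>1" and "p' \<in> mspace \<Gamma>2"
  shows mspace_wedge:
      "mspace (wedge \<Gamma>1 p \<Gamma>2 p') = Inl ` mspace \<Gamma>1 \<union> Inr ` (mspace \<Gamma>2 - {p'})"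
    and mdist_wedge: "mdist (wedge \<Gamma>1 p \<Gamma>2 p') = wedge_dist \<Gamma>1 p \<Gamma>2 p'"
  by (simp_all only: wedge_def Metric_space.mspace_metric[OF Metric_space_wedge[OF assms]]
      Metric_space.mdist_metric[OF Metric_space_wedge[OF assms]])


section \<open>Divisors\<close>

abbreviation Div :: "'a metric \<Rightarrow> ('a \<Rightarrow>\<^sub>0 int) set" where
  "Div \<Gamma> \<equiv> carrier (free_Abelian_group (mspace \<Gamma>))"

definition div_degree :: "('a \<Rightarrow>\<^sub>0 int) \<Rightarrow> int" where
  "div_degree D = (\<Sum>x\<in>Poly_Mapping.keys D. Poly_Mapping.lookup D x)"

definition effective :: "('a \<Rightarrow>\<^sub>0 int) \<Rightarrow> bool" where
  "effective D \<longleftrightarrow> (\<forall>x. Poly_Mapping.lookup D x \<ge> 0)"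

text \<open>The function \<open>f\<close> is linear on each branch of the chart, with integer outgoing slope
  \<open>s k\<close> on branch \<open>k\<close>.\<close>

definition linear_on_chart ::
  "'a metric \<Rightarrow> ('a \<Rightarrow> real) \<Rightarrow> 'a \<Rightarrow> nat \<Rightarrow> real \<Rightarrow> (nat \<times> real \<Rightarrow> 'a) \<Rightarrow> (nat \<Rightarrow> int) \<Rightarrow> bool"
where
  "linear_on_chart \<Gamma> f v n \<rho> \<phi> s \<longleftrightarrow> star_chart \<Gamma> v n \<rho> \<phi> \<and>
     (\<forall>k<n. \<forall>t\<in>{0<..<\<rho>}. f (\<phi> (k, t)) = f v + of_int (s k) * t)"

text \<open>Continuous piecewise linear functions with integer slopes. Linearity on a star around
  every point includes continuity, and by compactness finitely many linear pieces suffice.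
  Only the values on \<open>mspace \<Gamma>\<close> matter.\<close>

definition pl_function :: "'a metric \<Rightarrow> ('a \<Rightarrow> real) \<Rightarrow> bool" where
  "pl_function \<Gamma> f \<longleftrightarrow> (\<forall>v\<in>mspace \<Gamma>. \<exists>n \<rho> \<phi> s. linear_on_chart \<Gamma> f v n \<rho> \<phi> s)"

text \<open>The sum of the incoming slopes; these are the negatives of the outgoing slopes \<open>s k\<close>.
  The value does not depend on the chart, since for small \<open>t > 0\<close> the sum of \<open>f x - f v\<close> over
  the points \<open>x\<close> at distance \<open>t\<close> from \<open>v\<close> is \<open>t\<close> times the sum of the outgoing slopes.\<close>

definition ord_at :: "'a metric \<Rightarrow> ('a \<Rightarrow> real) \<Rightarrow> 'a \<Rightarrow> int" where
  "ord_at \<Gamma> f v =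
     (THE m. \<exists>n \<rho> \<phi> s. linear_on_chart \<Gamma> f v n \<rho> \<phi> s \<and> m = (\<Sum>k<n. - s k))"

definition divisor_of :: "'a metric \<Rightarrow> ('a \<Rightarrow> real) \<Rightarrow> ('a \<Rightarrow>\<^sub>0 int)" where
  "divisor_of \<Gamma> f =
     (\<Sum>v\<in>{v \<in> mspace \<Gamma>. ord_at \<Gamma> f v \<noteq> 0}. frag_cmul (ord_at \<Gamma> f v) (frag_of v))"

definition principal :: "'a metric \<Rightarrow> ('a \<Rightarrow>\<^sub>0 int) \<Rightarrow> bool" where
  "principal \<Gamma> D \<longleftrightarrow> (\<exists>f. pl_function \<Gamma> f \<and> D = divisor_of \<Gamma> f)"

definition lin_equiv :: "'a metric \<Rightarrow> ('a \<Rightarrow>\<^sub>0 int) \<Rightarrow> ('a \<Rightarrow>\<^sub>0 int) \<Rightarrow> bool" where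
  "lin_equiv \<Gamma> D D' \<longleftrightarrow> D \<in> Div \<Gamma> \<and> D' \<in> Div \<Gamma> \<and> principal \<Gamma> (D - D')"

definition lin_class :: "'a metric \<Rightarrow> ('a \<Rightarrow>\<^sub>0 int) \<Rightarrow> ('a \<Rightarrow>\<^sub>0 int) set" where
  "lin_class \<Gamma> D = {D'. lin_equiv \<Gamma> D D'}"

definition Pic :: "'a metric \<Rightarrow> int \<Rightarrow> ('a \<Rightarrow>\<^sub>0 int) set set" where
  "Pic \<Gamma> d = lin_class \<Gamma> ` {D \<in> Div \<Gamma>. div_degree D = d}"


section \<open>Ranks\<close>

definition equiv_effective :: "'a metric \<Rightarrow> ('a \<Rightarrow>\<^sub>0 int) \<Rightarrow> bool" where
  "equiv_effective \<Gamma> D \<longleftrightarrow> (\<exists>F. effective F \<and> lin_equiv \<Gamma> D F)"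

definition div_rank :: "'a metric \<Rightarrow> ('a \<Rightarrow>\<^sub>0 int) \<Rightarrow> int" where
  "div_rank \<Gamma> D = (if \<not> equiv_effective \<Gamma> D then - 1
     else int (GREATEST r. \<forall>E\<in>Div \<Gamma>. effective E \<and> div_degree E = int r \<longrightarrow>
            equiv_effective \<Gamma> (D - E)))"

definition W :: "'a metric \<Rightarrow> nat \<Rightarrow> nat \<Rightarrow> ('a \<Rightarrow>\<^sub>0 int) set set" where
  "W \<Gamma> r d = {c \<in> Pic \<Gamma> (int d). \<exists>D\<in>c. div_degree D = int d \<and> int r \<le> div_rank \<Gamma> D}"

definition bn_rank :: "'a metric \<Rightarrow> nat \<Rightarrow> nat \<Rightarrow> int" where
  "bn_rank \<Gamma> r d = (if W \<Gamma> r d = {} then - 1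
     else (GREATEST k. \<forall>E\<in>Div \<Gamma>. effective E \<and> div_degree E = int r + k \<longrightarrow>
            (\<exists>D\<in>Div \<Gamma>. div_degree D = int d \<and> int r \<le> div_rank \<Gamma> D \<and> effective (D - E))))"

end

(* The loop contributes exactly one chip. Every divisor of degree 1 on a loop is equivalent to a
   point, so for each divisor A on the wedge, pushing A along the retraction onto Gamma1 and adding
   the wedge point q gives A + x up to equivalence, for some point x. Hence D1 + q has rank at least
   r on the wedge whenever D1 has rank at least r on Gamma1, and it can be moved to contain a given E
   as soon as D1 contains the retraction of E. Conversely the retraction maps principal divisors to
   principal divisors, because principal divisors on Gamma2 have degree 0; removing q from the
   retraction of a divisor of rank r leaves a divisor of rank at least r - 1.

   That principal divisors have degree 0 is seen on the level sets of f: the upward flux through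
   level c is locally constant away from finitely many levels, vanishes for large |c|, and jumps at
   c by the sum of the orders of f over the points of level c. *)
theory Submission
  imports Defs
begin

section \<open>Charts onto metric balls\<close>

text \<open>A metric graph is given here only by star charts around its points; there are no global
  edges along which slopes could be summed. Global facts therefore come from compactness, and
  sweeping through the levels of \<open>f\<close> needs only local information near each level.
  Shrinking charts to metric balls makes them comparable with each other and with the balls of a
  wedge.

  The point x arises because A + deg(A) q is the sum of the two retractions of A, embedded in the
  wedge. The discrepancy between A and its image in \<Gamma>1 thus lives on the loop, has degree 0,
  and becomes equivalent to a point once q is added. On a circle of length L this is Abel-Jacobi: a
  divisor of degree 0 whose weighted sum of coordinates is a multiple of L is principal.

  Both ranks are defined by \<open>GREATEST\<close>, which says nothing until a largest value is
  known to exist. The predicates \<open>rank_cond\<close> and \<open>bn_cond\<close> isolate the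
  conditions; both inequalities become implications between \<open>bn_cond\<close> on the two graphs
  with the same \<open>k\<close>. In the upper bound q joins the test divisor and is taken off the
  retraction, which shifts r by one and keeps \<open>k\<close>.\<close>

lemma openin_mtopology_of:
  "openin (mtopology_of \<Gamma>) U \<longleftrightarrow> U \<subseteq> mspace \<Gamma> \<and> (\<forall>x\<in>U. \<exists>r>0. mball_of \<Gamma> x r \<subseteq> U)"
  unfolding mtopology_of_def mball_of_def
  using Metric_space.openin_mtopology[OF Metric_space_mspace_mdist, of \<Gamma> U] by auto

lemma mdist_self [simp]: "x \<in> mspace \<Gamma> \<Longrightarrow> mdist \<Gamma> x x = 0"
  by simp

lemma openin_mball_of: "openin (mtopology_of \<Gamma>) (mball_of \<Gamma> x r)"
  unfolding mtopology_of_def mball_of_def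
  by (rule Metric_space.openin_mball[OF Metric_space_mspace_mdist])

text \<open>The image of a \<open>star_chart\<close> is some open set that depends on the chart.
  Here it is the full metric ball of the chart's own radius, so charts with equal centre and radius
  have equal images and can be compared.\<close>

definition ball_chart ::
  "'a metric \<Rightarrow> 'a \<Rightarrow> nat \<Rightarrow> real \<Rightarrow> (nat \<times> real \<Rightarrow> 'a) \<Rightarrow> bool" where
  "ball_chart \<Gamma> v n \<delta> \<phi> \<longleftrightarrow> 0 < \<delta> \<and> \<phi> (0, 0) = v \<and> \<phi> ` mspace (star n \<delta>) = mball_of \<Gamma> v \<delta> \<and>
     (\<forall>x\<in>mspace (star n \<delta>). \<forall>y\<in>mspace (star n \<delta>). mdist \<Gamma> (\<phi> x) (\<phi> y) = star_dist x y)"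

text \<open>Working interface: the radial coordinate is the distance from \<open>v\<close>, so
  surjectivity onto the ball can be stated sphere by sphere with \<open>t\<close> fixed.\<close>

lemma ball_chartD:
  assumes "ball_chart \<Gamma> v n \<delta> \<phi>"
  shows "0 < \<delta>" "\<phi> (0, 0) = v" "v \<in> mspace \<Gamma>"
    and "\<And>k t. \<lbrakk>k < n; 0 < t; t < \<delta>\<rbrakk> \<Longrightarrow> \<phi> (k, t) \<in> mspace \<Gamma>"
    and "\<And>k t. \<lbrakk>k < n; 0 < t; t < \<delta>\<rbrakk> \<Longrightarrow> mdist \<Gamma> v (\<phi> (k, t)) = t"
    and "\<And>k t j u. \<lbrakk>k < n; 0 < t; t < \<delta>; j < n; 0 < u; u < \<delta>\<rbrakk> \<Longrightarrow>
          mdist \<Gamma> (\<phi> (k, t)) (\<phi> (j, u)) = (if k = j then \<bar>t - u\<bar> else t + u)"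
    and "\<And>x t. \<lbrakk>x \<in> mspace \<Gamma>; mdist \<Gamma> v x = t; 0 < t; t < \<delta>\<rbrakk> \<Longrightarrow> \<exists>k<n. \<phi> (k, t) = x"
proof -
  have \<delta>: "0 < \<delta>" and v: "\<phi> (0, 0) = v" and im: "\<phi> ` mspace (star n \<delta>) = mball_of \<Gamma> v \<delta>"
    and iso: "\<And>x y. \<lbrakk>x \<in> mspace (star n \<delta>); y \<in> mspace (star n \<delta>)\<rbrakk> \<Longrightarrow>
       mdist \<Gamma> (\<phi> x) (\<phi> y) = star_dist x y"
    using assms by (auto simp: ball_chart_def)
  show "0 < \<delta>" "\<phi> (0, 0) = v" by fact+
  have "\<phi> (0, 0) \<in> mball_of \<Gamma> v \<delta>" using im by (auto simp: mspace_star)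
  then show "v \<in> mspace \<Gamma>" by auto
  have in_star: "(k, t) \<in> mspace (star n \<delta>)" if "k < n" "0 < t" "t < \<delta>" for k t
    using that by (auto simp: mspace_star)
  show "\<phi> (k, t) \<in> mspace \<Gamma>" if "k < n" "0 < t" "t < \<delta>" for k t
    using imageI[OF in_star[OF that], of \<phi>] im by auto
  show d: "mdist \<Gamma> v (\<phi> (k, t)) = t" if "k < n" "0 < t" "t < \<delta>" for k t
    using iso[of "(0,0)" "(k,t)"] in_star[OF that] that v by (auto simp: mspace_star star_dist_def)
  show "mdist \<Gamma> (\<phi> (k, t)) (\<phi> (j, u)) = (if k = j then \<bar>t - u\<bar> else t + u)"
    if "k < n" "0 < t" "t < \<delta>" "j < n" "0 < u" "u < \<delta>" for k t j u
    using iso[of "(k,t)" "(j,u)"] in_star[of k t] in_star[of j u] that by (auto simp: star_dist_def)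
  show "\<exists>k<n. \<phi> (k, t) = x"
    if x: "x \<in> mspace \<Gamma>" and xt: "mdist \<Gamma> v x = t" and t: "0 < t" "t < \<delta>" for x t
  proof -
    have "x \<in> mball_of \<Gamma> v \<delta>" using x xt t \<open>v \<in> mspace \<Gamma>\<close> by auto
    then obtain y where y: "y \<in> mspace (star n \<delta>)" "x = \<phi> y" unfolding im[symmetric] by auto
    have "y \<noteq> (0, 0)" using mdist_self[OF \<open>v \<in> mspace \<Gamma>\<close>] xt t(1) y(2) v by (metis less_irrefl)
    then obtain k u where kt: "y = (k, u)" "k < n" "0 < u" "u < \<delta>"
      using y(1) by (auto simp: mspace_star)
    have "u = t" using d[OF kt(2-4)] y(2) kt(1) xt by simp
    then show ?thesis using kt y(2) by blast
  qed
qed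

lemma ball_chartI:
  assumes "0 < \<delta>" "\<phi> (0, 0) = v" "v \<in> mspace \<Gamma>"
    and mem: "\<And>k t. \<lbrakk>k < n; 0 < t; t < \<delta>\<rbrakk> \<Longrightarrow> \<phi> (k, t) \<in> mspace \<Gamma>"
    and dist: "\<And>k t. \<lbrakk>k < n; 0 < t; t < \<delta>\<rbrakk> \<Longrightarrow> mdist \<Gamma> v (\<phi> (k, t)) = t"
    and iso: "\<And>k t j u. \<lbrakk>k < n; 0 < t; t < \<delta>; j < n; 0 < u; u < \<delta>\<rbrakk> \<Longrightarrow>
          mdist \<Gamma> (\<phi> (k, t)) (\<phi> (j, u)) = (if k = j then \<bar>t - u\<bar> else t + u)"
    and surj: "\<And>x t. \<lbrakk>x \<in> mspace \<Gamma>; mdist \<Gamma> v x = t; 0 < t; t < \<delta>\<rbrakk> \<Longrightarrow> \<exists>k<n. \<phi> (k, t) = x"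
  shows "ball_chart \<Gamma> v n \<delta> \<phi>"
  unfolding ball_chart_def
proof (intro conjI ballI)
  show "\<phi> ` mspace (star n \<delta>) = mball_of \<Gamma> v \<delta>"
  proof (intro subset_antisym subsetI)
    fix x assume "x \<in> \<phi> ` mspace (star n \<delta>)"
    then show "x \<in> mball_of \<Gamma> v \<delta>"
      using assms(1-3) mem dist mdist_self by (auto simp: mspace_star)
  next
    fix x assume x: "x \<in> mball_of \<Gamma> v \<delta>"
    show "x \<in> \<phi> ` mspace (star n \<delta>)"
    proof (cases "x = v")
      case True
      then show ?thesis using assms(2) by (auto simp: mspace_star)
    next
      case False
      then have pos: "0 < mdist \<Gamma> v x" using x by (metis in_mball_of less_eq_real_def mdist_nonneg mdist_zero)
      then obtain k where "k < n" "\<phi> (k, mdist \<Gamma> v x) = x" using surj[OF _ refl pos] x by auto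
      then show ?thesis using pos x by (intro image_eqI[where x = "(k, mdist \<Gamma> v x)"]) (auto simp: mspace_star)
    qed
  qed
  fix x y assume "x \<in> mspace (star n \<delta>)" "y \<in> mspace (star n \<delta>)"
  then consider "x = (0, 0)" "y = (0, 0)"
    | k t where "x = (k, t)" "y = (0, 0)" "k < n" "0 < t" "t < \<delta>"
    | j u where "x = (0, 0)" "y = (j, u)" "j < n" "0 < u" "u < \<delta>"
    | k t j u where "x = (k, t)" "y = (j, u)" "k < n" "0 < t" "t < \<delta>" "j < n" "0 < u" "u < \<delta>"
    by (auto simp: mspace_star)
  then show "mdist \<Gamma> (\<phi> x) (\<phi> y) = star_dist x y"
  proof cases
    case 1
    then show ?thesis using assms(2,3) by (simp add: star_dist_def)
  next
    case (2 k t)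
    then show ?thesis using assms(2) dist[of k t] by (simp add: star_dist_def mdist_commute)
  next
    case (3 j u)
    then show ?thesis using assms(2) dist[of j u] by (simp add: star_dist_def)
  next
    case (4 k t j u)
    then show ?thesis using iso[of k t j u] by (simp add: star_dist_def)
  qed
qed fact+

lemma ball_chart_shrink:
  assumes "ball_chart \<Gamma> v n \<delta> \<phi>" "0 < \<epsilon>" "\<epsilon> \<le> \<delta>"
  shows "ball_chart \<Gamma> v n \<epsilon> \<phi>"
proof (rule ball_chartI)
  note c = ball_chartD[OF assms(1)]
  show "\<exists>k<n. \<phi> (k, t) = x" if "x \<in> mspace \<Gamma>" "mdist \<Gamma> v x = t" "0 < t" "t < \<epsilon>" for x t
    using c(7)[OF that(1-3)] that(4) assms(3) by simp
qed (use assms(2,3) ball_chartD(2-6)[OF assms(1)] in simp_all)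

lemma ball_chart_imp_star_chart:
  assumes "ball_chart \<Gamma> v n \<delta> \<phi>"
  shows "star_chart \<Gamma> v n \<delta> \<phi>"
  unfolding star_chart_def
proof (intro conjI exI[of _ "mball_of \<Gamma> v \<delta>"])
  show "is_isometry (star n \<delta>) (submetric \<Gamma> (mball_of \<Gamma> v \<delta>)) \<phi>"
    using assms by (auto simp: is_isometry_def ball_chart_def mdist_star)
qed (use assms openin_mball_of in \<open>auto simp: ball_chart_def\<close>)

text \<open>The open image contains a ball of some radius \<open>r\<close>. A point of that ball has
  a preimage in the star whose radial coordinate must be its distance from \<open>v\<close>; hence
  the same map works with radius \<open>min r \<rho>\<close>.\<close>

lemma star_chart_imp_ball_chart:
  assumes "star_chart \<Gamma> v n \<rho> \<phi>"
  obtains \<delta> where "0 < \<delta>" "\<delta> \<le> \<rho>" "ball_chart \<Gamma> v n \<delta> \<phi>"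
proof -
  from assms obtain U where \<rho>: "\<rho> > 0" and v: "\<phi> (0, 0) = v" and U: "openin (mtopology_of \<Gamma>) U"
    and im: "\<phi> ` mspace (star n \<rho>) = U \<inter> mspace \<Gamma>"
    and iso: "\<And>x y. \<lbrakk>x \<in> mspace (star n \<rho>); y \<in> mspace (star n \<rho>)\<rbrakk> \<Longrightarrow>
       mdist \<Gamma> (\<phi> x) (\<phi> y) = star_dist x y"
    by (auto simp: star_chart_def is_isometry_def mdist_star)
  have vU: "v \<in> U" "v \<in> mspace \<Gamma>"
    using im v by (auto simp: mspace_star)
  then obtain r where r: "r > 0" "mball_of \<Gamma> v r \<subseteq> U" using U by (auto simp: openin_mtopology_of)
  have in_star: "(k, t) \<in> mspace (star n \<rho>)" if "k < n" "0 < t" "t < \<rho>" for k t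
    using that by (auto simp: mspace_star)
  have d: "mdist \<Gamma> v (\<phi> (k, t)) = t" if "k < n" "0 < t" "t < \<rho>" for k t
    using iso[of "(0,0)" "(k,t)"] in_star[OF that] that v by (auto simp: mspace_star star_dist_def)
  have "ball_chart \<Gamma> v n (min r \<rho>) \<phi>"
  proof (rule ball_chartI)
    show "\<phi> (k, t) \<in> mspace \<Gamma>" if "k < n" "0 < t" "t < min r \<rho>" for k t
      using imageI[OF in_star, of k t \<phi>] im that by auto
    show "mdist \<Gamma> (\<phi> (k, t)) (\<phi> (j, u)) = (if k = j then \<bar>t - u\<bar> else t + u)"
      if "k < n" "0 < t" "t < min r \<rho>" "j < n" "0 < u" "u < min r \<rho>" for k t j u
      using iso[of "(k,t)" "(j,u)"] in_star[of k t] in_star[of j u] that by (auto simp: star_dist_def)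
    show "\<exists>k<n. \<phi> (k, t) = x"
      if x: "x \<in> mspace \<Gamma>" and xt: "mdist \<Gamma> v x = t" and t: "0 < t" "t < min r \<rho>" for x t
    proof -
      have "x \<in> U \<inter> mspace \<Gamma>" using x xt t r vU by auto
      then obtain y where y: "y \<in> mspace (star n \<rho>)" "x = \<phi> y" unfolding im[symmetric] by auto
      have "y \<noteq> (0, 0)" using mdist_self[OF vU(2)] xt t(1) y(2) v by (metis less_irrefl)
      then obtain k u where kt: "y = (k, u)" "k < n" "0 < u" "u < \<rho>"
        using y(1) by (auto simp: mspace_star)
      have "u = t" using d[OF kt(2-4)] y(2) kt(1) xt by simp
      then show ?thesis using kt y(2) by blast
    qed
  qed (use \<rho> r v vU d in auto)
  then show thesis using that \<rho> r by (metis min.cobounded2 min_less_iff_conj)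
qed

lemma metric_graph_ball_chart:
  assumes "metric_graph \<Gamma>" "v \<in> mspace \<Gamma>"
  obtains n \<delta> \<phi> where "ball_chart \<Gamma> v n \<delta> \<phi>"
  using assms unfolding metric_graph_def by (metis star_chart_imp_ball_chart)

lemma ball_chart_inj:
  assumes "ball_chart \<Gamma> v n \<delta> \<phi>" "k < n" "0 < t" "t < \<delta>" "j < n" "0 < u" "u < \<delta>"
    and "\<phi> (k, t) = \<phi> (j, u)"
  shows "k = j" "t = u"
proof -
  note c = ball_chartD[OF assms(1)]
  have "mdist \<Gamma> (\<phi> (k, t)) (\<phi> (j, u)) = 0"
    unfolding assms(8) using c(4)[OF assms(5-7)] by simp
  then have "(if k = j then \<bar>t - u\<bar> else t + u) = 0"
    unfolding c(6)[OF assms(2-7)] .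
  then show "k = j" "t = u"
    using assms(3,6) by (auto split: if_splits)
qed

text \<open>Every branch meets the sphere of radius \<open>t\<close> in exactly one point. The left
  side depends on the metric alone, which is what makes slope sums independent of the chart.\<close>

lemma ball_chart_sphere:
  assumes "ball_chart \<Gamma> v n \<delta> \<phi>" "0 < t" "t < \<delta>"
  shows "(\<Sum>x | x \<in> mspace \<Gamma> \<and> mdist \<Gamma> v x = t. h x) = (\<Sum>k<n. h (\<phi> (k, t)))"
proof -
  note c = ball_chartD[OF assms(1)]
  have "inj_on (\<lambda>k. \<phi> (k, t)) {..<n}"
    using ball_chart_inj(1)[OF assms(1) _ assms(2,3) _ assms(2,3)] by (intro inj_onI) simp
  moreover have "{x. x \<in> mspace \<Gamma> \<and> mdist \<Gamma> v x = t} = (\<lambda>k. \<phi> (k, t)) ` {..<n}"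
  proof (intro subset_antisym subsetI)
    fix x assume "x \<in> {x. x \<in> mspace \<Gamma> \<and> mdist \<Gamma> v x = t}"
    then obtain k where "k < n" "\<phi> (k, t) = x" using c(7)[of x t] assms(2,3) by auto
    then show "x \<in> (\<lambda>k. \<phi> (k, t)) ` {..<n}" by blast
  next
    fix x assume "x \<in> (\<lambda>k. \<phi> (k, t)) ` {..<n}"
    then obtain k where k: "k < n" and x: "x = \<phi> (k, t)" by auto
    show "x \<in> {x. x \<in> mspace \<Gamma> \<and> mdist \<Gamma> v x = t}"
      unfolding x using c(4,5)[OF k assms(2,3)] by simp
  qed
  ultimately show ?thesis by (simp add: sum.reindex)
qed

text \<open>Match the branches at one radius \<open>t0\<close>. The distance to the matched point is
  |t - t0| on its own branch and t + t0 on any other, so the match persists along the whole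
  branch.\<close>

lemma ball_chart_transition:
  assumes a: "ball_chart \<Gamma> v n \<delta> \<phi>" and b: "ball_chart \<Gamma> v n' \<delta> \<phi>'" and k: "k < n"
  shows "\<exists>k'<n'. \<forall>t. 0 < t \<longrightarrow> t < \<delta> \<longrightarrow> \<phi> (k, t) = \<phi>' (k', t)"
proof -
  note ca = ball_chartD[OF a] and cb = ball_chartD[OF b]
  have ex: "\<exists>k'<n'. \<phi> (k, t) = \<phi>' (k', t)" if "0 < t" "t < \<delta>" for t
    using cb(7)[OF ca(4,5)[OF k that] that] by metis
  define t0 where "t0 = \<delta> / 2"
  have t0: "0 < t0" "t0 < \<delta>" using ca(1) by (auto simp: t0_def)
  then obtain k' where k': "k' < n'" "\<phi> (k, t0) = \<phi>' (k', t0)" using ex by blast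
  have "\<phi> (k, t) = \<phi>' (k', t)" if t: "0 < t" "t < \<delta>" for t
  proof -
    obtain j where j: "j < n'" "\<phi> (k, t) = \<phi>' (j, t)" using ex t by blast
    have "\<bar>t - t0\<bar> = (if j = k' then \<bar>t - t0\<bar> else t + t0)"
      using ca(6)[of k t k t0] cb(6)[of j t k' t0] k t t0 k' j by simp
    then show ?thesis using j t t0 by (auto split: if_splits)
  qed
  then show ?thesis using k' by blast
qed

section \<open>Piecewise linear functions and their slopes\<close>

text \<open>Pointwise form of \<open>pl_function\<close>: on a wedge, the points of either side and
  the wedge point need separate arguments.\<close>

definition locally_linear :: "'a metric \<Rightarrow> ('a \<Rightarrow> real) \<Rightarrow> 'a \<Rightarrow> bool" where
  "locally_linear \<Gamma> f v \<longleftrightarrow> (\<exists>n \<rho> \<phi> s. linear_on_chart \<Gamma> f v n \<rho> \<phi> s)"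

lemma pl_function_iff: "pl_function \<Gamma> f \<longleftrightarrow> (\<forall>v\<in>mspace \<Gamma>. locally_linear \<Gamma> f v)"
  by (simp add: pl_function_def locally_linear_def)

lemma linear_on_ball_chart:
  assumes "ball_chart \<Gamma> v n \<delta> \<phi>"
  shows "linear_on_chart \<Gamma> f v n \<delta> \<phi> s \<longleftrightarrow>
    (\<forall>k<n. \<forall>t. 0 < t \<longrightarrow> t < \<delta> \<longrightarrow> f (\<phi> (k, t)) = f v + of_int (s k) * t)"
  using ball_chart_imp_star_chart[OF assms] by (auto simp: linear_on_chart_def)

text \<open>Valid for all smaller radii at once, so that several charts or functions can be brought
  to a common radius.\<close>

lemma linear_on_chart_shrink:
  assumes "linear_on_chart \<Gamma> f v n \<rho> \<phi> s" 
  obtains \<delta> where "0 < \<delta>" "\<delta> \<le> \<rho>"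
    "\<forall>\<epsilon>\<in>{0<..\<delta>}. ball_chart \<Gamma> v n \<epsilon> \<phi> \<and> linear_on_chart \<Gamma> f v n \<epsilon> \<phi> s"
proof -
  obtain \<delta> where \<delta>: "0 < \<delta>" "\<delta> \<le> \<rho>" "ball_chart \<Gamma> v n \<delta> \<phi>"
    using assms star_chart_imp_ball_chart unfolding linear_on_chart_def by metis
  show thesis
  proof (rule that[OF \<delta>(1,2)], intro ballI)
    fix \<epsilon> assume "\<epsilon> \<in> {0<..\<delta>}"
    then have \<epsilon>: "0 < \<epsilon>" "\<epsilon> \<le> \<delta>" by auto
    have b: "ball_chart \<Gamma> v n \<epsilon> \<phi>" by (rule ball_chart_shrink[OF \<delta>(3) \<epsilon>])
    moreover have "linear_on_chart \<Gamma> f v n \<epsilon> \<phi> s"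
      unfolding linear_on_ball_chart[OF b] using assms \<delta> \<epsilon> by (simp add: linear_on_chart_def)
    ultimately show "ball_chart \<Gamma> v n \<epsilon> \<phi> \<and> linear_on_chart \<Gamma> f v n \<epsilon> \<phi> s" by simp
  qed
qed

lemma linear_on_chartE:
  assumes "linear_on_chart \<Gamma> f v n \<rho> \<phi> s"
  obtains \<delta> where "ball_chart \<Gamma> v n \<delta> \<phi>" "linear_on_chart \<Gamma> f v n \<delta> \<phi> s"
proof -
  obtain \<delta> where "0 < \<delta>" "\<delta> \<le> \<rho>"
    "\<forall>\<epsilon>\<in>{0<..\<delta>}. ball_chart \<Gamma> v n \<epsilon> \<phi> \<and> linear_on_chart \<Gamma> f v n \<epsilon> \<phi> s"
    by (rule linear_on_chart_shrink[OF assms])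
  then show thesis using that[of \<delta>] by simp
qed

text \<open>Branches of two ball charts of equal radius correspond, and the slopes are carried over
  along this correspondence. The chart can thus be prescribed, as sums of functions and wedges
  require.\<close>

lemma locally_linear_on_ball_chart:
  assumes "locally_linear \<Gamma> f v" and b: "ball_chart \<Gamma> v n \<delta> \<phi>"
  obtains \<epsilon> s where "0 < \<epsilon>" "\<epsilon> \<le> \<delta>"
    "\<forall>\<eta>\<in>{0<..\<epsilon>}. ball_chart \<Gamma> v n \<eta> \<phi> \<and> linear_on_chart \<Gamma> f v n \<eta> \<phi> s"
proof -
  obtain n' \<rho> \<phi>' s' where l: "linear_on_chart \<Gamma> f v n' \<rho> \<phi>' s'"
    using assms by (auto simp: locally_linear_def)
  obtain \<delta>' where "0 < \<delta>'" "\<delta>' \<le> \<rho>" and \<delta>':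
    "\<forall>\<epsilon>\<in>{0<..\<delta>'}. ball_chart \<Gamma> v n' \<epsilon> \<phi>' \<and> linear_on_chart \<Gamma> f v n' \<epsilon> \<phi>' s'"
    by (rule linear_on_chart_shrink[OF l])
  define \<epsilon> where "\<epsilon> = min \<delta> \<delta>'"
  have \<epsilon>: "0 < \<epsilon>" "\<epsilon> \<le> \<delta>" "\<epsilon> \<le> \<delta>'" using \<open>0 < \<delta>'\<close> ball_chartD(1)[OF b] by (auto simp: \<epsilon>_def)
  have b1: "ball_chart \<Gamma> v n \<epsilon> \<phi>" by (rule ball_chart_shrink[OF b \<epsilon>(1,2)])
  have b2: "ball_chart \<Gamma> v n' \<epsilon> \<phi>'" and l2: "linear_on_chart \<Gamma> f v n' \<epsilon> \<phi>' s'" using \<delta>' \<epsilon> by auto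
  have "\<exists>s. \<forall>t. 0 < t \<longrightarrow> t < \<epsilon> \<longrightarrow> f (\<phi> (k, t)) = f v + of_int s * t" if k: "k < n" for k
  proof -
    obtain k' where "k' < n'" "\<forall>t. 0 < t \<longrightarrow> t < \<epsilon> \<longrightarrow> \<phi> (k, t) = \<phi>' (k', t)"
      using ball_chart_transition[OF b1 b2 k] by blast
    then show ?thesis using l2 unfolding linear_on_ball_chart[OF b2] by metis
  qed
  then obtain s where s: "\<And>k t. \<lbrakk>k < n; 0 < t; t < \<epsilon>\<rbrakk> \<Longrightarrow> f (\<phi> (k, t)) = f v + of_int (s k) * t"
    by metis
  show thesis
  proof (rule that[OF \<epsilon>(1,2), of s], intro ballI)
    fix \<eta> assume "\<eta> \<in> {0<..\<epsilon>}"
    then have \<eta>: "0 < \<eta>" "\<eta> \<le> \<epsilon>" by auto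
    have b: "ball_chart \<Gamma> v n \<eta> \<phi>" by (rule ball_chart_shrink[OF b1 \<eta>])
    then show "ball_chart \<Gamma> v n \<eta> \<phi> \<and> linear_on_chart \<Gamma> f v n \<eta> \<phi> s"
      using s \<eta> by (auto simp: linear_on_ball_chart[OF b])
  qed
qed

text \<open>Generalizes \<open>ord_at\<close> to a weight \<open>\<psi>\<close> on the outgoing
  slopes, so that one proof of chart independence covers both the order (\<open>uminus\<close>) and
  the fluxes through a level (\<open>max 0\<close> and its mirror image).\<close>

definition slope_sum :: "'a metric \<Rightarrow> ('a \<Rightarrow> real) \<Rightarrow> (int \<Rightarrow> int) \<Rightarrow> 'a \<Rightarrow> int" where
  "slope_sum \<Gamma> f \<psi> v =
     (THE m. \<exists>n \<rho> \<phi> s. linear_on_chart \<Gamma> f v n \<rho> \<phi> s \<and> m = (\<Sum>k<n. \<psi> (s k)))"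

lemma ord_at_eq_slope_sum: "ord_at \<Gamma> f v = slope_sum \<Gamma> f uminus v"
  by (simp add: ord_at_def slope_sum_def)

text \<open>The left-hand side mentions no chart, so the sum over the slopes is independent of it.\<close>

lemma slope_sum_sphere:
  assumes "linear_on_chart \<Gamma> f v n \<rho> \<phi> s"
  obtains \<delta> where "0 < \<delta>" "\<forall>t\<in>{0<..<\<delta>}.
    (\<Sum>x | x \<in> mspace \<Gamma> \<and> mdist \<Gamma> v x = t. \<psi> \<lfloor>(f x - f v) / t\<rfloor>) = (\<Sum>k<n. \<psi> (s k))"
proof -
  obtain \<delta> where b: "ball_chart \<Gamma> v n \<delta> \<phi>" and l: "linear_on_chart \<Gamma> f v n \<delta> \<phi> s"
    by (rule linear_on_chartE[OF assms])
  show thesis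
  proof (rule that[OF ball_chartD(1)[OF b]], intro ballI)
    fix t assume "t \<in> {0<..<\<delta>}"
    then have t: "0 < t" "t < \<delta>" by auto
    \<comment> \<open>On a branch the difference quotient equals the integer slope exactly; the
      floor merely converts it from a real to an integer.\<close>
    show "(\<Sum>x | x \<in> mspace \<Gamma> \<and> mdist \<Gamma> v x = t. \<psi> \<lfloor>(f x - f v) / t\<rfloor>) = (\<Sum>k<n. \<psi> (s k))"
      unfolding ball_chart_sphere[OF b t] using l t
      by (intro sum.cong) (auto simp: linear_on_ball_chart[OF b])
  qed
qed

text \<open>Two charts give the same value because both compute the sphere sum at a common small
  radius.\<close>

lemma slope_sum_eq:
  assumes "linear_on_chart \<Gamma> f v n \<rho> \<phi> s"
  shows "slope_sum \<Gamma> f \<psi> v = (\<Sum>k<n. \<psi> (s k))"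
  unfolding slope_sum_def
proof (rule the_equality)
  fix m assume "\<exists>n \<rho> \<phi> s. linear_on_chart \<Gamma> f v n \<rho> \<phi> s \<and> m = (\<Sum>k<n. \<psi> (s k))"
  then obtain n' \<rho>' \<phi>' s' where l': "linear_on_chart \<Gamma> f v n' \<rho>' \<phi>' s'" and m: "m = (\<Sum>k<n'. \<psi> (s' k))"
    by blast
  obtain \<delta> where \<delta>: "0 < \<delta>" "\<forall>t\<in>{0<..<\<delta>}.
    (\<Sum>x | x \<in> mspace \<Gamma> \<and> mdist \<Gamma> v x = t. \<psi> \<lfloor>(f x - f v) / t\<rfloor>) = (\<Sum>k<n. \<psi> (s k))"
    by (rule slope_sum_sphere[OF assms])
  obtain \<delta>' where \<delta>': "0 < \<delta>'" "\<forall>t\<in>{0<..<\<delta>'}.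
    (\<Sum>x | x \<in> mspace \<Gamma> \<and> mdist \<Gamma> v x = t. \<psi> \<lfloor>(f x - f v) / t\<rfloor>) = (\<Sum>k<n'. \<psi> (s' k))"
    by (rule slope_sum_sphere[OF l'])
  show "m = (\<Sum>k<n. \<psi> (s k))"
    using \<delta>(2)[rule_format, of "min \<delta> \<delta>' / 2"] \<delta>'(2)[rule_format, of "min \<delta> \<delta>' / 2"] \<delta>(1) \<delta>'(1) m
    by simp
qed (use assms in blast)

lemma ord_at_eq:
  assumes "linear_on_chart \<Gamma> f v n \<rho> \<phi> s"
  shows "ord_at \<Gamma> f v = (\<Sum>k<n. - s k)"
  using slope_sum_eq[OF assms] by (simp add: ord_at_eq_slope_sum)

lemma locally_linear_const:
  assumes "star_chart \<Gamma> v n \<rho> \<phi>"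
  shows "locally_linear \<Gamma> (\<lambda>x. c) v" "ord_at \<Gamma> (\<lambda>x. c) v = 0"
proof -
  have l: "linear_on_chart \<Gamma> (\<lambda>x. c) v n \<rho> \<phi> (\<lambda>k. 0)"
    using assms by (simp add: linear_on_chart_def)
  then show "locally_linear \<Gamma> (\<lambda>x. c) v" by (auto simp: locally_linear_def)
  show "ord_at \<Gamma> (\<lambda>x. c) v = 0" using ord_at_eq[OF l] by simp
qed

lemma locally_linear_uminus:
  assumes "locally_linear \<Gamma> f v"
  shows "locally_linear \<Gamma> (\<lambda>x. - f x) v"
    and "slope_sum \<Gamma> (\<lambda>x. - f x) \<psi> v = slope_sum \<Gamma> f (\<lambda>s. \<psi> (- s)) v"
    and "ord_at \<Gamma> (\<lambda>x. - f x) v = - ord_at \<Gamma> f v"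
proof -
  obtain n \<rho> \<phi> s where l: "linear_on_chart \<Gamma> f v n \<rho> \<phi> s"
    using assms by (auto simp: locally_linear_def)
  then have l': "linear_on_chart \<Gamma> (\<lambda>x. - f x) v n \<rho> \<phi> (\<lambda>k. - s k)"
    by (simp add: linear_on_chart_def)
  then show "locally_linear \<Gamma> (\<lambda>x. - f x) v" by (auto simp: locally_linear_def)
  show "slope_sum \<Gamma> (\<lambda>x. - f x) \<psi> v = slope_sum \<Gamma> f (\<lambda>s. \<psi> (- s)) v"
    using slope_sum_eq[OF l] slope_sum_eq[OF l'] by simp
  show "ord_at \<Gamma> (\<lambda>x. - f x) v = - ord_at \<Gamma> f v"
    using ord_at_eq[OF l] ord_at_eq[OF l'] by (simp add: sum_negf)
qed

text \<open>\<open>g\<close> is made linear on the chart that came with \<open>f\<close>; slopes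
  then add branch by branch.\<close>

lemma locally_linear_add:
  assumes f: "locally_linear \<Gamma> f v" and g: "locally_linear \<Gamma> g v"
  shows "locally_linear \<Gamma> (\<lambda>x. f x + g x) v"
    and "ord_at \<Gamma> (\<lambda>x. f x + g x) v = ord_at \<Gamma> f v + ord_at \<Gamma> g v"
proof -
  obtain n \<rho> \<phi> s where l: "linear_on_chart \<Gamma> f v n \<rho> \<phi> s"
    using f by (auto simp: locally_linear_def)
  obtain \<delta> where \<delta>: "0 < \<delta>" "\<delta> \<le> \<rho>"
    "\<forall>\<epsilon>\<in>{0<..\<delta>}. ball_chart \<Gamma> v n \<epsilon> \<phi> \<and> linear_on_chart \<Gamma> f v n \<epsilon> \<phi> s"
    by (rule linear_on_chart_shrink[OF l])
  then have b: "ball_chart \<Gamma> v n \<delta> \<phi>" by simp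
  obtain \<epsilon> s' where \<epsilon>: "0 < \<epsilon>" "\<epsilon> \<le> \<delta>" and
    "\<forall>\<eta>\<in>{0<..\<epsilon>}. ball_chart \<Gamma> v n \<eta> \<phi> \<and> linear_on_chart \<Gamma> g v n \<eta> \<phi> s'"
    by (rule locally_linear_on_ball_chart[OF g b])
  then have lg: "linear_on_chart \<Gamma> g v n \<epsilon> \<phi> s'" by simp
  have lf: "linear_on_chart \<Gamma> f v n \<epsilon> \<phi> s" using \<delta> \<epsilon> by simp
  have l: "linear_on_chart \<Gamma> (\<lambda>x. f x + g x) v n \<epsilon> \<phi> (\<lambda>k. s k + s' k)"
    using lf lg by (auto simp: linear_on_chart_def algebra_simps)
  then show "locally_linear \<Gamma> (\<lambda>x. f x + g x) v" by (auto simp: locally_linear_def)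
  show "ord_at \<Gamma> (\<lambda>x. f x + g x) v = ord_at \<Gamma> f v + ord_at \<Gamma> g v"
    using ord_at_eq[OF l] ord_at_eq[OF lf] ord_at_eq[OF lg] by (simp add: sum_negf sum.distrib sum_subtractf)
qed

text \<open>Away from the centre a branch is an open interval, so its points have valence 2. Branch
  0 leads back to \<open>v\<close> and branch 1 away from it; the bounds on
  \<open>\<epsilon>\<close> keep both inside the old branch.\<close>

lemma ball_chart_branch:
  assumes b: "ball_chart \<Gamma> v n \<delta> \<phi>" and k: "k < n" and t: "0 < t" "t < \<delta>"
    and \<epsilon>: "0 < \<epsilon>" "\<epsilon> \<le> t" "\<epsilon> \<le> \<delta> - t"
  shows "ball_chart \<Gamma> (\<phi> (k, t)) 2 \<epsilon> (\<lambda>(j, u). \<phi> (k, if j = 0 then t - u else t + u))"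
proof (rule ball_chartI)
  note c = ball_chartD[OF b]
  have in_ran: "0 < (if j = (0::nat) then t - u else t + u) \<and> (if j = 0 then t - u else t + u) < \<delta>"
    if "0 < u" "u < \<epsilon>" for j u using that t \<epsilon> by auto
  show "\<phi> (k, t) \<in> mspace \<Gamma>" using c k t by blast
  show "(case (j, u) of (j, u) \<Rightarrow> \<phi> (k, if j = 0 then t - u else t + u)) \<in> mspace \<Gamma>"
    if "0 < u" "u < \<epsilon>" for j :: nat and u
    using c(4)[OF k] in_ran[OF that, of j] by simp
  show "mdist \<Gamma> (\<phi> (k, t)) (case (j, u) of (j, u) \<Rightarrow> \<phi> (k, if j = 0 then t - u else t + u)) = u"
    if "0 < u" "u < \<epsilon>" for j :: nat and u
    using c(6)[OF k t k] in_ran[OF that, of j] that by auto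
  show "mdist \<Gamma> (case (i, w) of (j, u) \<Rightarrow> \<phi> (k, if j = 0 then t - u else t + u))
      (case (j, u) of (j, u) \<Rightarrow> \<phi> (k, if j = 0 then t - u else t + u)) =
      (if i = j then \<bar>w - u\<bar> else w + u)"
    if "i < 2" "0 < w" "w < \<epsilon>" "j < 2" "0 < u" "u < \<epsilon>" for i j :: nat and w u
    using c(6)[OF k _ _ k] in_ran[OF that(2,3), of i] in_ran[OF that(5,6), of j] that by auto
  show "\<exists>j<2::nat. (case (j, w) of (j, u) \<Rightarrow> \<phi> (k, if j = 0 then t - u else t + u)) = x"
    if x: "x \<in> mspace \<Gamma>" "mdist \<Gamma> (\<phi> (k, t)) x = w" "0 < w" "w < \<epsilon>" for x w
  proof -
    have kt: "\<phi> (k, t) \<in> mspace \<Gamma>" "mdist \<Gamma> v (\<phi> (k, t)) = t" using c k t by auto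
    \<comment> \<open>The triangle inequality places \<open>x\<close> in the ball around
      \<open>v\<close> but away from \<open>v\<close>; a different branch is excluded because there
      the distance would exceed \<open>t\<close>.\<close>
    have "mdist \<Gamma> v x < \<delta>" using mdist_triangle[of v \<Gamma> "\<phi> (k, t)" x] x kt c(3) \<epsilon> by simp
    moreover have "0 < mdist \<Gamma> v x"
      using mdist_triangle[of v \<Gamma> x "\<phi> (k, t)"] x kt c(3) \<epsilon> mdist_commute[of \<Gamma> x "\<phi> (k, t)"] by simp
    ultimately obtain j u where j: "j < n" "x = \<phi> (j, u)" "0 < u" "u < \<delta>"
      using c(7)[OF x(1) refl] by metis
    have d: "mdist \<Gamma> (\<phi> (k, t)) x = (if k = j then \<bar>t - u\<bar> else t + u)"
      using c(6)[OF k t] j by simp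
    with x \<epsilon> j have "k = j" by (auto split: if_splits)
    with d x j have "u = t - w \<or> u = t + w" by auto
    then show ?thesis
    proof
      assume "u = t - w"
      then show ?thesis using j \<open>k = j\<close> by (intro exI[of _ 0]) auto
    next
      assume "u = t + w"
      then show ?thesis using j \<open>k = j\<close> by (intro exI[of _ 1]) auto
    qed
  qed
qed (use \<epsilon> in auto)

text \<open>The two outgoing slopes at an interior point of a branch are opposite. Order 0 confines
  the support of the divisor to chart centres; a general \<open>\<psi>\<close> measures the flux
  through one branch.\<close>

lemma slope_sum_branch:
  assumes b: "ball_chart \<Gamma> v n \<delta> \<phi>" and l: "linear_on_chart \<Gamma> f v n \<delta> \<phi> s"
    and k: "k < n" and t: "0 < t" "t < \<delta>"
  shows "slope_sum \<Gamma> f \<psi> (\<phi> (k, t)) = \<psi> (- s k) + \<psi> (s k)"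
    and "ord_at \<Gamma> f (\<phi> (k, t)) = 0"
proof -
  define \<epsilon> where "\<epsilon> = min t (\<delta> - t)"
  have \<epsilon>: "0 < \<epsilon>" "\<epsilon> \<le> t" "\<epsilon> \<le> \<delta> - t" using t by (auto simp: \<epsilon>_def)
  note b' = ball_chart_branch[OF b k t \<epsilon>]
  have f: "f (\<phi> (k, u)) = f v + of_int (s k) * u" if "0 < u" "u < \<delta>" for u
    using l k that by (auto simp: linear_on_ball_chart[OF b])
  have "linear_on_chart \<Gamma> f (\<phi> (k, t)) 2 \<epsilon> (\<lambda>(j, u). \<phi> (k, if j = 0 then t - u else t + u))
     (\<lambda>j. if j = 0 then - s k else s k)"
    unfolding linear_on_ball_chart[OF b'] using t \<epsilon> by (auto simp: f algebra_simps)
  from slope_sum_eq[OF this] show *: "slope_sum \<Gamma> f \<psi> (\<phi> (k, t)) = \<psi> (- s k) + \<psi> (s k)" for \<psi>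
    by (simp add: numeral_2_eq_2)
  show "ord_at \<Gamma> f (\<phi> (k, t)) = 0" by (simp add: ord_at_eq_slope_sum *)
qed

lemma finite_ball_cover:
  assumes K: "compactin (mtopology_of \<Gamma>) K" and r: "\<And>v. v \<in> K \<Longrightarrow> 0 < r v"
  obtains V where "finite V" "V \<subseteq> K" "K \<subseteq> (\<Union>v\<in>V. mball_of \<Gamma> v (r v))"
proof -
  have "K \<subseteq> mspace \<Gamma>" using compactin_subset_topspace[OF K] by simp
  then have "K \<subseteq> \<Union>((\<lambda>v. mball_of \<Gamma> v (r v)) ` K)" using r by fastforce
  then have "\<exists>F. finite F \<and> F \<subseteq> (\<lambda>v. mball_of \<Gamma> v (r v)) ` K \<and> K \<subseteq> \<Union>F"
    by (intro compactinD[OF K]) (auto simp: openin_mball_of)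
  then obtain F where "finite F" "F \<subseteq> (\<lambda>v. mball_of \<Gamma> v (r v)) ` K" "K \<subseteq> \<Union>F" by auto
  moreover from this(1,2) obtain V where "V \<subseteq> K" "finite V" "F = (\<lambda>v. mball_of \<Gamma> v (r v)) ` V"
    by (auto dest: finite_subset_image)
  ultimately show thesis using that[of V] by simp
qed

text \<open>A chart ball on which \<open>f\<close> is linear can carry order only at its centre, so
  the centres of a finite cover by such balls contain the support.\<close>

lemma finite_ord_at_support:
  assumes "compact_space (mtopology_of \<Gamma>)" and "pl_function \<Gamma> f"
  shows "finite {v \<in> mspace \<Gamma>. ord_at \<Gamma> f v \<noteq> 0}"
proof -
  have "\<exists>\<delta>>0. \<forall>x\<in>mball_of \<Gamma> v \<delta>. x \<noteq> v \<longrightarrow> ord_at \<Gamma> f x = 0" if v: "v \<in> mspace \<Gamma>" for v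
  proof -
    obtain n \<rho> \<phi> s where "linear_on_chart \<Gamma> f v n \<rho> \<phi> s"
      using assms(2) v unfolding pl_function_def by blast
    then obtain \<delta> where b: "ball_chart \<Gamma> v n \<delta> \<phi>" and l: "linear_on_chart \<Gamma> f v n \<delta> \<phi> s"
      by (rule linear_on_chartE)
    have "ord_at \<Gamma> f x = 0" if "x \<in> mball_of \<Gamma> v \<delta>" "x \<noteq> v" for x
    proof -
      have "0 < mdist \<Gamma> v x" using that by (metis in_mball_of less_eq_real_def mdist_nonneg mdist_zero)
      moreover have "mdist \<Gamma> v x < \<delta>" "x \<in> mspace \<Gamma>" using that by auto
      ultimately show ?thesis
        using ball_chartD(7)[OF b _ refl] slope_sum_branch(2)[OF b l] by metis
    qed
    then show ?thesis using ball_chartD(1)[OF b] by blast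
  qed
  then obtain r where r: "\<And>v. v \<in> mspace \<Gamma> \<Longrightarrow> 0 < r v"
    "\<And>v x. \<lbrakk>v \<in> mspace \<Gamma>; x \<in> mball_of \<Gamma> v (r v); x \<noteq> v\<rbrakk> \<Longrightarrow> ord_at \<Gamma> f x = 0"
    by metis
  obtain V where V: "finite V" "V \<subseteq> mspace \<Gamma>" "mspace \<Gamma> \<subseteq> (\<Union>v\<in>V. mball_of \<Gamma> v (r v))"
    using finite_ball_cover[of \<Gamma> "mspace \<Gamma>" r] assms(1) r(1) by (auto simp: compact_space_def)
  have "{v \<in> mspace \<Gamma>. ord_at \<Gamma> f v \<noteq> 0} \<subseteq> V" using V r(2) by blast
  then show ?thesis using V(1) finite_subset by blast
qed

section \<open>Principal divisors have degree zero\<close>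

lemma mdist_pos: "\<lbrakk>x \<in> mspace \<Gamma>; y \<in> mspace \<Gamma>; x \<noteq> y\<rbrakk> \<Longrightarrow> 0 < mdist \<Gamma> x y"
  using mdist_nonneg[of \<Gamma> x y] mdist_zero[of x \<Gamma> y] by linarith

lemma ball_chart_cases:
  assumes "ball_chart \<Gamma> v n \<delta> \<phi>" "y \<in> mball_of \<Gamma> v \<delta>"
  obtains "y = v" | k t where "k < n" "0 < t" "t < \<delta>" "y = \<phi> (k, t)"
proof (cases "y = v")
  case False
  have y: "y \<in> mspace \<Gamma>" "v \<in> mspace \<Gamma>" "mdist \<Gamma> v y < \<delta>" using assms(2) by auto
  then have "0 < mdist \<Gamma> v y" using mdist_pos False by metis
  moreover obtain k where "k < n" "\<phi> (k, mdist \<Gamma> v y) = y"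
    using ball_chartD(7)[OF assms(1) y(1) refl calculation y(3)] by auto
  ultimately show ?thesis using that(2) y(3) by metis
qed (use that in auto)

section \<open>Continuity, boundedness and level sets\<close>

lemma locally_linear_continuous:
  assumes "locally_linear \<Gamma> f v" "0 < e"
  obtains r where "0 < r" "\<forall>y\<in>mball_of \<Gamma> v r. \<bar>f y - f v\<bar> < e"
proof -
  obtain n \<rho> \<phi> s where "linear_on_chart \<Gamma> f v n \<rho> \<phi> s"
    using assms(1) by (auto simp: locally_linear_def)
  then obtain \<delta> where b: "ball_chart \<Gamma> v n \<delta> \<phi>" and l: "linear_on_chart \<Gamma> f v n \<delta> \<phi> s"
    by (rule linear_on_chartE)
  \<comment> \<open>Adding 1 keeps \<open>M\<close> positive even if there are no branches or all
    slopes vanish.\<close>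
  define M where "M = (\<Sum>k<n. \<bar>of_int (s k) :: real\<bar>) + 1"
  have M: "\<bar>of_int (s k)\<bar> \<le> M" if "k < n" for k
  proof -
    have "\<bar>of_int (s k) :: real\<bar> \<le> (\<Sum>k<n. \<bar>of_int (s k) :: real\<bar>)"
      using that by (intro member_le_sum) auto
    then show ?thesis by (simp add: M_def)
  qed
  have "0 < M" unfolding M_def by (intro add_nonneg_pos sum_nonneg) auto
  define r where "r = min \<delta> (e / M)"
  have "0 < r" using ball_chartD(1)[OF b] assms(2) \<open>0 < M\<close> by (simp add: r_def)
  moreover have "\<bar>f y - f v\<bar> < e" if y: "y \<in> mball_of \<Gamma> v r" for y
  proof -
    have b': "ball_chart \<Gamma> v n r \<phi>"
      by (rule ball_chart_shrink[OF b \<open>0 < r\<close>]) (simp add: r_def)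
    show ?thesis
    proof (rule ball_chart_cases[OF b' y])
      assume "y = v"
      then show ?thesis using assms(2) by simp
    next
      fix k t assume kt: "k < n" "0 < t" "t < r" "y = \<phi> (k, t)"
      have "f y - f v = of_int (s k) * t"
        using l kt by (simp add: linear_on_ball_chart[OF b] r_def)
      moreover have "\<bar>of_int (s k) * t\<bar> \<le> M * t"
        using M[OF kt(1)] kt(2) by (simp add: abs_mult)
      moreover have "M * t < e" using kt(3) \<open>0 < M\<close> by (simp add: r_def field_simps)
      ultimately show ?thesis by simp
    qed
  qed
  ultimately show thesis using that by blast
qed

text \<open>On each ball of a finite cover, \<open>f\<close> differs from its value at the centre by
  less than 1.\<close>

lemma pl_function_bounded:
  assumes "compact_space (mtopology_of \<Gamma>)" "pl_function \<Gamma> f"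
  obtains B where "\<forall>x\<in>mspace \<Gamma>. \<bar>f x\<bar> < B"
proof -
  have "\<forall>v\<in>mspace \<Gamma>. \<exists>r. 0 < r \<and> (\<forall>y\<in>mball_of \<Gamma> v r. \<bar>f y - f v\<bar> < 1)"
    using assms(2) unfolding pl_function_iff by (metis locally_linear_continuous zero_less_one)
  then obtain r where r: "\<forall>v\<in>mspace \<Gamma>. 0 < r v \<and> (\<forall>y\<in>mball_of \<Gamma> v (r v). \<bar>f y - f v\<bar> < 1)"
    by (rule bchoice[THEN exE])
  obtain V where V: "finite V" "V \<subseteq> mspace \<Gamma>" "mspace \<Gamma> \<subseteq> (\<Union>v\<in>V. mball_of \<Gamma> v (r v))"
    using finite_ball_cover[of \<Gamma> "mspace \<Gamma>" r] assms(1) r by (auto simp: compact_space_def)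
  have "\<bar>f x\<bar> < (\<Sum>v\<in>V. \<bar>f v\<bar>) + 1" if x: "x \<in> mspace \<Gamma>" for x
  proof -
    obtain v where v: "v \<in> V" "x \<in> mball_of \<Gamma> v (r v)" using V x by blast
    then have "\<bar>f x - f v\<bar> < 1" using r V(2) by blast
    moreover have "\<bar>f v\<bar> \<le> (\<Sum>v\<in>V. \<bar>f v\<bar>)" using V(1) v(1) by (intro member_le_sum) auto
    ultimately show ?thesis by linarith
  qed
  then show thesis using that by blast
qed

text \<open>A level may contain whole segments. Compactness still yields finitely many charts
  centred on it: around points off the level take balls where \<open>f\<close> stays away from
  \<open>c\<close>, so that only centres on the level account for values near
  \<open>c\<close>.\<close>

lemma level_set_charts:
  assumes "compact_space (mtopology_of \<Gamma>)" "pl_function \<Gamma> f"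
  obtains V \<epsilon> n \<delta> \<phi> s where "finite V" "0 < \<epsilon>"
    "\<forall>v\<in>V. v \<in> mspace \<Gamma> \<and> f v = c \<and> ball_chart \<Gamma> v (n v) (\<delta> v) (\<phi> v) \<and>
        linear_on_chart \<Gamma> f v (n v) (\<delta> v) (\<phi> v) (s v)"
    "\<forall>v\<in>V. \<epsilon> \<le> \<delta> v"
    "\<forall>v\<in>V. \<forall>w\<in>V. v \<noteq> w \<longrightarrow> 2 * \<epsilon> \<le> mdist \<Gamma> v w"
    "\<forall>y\<in>mspace \<Gamma>. \<bar>f y - c\<bar> < \<epsilon> \<longrightarrow>
        (\<exists>v\<in>V. y = v \<or> (\<exists>k<n v. \<exists>t. 0 < t \<and> t < \<delta> v \<and> y = \<phi> v (k, t)))"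
proof -
  have "\<forall>v\<in>mspace \<Gamma>. \<exists>r. 0 < r \<and> (f v \<noteq> c \<longrightarrow> (\<forall>y\<in>mball_of \<Gamma> v r. \<bar>f y - f v\<bar> < \<bar>f v - c\<bar> / 2))"
  proof
    fix v assume "v \<in> mspace \<Gamma>"
    then have l: "locally_linear \<Gamma> f v" using assms(2) by (simp add: pl_function_iff)
    show "\<exists>r. 0 < r \<and> (f v \<noteq> c \<longrightarrow> (\<forall>y\<in>mball_of \<Gamma> v r. \<bar>f y - f v\<bar> < \<bar>f v - c\<bar> / 2))"
    proof (cases "f v = c")
      case False
      then have "0 < \<bar>f v - c\<bar> / 2" by simp
      then show ?thesis using locally_linear_continuous[OF l] by metis
    qed (auto intro: exI[of _ 1])
  qed
  then obtain r1 where r1: "\<forall>v\<in>mspace \<Gamma>. 0 < r1 v \<and>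
      (f v \<noteq> c \<longrightarrow> (\<forall>y\<in>mball_of \<Gamma> v (r1 v). \<bar>f y - f v\<bar> < \<bar>f v - c\<bar> / 2))"
    by (rule bchoice[THEN exE])
  have "\<forall>v\<in>mspace \<Gamma>. \<exists>q. case q of (n, \<delta>, \<phi>, s) \<Rightarrow>
      ball_chart \<Gamma> v n \<delta> \<phi> \<and> linear_on_chart \<Gamma> f v n \<delta> \<phi> s"
  proof
    fix v assume "v \<in> mspace \<Gamma>"
    then obtain n \<rho> \<phi> s where "linear_on_chart \<Gamma> f v n \<rho> \<phi> s"
      using assms(2) unfolding pl_function_def by blast
    then obtain \<delta> where "ball_chart \<Gamma> v n \<delta> \<phi>" "linear_on_chart \<Gamma> f v n \<delta> \<phi> s"
      by (rule linear_on_chartE)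
    then show "\<exists>q. case q of (n, \<delta>, \<phi>, s) \<Rightarrow>
      ball_chart \<Gamma> v n \<delta> \<phi> \<and> linear_on_chart \<Gamma> f v n \<delta> \<phi> s"
      by (intro exI[of _ "(n, \<delta>, \<phi>, s)"]) simp
  qed
  then obtain q where q: "\<forall>v\<in>mspace \<Gamma>. case q v of (n, \<delta>, \<phi>, s) \<Rightarrow>
      ball_chart \<Gamma> v n \<delta> \<phi> \<and> linear_on_chart \<Gamma> f v n \<delta> \<phi> s"
    by (rule bchoice[THEN exE])
  define n \<delta> \<phi> s where "n v = fst (q v)" and "\<delta> v = fst (snd (q v))"
    and "\<phi> v = fst (snd (snd (q v)))" and "s v = snd (snd (snd (q v)))" for v
  have ch: "ball_chart \<Gamma> v (n v) (\<delta> v) (\<phi> v)" "linear_on_chart \<Gamma> f v (n v) (\<delta> v) (\<phi> v) (s v)"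
    if "v \<in> mspace \<Gamma>" for v
    using bspec[OF q that] by (simp_all add: n_def \<delta>_def \<phi>_def s_def case_prod_unfold)
  \<comment> \<open>Centres on the level keep the whole chart ball; every other centre gets a ball
    on which \<open>f\<close> retains more than half of its distance from \<open>c\<close>.\<close>
  define r where "r v = (if f v = c then \<delta> v else r1 v)" for v
  have "0 < r v" if "v \<in> mspace \<Gamma>" for v
    using r1 that ball_chartD(1)[OF ch(1)[OF that]] by (simp add: r_def)
  then obtain W where W: "finite W" "W \<subseteq> mspace \<Gamma>" "mspace \<Gamma> \<subseteq> (\<Union>v\<in>W. mball_of \<Gamma> v (r v))"
    using finite_ball_cover[of \<Gamma> "mspace \<Gamma>" r] assms(1) by (auto simp: compact_space_def)
  define V where "V = {v \<in> W. f v = c}"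
  \<comment> \<open>All upper bounds imposed on \<open>\<epsilon>\<close>. The element 1 keeps the
    set nonempty, and halving the distances gives the factor 2 in the separation.\<close>
  define E where "E = insert 1 ((\<lambda>v. \<bar>f v - c\<bar> / 2) ` (W - V) \<union> \<delta> ` V \<union>
      (\<lambda>(v, w). mdist \<Gamma> v w / 2) ` {(v, w) \<in> V \<times> V. v \<noteq> w})"
  have "finite V" using W(1) by (simp add: V_def)
  moreover have "finite {(v, w) \<in> V \<times> V. v \<noteq> w}"
    by (rule finite_subset[of _ "V \<times> V"]) (use \<open>finite V\<close> in auto)
  ultimately have "finite E" using W(1) by (simp add: E_def)
  have "\<forall>e\<in>E. 0 < e"
  proof -
    have "0 < mdist \<Gamma> v w" if "v \<in> V" "w \<in> V" "v \<noteq> w" for v w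
      using that W(2) by (intro mdist_pos) (auto simp: V_def)
    moreover have "0 < \<delta> v" if "v \<in> V" for v
      using ball_chartD(1)[OF ch(1)] that W(2) by (auto simp: V_def)
    ultimately show ?thesis unfolding E_def by (auto simp: V_def)
  qed
  define \<epsilon> where "\<epsilon> = Min E"
  have "0 < \<epsilon>" using \<open>\<forall>e\<in>E. 0 < e\<close> \<open>finite E\<close> by (auto simp: \<epsilon>_def E_def)
  have le: "\<epsilon> \<le> e" if "e \<in> E" for e using that \<open>finite E\<close> by (simp add: \<epsilon>_def)
  have cover: "\<exists>v\<in>V. y = v \<or> (\<exists>k<n v. \<exists>t. 0 < t \<and> t < \<delta> v \<and> y = \<phi> v (k, t))"
    if y: "y \<in> mspace \<Gamma>" "\<bar>f y - c\<bar> < \<epsilon>" for y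
  proof -
    obtain v where v: "v \<in> W" "y \<in> mball_of \<Gamma> v (r v)" using W(3) y(1) by blast
    have vm: "v \<in> mspace \<Gamma>" using v W(2) by blast
    have fv: "f v = c"
    proof (rule ccontr)
      assume "f v \<noteq> c"
      then have "\<bar>f y - f v\<bar> < \<bar>f v - c\<bar> / 2" using r1 vm v(2) by (simp add: r_def)
      moreover have "\<epsilon> \<le> \<bar>f v - c\<bar> / 2"
        using v \<open>f v \<noteq> c\<close> by (intro le) (auto simp: E_def V_def)
      moreover have "\<bar>f v - c\<bar> \<le> \<bar>f y - f v\<bar> + \<bar>f y - c\<bar>" by arith
      moreover have False if "a < h / 2" "e \<le> h / 2" "h \<le> a + b" "b < e" for a b h e :: real
        using that by linarith
      ultimately show False using y(2) by blast
    qed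
    then have "y \<in> mball_of \<Gamma> v (\<delta> v)" using v by (simp add: r_def)
    then have "y = v \<or> (\<exists>k<n v. \<exists>t. 0 < t \<and> t < \<delta> v \<and> y = \<phi> v (k, t))"
      by (rule ball_chart_cases[OF ch(1)[OF vm]]) auto
    then show ?thesis using v fv by (auto simp: V_def)
  qed
  show thesis
  proof (rule that[of V \<epsilon> n \<delta> \<phi> s])
    show "\<forall>v\<in>V. v \<in> mspace \<Gamma> \<and> f v = c \<and> ball_chart \<Gamma> v (n v) (\<delta> v) (\<phi> v) \<and>
        linear_on_chart \<Gamma> f v (n v) (\<delta> v) (\<phi> v) (s v)"
      using ch W(2) by (auto simp: V_def)
    show "\<forall>v\<in>V. \<epsilon> \<le> \<delta> v" by (intro ballI le) (auto simp: E_def)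
    show "\<forall>v\<in>V. \<forall>w\<in>V. v \<noteq> w \<longrightarrow> 2 * \<epsilon> \<le> mdist \<Gamma> v w"
    proof (intro ballI impI)
      fix v w assume "v \<in> V" "w \<in> V" "v \<noteq> w"
      then have "\<epsilon> \<le> mdist \<Gamma> v w / 2" by (intro le) (auto simp: E_def)
      then show "2 * \<epsilon> \<le> mdist \<Gamma> v w" by simp
    qed
    show "\<forall>y\<in>mspace \<Gamma>. \<bar>f y - c\<bar> < \<epsilon> \<longrightarrow>
        (\<exists>v\<in>V. y = v \<or> (\<exists>k<n v. \<exists>t. 0 < t \<and> t < \<delta> v \<and> y = \<phi> v (k, t)))"
      using cover by blast
  qed fact+
qed

text \<open>For \<open>\<psi> s = max 0 s\<close> this is the flux of the gradient leaving the level set upwards, for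
  \<open>\<psi> s = max 0 (- s)\<close> the flux reaching it from below. A level set may be infinite, but only
  finitely many of its points carry flux.\<close>

definition level_flux :: "'a metric \<Rightarrow> ('a \<Rightarrow> real) \<Rightarrow> (int \<Rightarrow> int) \<Rightarrow> real \<Rightarrow> int" where
  "level_flux \<Gamma> f \<psi> c =
     (\<Sum>x | x \<in> mspace \<Gamma> \<and> f x = c \<and> slope_sum \<Gamma> f \<psi> x \<noteq> 0. slope_sum \<Gamma> f \<psi> x)"

section \<open>Flux near a level and its jump across it\<close>

lemma level_flux_eq_sum:
  assumes "finite V" "\<forall>v\<in>V. v \<in> mspace \<Gamma> \<and> f v = c"
    and "\<And>x. \<lbrakk>x \<in> mspace \<Gamma>; f x = c; x \<notin> V\<rbrakk> \<Longrightarrow> slope_sum \<Gamma> f \<psi> x = 0"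
  shows "level_flux \<Gamma> f \<psi> c = (\<Sum>x\<in>V. slope_sum \<Gamma> f \<psi> x)"
  unfolding level_flux_def using assms by (intro sum.mono_neutral_left) auto

lemma level_flux_uminus:
  assumes "pl_function \<Gamma> f"
  shows "level_flux \<Gamma> (\<lambda>x. - f x) \<psi> (- c) = level_flux \<Gamma> f (\<lambda>s. \<psi> (- s)) c"
proof -
  have "slope_sum \<Gamma> (\<lambda>x. - f x) \<psi> x = slope_sum \<Gamma> f (\<lambda>s. \<psi> (- s)) x" if "x \<in> mspace \<Gamma>" for x
    using assms that by (intro locally_linear_uminus(2)) (simp add: pl_function_iff)
  then show ?thesis unfolding level_flux_def by (intro sum.cong) auto
qed

text \<open>A point slightly above level \<open>c\<close> that carries flux lies on exactly one
  branch ascending from a centre on level \<open>c\<close>, and contributes the slope of that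
  branch. The condition on \<open>\<psi>\<close> counts a slope once whichever way it is read. It
  holds for \<open>max 0\<close> and for its mirror image; the latter is the weight that arises when
  \<open>f\<close> is negated.\<close>

lemma level_flux_right:
  assumes "compact_space (mtopology_of \<Gamma>)" "pl_function \<Gamma> f"
  obtains \<epsilon> where "0 < \<epsilon>"
    "\<forall>c' \<psi>. c < c' \<and> c' < c + \<epsilon> \<and> (\<forall>z. \<psi> (- z) + \<psi> z = \<bar>z\<bar>) \<longrightarrow>
       level_flux \<Gamma> f \<psi> c' = level_flux \<Gamma> f (max 0) c"
proof -
  obtain V \<epsilon> n \<delta> \<phi> s where V: "finite V" "0 < \<epsilon>"
    "\<forall>v\<in>V. v \<in> mspace \<Gamma> \<and> f v = c \<and> ball_chart \<Gamma> v (n v) (\<delta> v) (\<phi> v) \<and>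
        linear_on_chart \<Gamma> f v (n v) (\<delta> v) (\<phi> v) (s v)"
    and \<delta>: "\<forall>v\<in>V. \<epsilon> \<le> \<delta> v"
    and sep: "\<forall>v\<in>V. \<forall>w\<in>V. v \<noteq> w \<longrightarrow> 2 * \<epsilon> \<le> mdist \<Gamma> v w"
    and cover: "\<forall>y\<in>mspace \<Gamma>. \<bar>f y - c\<bar> < \<epsilon> \<longrightarrow>
        (\<exists>v\<in>V. y = v \<or> (\<exists>k<n v. \<exists>t. 0 < t \<and> t < \<delta> v \<and> y = \<phi> v (k, t)))"
    by (rule level_set_charts[OF assms])
  have ch: "v \<in> mspace \<Gamma>" "f v = c" "ball_chart \<Gamma> v (n v) (\<delta> v) (\<phi> v)"
      "linear_on_chart \<Gamma> f v (n v) (\<delta> v) (\<phi> v) (s v)" if "v \<in> V" for v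
    using V(3) that by auto
  have f: "f (\<phi> v (k, t)) = c + of_int (s v k) * t" if "v \<in> V" "k < n v" "0 < t" "t < \<delta> v" for v k t
    using ch(4)[OF that(1)] that ch(2)[OF that(1)] by (simp add: linear_on_ball_chart[OF ch(3)[OF that(1)]])
  \<comment> \<open>A point of level \<open>c\<close> outside \<open>V\<close> lies on a branch
    along which \<open>f\<close> is constant, so it carries no flux.\<close>
  have flux_c: "level_flux \<Gamma> f (max 0) c = (\<Sum>v\<in>V. slope_sum \<Gamma> f (max 0) v)"
  proof (rule level_flux_eq_sum)
    fix x assume x: "x \<in> mspace \<Gamma>" "f x = c" "x \<notin> V"
    then obtain v k t where kt: "v \<in> V" "k < n v" "0 < t" "t < \<delta> v" "x = \<phi> v (k, t)"
      using cover V(2) by (metis abs_zero cancel_comm_monoid_add_class.diff_cancel)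
    then have "s v k = 0" using f[OF kt(1-4)] x(2) by simp
    then show "slope_sum \<Gamma> f (max 0) x = 0"
      unfolding kt(5) slope_sum_branch(1)[OF ch(3,4)[OF kt(1)] kt(2-4)] by simp
  qed (use V in auto)
  have main: "level_flux \<Gamma> f \<psi> c' = level_flux \<Gamma> f (max 0) c"
    if c': "c < c'" "c' < c + \<epsilon>" and \<psi>: "\<forall>z. \<psi> (- z) + \<psi> z = \<bar>z\<bar>" for c' \<psi>
  proof -
    \<comment> \<open>\<open>J\<close> lists the ascending branches; one of slope
      \<open>s v k\<close> reaches level \<open>c'\<close> at the parameter
      \<open>t v k\<close>.\<close>
    define J where "J = (SIGMA v:V. {k. k < n v \<and> 0 < s v k})"
    define t where "t v k = (c' - c) / of_int (s v k)" for v k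
    define y where "y = (\<lambda>(v, k). \<phi> v (k, t v k))"
    have t: "0 < t v k" "t v k < \<epsilon>" "t v k < \<delta> v" "f (\<phi> v (k, t v k)) = c'"
      if "v \<in> V" "k < n v" "0 < s v k" for v k
    proof -
      \<comment> \<open>Slopes are integers, so a positive one is at least 1 and level
        \<open>c'\<close> is reached before the branch leaves the chart.\<close>
      have s1: "1 \<le> (of_int (s v k) :: real)" using that(3) by simp
      show "0 < t v k" using s1 c' by (simp add: t_def)
      have "t v k \<le> (c' - c) / 1" unfolding t_def using s1 c' by (intro divide_left_mono) auto
      then show "t v k < \<epsilon>" using c' by simp
      then show "t v k < \<delta> v" using \<delta> that(1) by fastforce
      then show "f (\<phi> v (k, t v k)) = c'"
        using f[OF that(1,2) \<open>0 < t v k\<close>] s1 by (simp add: t_def)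
    qed
    have ym: "\<phi> v (k, t v k) \<in> mspace \<Gamma>" "mdist \<Gamma> v (\<phi> v (k, t v k)) = t v k"
      "slope_sum \<Gamma> f \<psi> (\<phi> v (k, t v k)) = s v k" if "v \<in> V" "k < n v" "0 < s v k" for v k
      using ball_chartD(4,5)[OF ch(3)[OF that(1)] that(2) t(1,3)[OF that]]
        slope_sum_branch(1)[OF ch(3,4)[OF that(1)] that(2) t(1,3)[OF that]] \<psi> that(3) by simp_all
    have "{x. x \<in> mspace \<Gamma> \<and> f x = c' \<and> slope_sum \<Gamma> f \<psi> x \<noteq> 0} = y ` J"
    proof (intro subset_antisym subsetI)
      fix x assume "x \<in> {x. x \<in> mspace \<Gamma> \<and> f x = c' \<and> slope_sum \<Gamma> f \<psi> x \<noteq> 0}"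
      then have x: "x \<in> mspace \<Gamma>" "f x = c'" by auto
      then have "\<bar>f x - c\<bar> < \<epsilon>" using c' by simp
      then obtain v where v: "v \<in> V" "x = v \<or> (\<exists>k<n v. \<exists>u. 0 < u \<and> u < \<delta> v \<and> x = \<phi> v (k, u))"
        using cover x(1) by blast
      have "x \<noteq> v" using x(2) ch(2)[OF v(1)] c' by auto
      then obtain k u where u: "k < n v" "0 < u" "u < \<delta> v" "x = \<phi> v (k, u)" using v(2) by blast
      have e: "c' - c = of_int (s v k) * u" using f[OF v(1) u(1-3)] x(2) u(4) by simp
      then have "0 < of_int (s v k) * u" using c' by simp
      then have s: "0 < s v k" using u(2) by (simp add: zero_less_mult_iff)
      then have "t v k = u" using e by (simp add: t_def)
      then show "x \<in> y ` J" using u v s by (intro image_eqI[where x = "(v, k)"]) (auto simp: y_def J_def)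
    next
      fix x assume "x \<in> y ` J"
      then obtain v k where vk: "v \<in> V" "k < n v" "0 < s v k" and x: "x = \<phi> v (k, t v k)"
        by (auto simp: y_def J_def)
      show "x \<in> {x. x \<in> mspace \<Gamma> \<and> f x = c' \<and> slope_sum \<Gamma> f \<psi> x \<noteq> 0}"
        unfolding x using ym[OF vk] t(4)[OF vk] vk(3) by simp
    qed
    moreover have "inj_on y J"
    proof (rule inj_onI)
      fix i j assume "i \<in> J" "j \<in> J" and eq: "y i = y j"
      then obtain v k w l where i: "i = (v, k)" "v \<in> V" "k < n v" "0 < s v k"
        and j: "j = (w, l)" "w \<in> V" "l < n w" "0 < s w l"
        by (auto simp: J_def)
      have eq': "\<phi> v (k, t v k) = \<phi> w (l, t w l)" using eq by (simp add: y_def i(1) j(1))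
      \<comment> \<open>A common point of branches from different centres would bring the centres
        closer than \<open>sep\<close> allows.\<close>
      have "mdist \<Gamma> v w \<le> mdist \<Gamma> v (\<phi> v (k, t v k)) + mdist \<Gamma> (\<phi> v (k, t v k)) w"
        by (rule mdist_triangle[OF ch(1)[OF i(2)] ym(1)[OF i(2-4)] ch(1)[OF j(2)]])
      also have "mdist \<Gamma> (\<phi> v (k, t v k)) w = t w l"
        unfolding eq' mdist_commute[of _ _ w] by (rule ym(2)[OF j(2-4)])
      finally have "mdist \<Gamma> v w < 2 * \<epsilon>"
        using ym(2)[OF i(2-4)] t(2)[OF i(2-4)] t(2)[OF j(2-4)] by linarith
      then have "v = w" using sep i(2) j(2) by fastforce
      moreover have "k = l"
        using ball_chart_inj(1)[OF ch(3)[OF i(2)] i(3) t(1,3)[OF i(2-4)], of l "t w l"]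
          j t(1,3)[OF j(2-4)] eq' \<open>v = w\<close> by simp
      ultimately show "i = j" by (simp add: i(1) j(1))
    qed
    ultimately have "level_flux \<Gamma> f \<psi> c' = (\<Sum>i\<in>J. slope_sum \<Gamma> f \<psi> (y i))"
      by (simp add: level_flux_def sum.reindex)
    also have "\<dots> = (\<Sum>(v, k)\<in>J. s v k)"
      by (intro sum.cong) (auto simp: J_def y_def ym)
    also have "\<dots> = (\<Sum>v\<in>V. \<Sum>k | k < n v \<and> 0 < s v k. s v k)"
      unfolding J_def using V(1) by (subst sum.Sigma) auto
    also have "\<dots> = (\<Sum>v\<in>V. slope_sum \<Gamma> f (max 0) v)"
    proof (rule sum.cong[OF refl])
      fix v assume v: "v \<in> V"
      have "(\<Sum>k | k < n v \<and> 0 < s v k. s v k) = (\<Sum>k<n v. max 0 (s v k))"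
        by (rule sum.mono_neutral_cong_left) auto
      then show "(\<Sum>k | k < n v \<and> 0 < s v k. s v k) = slope_sum \<Gamma> f (max 0) v"
        by (simp add: slope_sum_eq[OF ch(4)[OF v]])
    qed
    finally show ?thesis by (simp add: flux_c)
  qed
  show thesis by (rule that[OF V(2)]) (use main in blast)
qed

text \<open>This is the right-hand statement for \<open>- f\<close> at level \<open>- c\<close>:
  negation exchanges ascending and descending branches.\<close>

lemma level_flux_left:
  assumes "compact_space (mtopology_of \<Gamma>)" "pl_function \<Gamma> f"
  obtains \<epsilon> where "0 < \<epsilon>"
    "\<forall>c'. c - \<epsilon> < c' \<and> c' < c \<longrightarrow>
       level_flux \<Gamma> f (max 0) c' = level_flux \<Gamma> f (\<lambda>s. max 0 (- s)) c"
proof -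
  have pl: "pl_function \<Gamma> (\<lambda>x. - f x)"
    using assms(2) by (simp add: pl_function_iff locally_linear_uminus(1))
  obtain \<epsilon> where \<epsilon>: "0 < \<epsilon>"
    "\<forall>c' \<psi>. - c < c' \<and> c' < - c + \<epsilon> \<and> (\<forall>z. \<psi> (- z) + \<psi> z = \<bar>z\<bar>) \<longrightarrow>
       level_flux \<Gamma> (\<lambda>x. - f x) \<psi> c' = level_flux \<Gamma> (\<lambda>x. - f x) (max 0) (- c)"
    by (rule level_flux_right[OF assms(1) pl, of "- c"])
  show thesis
  proof (rule that[OF \<epsilon>(1)], intro allI impI)
    fix c' assume c': "c - \<epsilon> < c' \<and> c' < c"
    have "level_flux \<Gamma> (\<lambda>x. - f x) (\<lambda>s. max 0 (- s)) (- c') =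
        level_flux \<Gamma> (\<lambda>x. - f x) (max 0) (- c)"
      by (rule \<epsilon>(2)[rule_format]) (use c' in auto)
    then show "level_flux \<Gamma> f (max 0) c' = level_flux \<Gamma> f (\<lambda>s. max 0 (- s)) c"
      by (simp add: level_flux_uminus[OF assms(2)])
  qed
qed

text \<open>Since max 0 (-s) - max 0 s = -s, the flux reaching a point from below minus the flux
  leaving it upwards is the sum of its incoming slopes.\<close>

lemma level_flux_jump:
  assumes "compact_space (mtopology_of \<Gamma>)" "pl_function \<Gamma> f"
  shows "level_flux \<Gamma> f (\<lambda>s. max 0 (- s)) c - level_flux \<Gamma> f (max 0) c =
    (\<Sum>v | v \<in> mspace \<Gamma> \<and> ord_at \<Gamma> f v \<noteq> 0 \<and> f v = c. ord_at \<Gamma> f v)"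
proof -
  obtain V \<epsilon> n \<delta> \<phi> s where V: "finite V" "0 < \<epsilon>"
    "\<forall>v\<in>V. v \<in> mspace \<Gamma> \<and> f v = c \<and> ball_chart \<Gamma> v (n v) (\<delta> v) (\<phi> v) \<and>
        linear_on_chart \<Gamma> f v (n v) (\<delta> v) (\<phi> v) (s v)"
    and cover: "\<forall>y\<in>mspace \<Gamma>. \<bar>f y - c\<bar> < \<epsilon> \<longrightarrow>
        (\<exists>v\<in>V. y = v \<or> (\<exists>k<n v. \<exists>t. 0 < t \<and> t < \<delta> v \<and> y = \<phi> v (k, t)))"
    by (rule level_set_charts[OF assms])
  have ch: "ball_chart \<Gamma> v (n v) (\<delta> v) (\<phi> v)" "linear_on_chart \<Gamma> f v (n v) (\<delta> v) (\<phi> v) (s v)"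
    if "v \<in> V" for v
    using V(3) that by auto
  have zero: "slope_sum \<Gamma> f \<psi> x = 0"
    if x: "x \<in> mspace \<Gamma>" "f x = c" "x \<notin> V" and \<psi>: "\<psi> 0 = 0" for x \<psi>
  proof -
    obtain v k t where kt: "v \<in> V" "k < n v" "0 < t" "t < \<delta> v" "x = \<phi> v (k, t)"
      using cover V(2) x by (metis abs_zero cancel_comm_monoid_add_class.diff_cancel)
    then have "s v k = 0"
      using ch(2)[OF kt(1)] V(3) x(2) by (simp add: linear_on_ball_chart[OF ch(1)[OF kt(1)]])
    then show ?thesis
      unfolding kt(5) slope_sum_branch(1)[OF ch[OF kt(1)] kt(2-4)] using \<psi> by simp
  qed
  have flux: "level_flux \<Gamma> f \<psi> c = (\<Sum>v\<in>V. slope_sum \<Gamma> f \<psi> v)" if "\<psi> 0 = 0" for \<psi>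
    using V zero that by (intro level_flux_eq_sum) auto
  have "level_flux \<Gamma> f (\<lambda>s. max 0 (- s)) c - level_flux \<Gamma> f (max 0) c =
      (\<Sum>v\<in>V. slope_sum \<Gamma> f (\<lambda>s. max 0 (- s)) v - slope_sum \<Gamma> f (max 0) v)"
    by (simp add: flux sum_subtractf)
  also have "\<dots> = (\<Sum>v\<in>V. ord_at \<Gamma> f v)"
  proof (rule sum.cong[OF refl])
    fix v assume v: "v \<in> V"
    have "(\<Sum>k<n v. max 0 (- s v k)) - (\<Sum>k<n v. max 0 (s v k)) = (\<Sum>k<n v. - s v k)"
      unfolding sum_subtractf[symmetric] by (intro sum.cong) auto
    then show "slope_sum \<Gamma> f (\<lambda>s. max 0 (- s)) v - slope_sum \<Gamma> f (max 0) v = ord_at \<Gamma> f v"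
      by (simp add: slope_sum_eq[OF ch(2)[OF v]] ord_at_eq[OF ch(2)[OF v]])
  qed
  \<comment> \<open>Centres of order 0 drop out; level points outside \<open>V\<close> have order 0
    by \<open>zero\<close> with the weight \<open>uminus\<close>.\<close>
  also have "\<dots> = (\<Sum>v | v \<in> mspace \<Gamma> \<and> ord_at \<Gamma> f v \<noteq> 0 \<and> f v = c. ord_at \<Gamma> f v)"
    using V zero[of _ uminus] by (intro sum.mono_neutral_right) (auto simp: ord_at_eq_slope_sum)
  finally show ?thesis .
qed

text \<open>\<open>h\<close> plus the jumps at all levels up to \<open>a\<close> is locally constant
  in \<open>a\<close>, hence constant on the line. Because \<open>h\<close> takes its right-hand
  value at a jump, the jump shows only when moving to the left, where the sum loses exactly this
  term.\<close>

lemma jump_balance: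
  fixes h L R :: "real \<Rightarrow> int"
  assumes C: "finite C" "\<And>c. c \<notin> C \<Longrightarrow> L c = R c"
    and h: "\<And>c. h c = R c"
    and right: "\<And>c. \<exists>\<epsilon>>0. \<forall>c'. c < c' \<and> c' < c + \<epsilon> \<longrightarrow> h c' = R c"
    and left: "\<And>c. \<exists>\<epsilon>>0. \<forall>c'. c - \<epsilon> < c' \<and> c' < c \<longrightarrow> h c' = L c"
  shows "h a + (\<Sum>c | c \<in> C \<and> c \<le> a. L c - R c) = h b + (\<Sum>c | c \<in> C \<and> c \<le> b. L c - R c)"
    (is "?\<Phi> a = ?\<Phi> b")
proof (rule connected_local_const[of UNIV, OF connected_UNIV UNIV_I UNIV_I], intro ballI)
  fix x :: real
  obtain \<epsilon>1 where \<epsilon>1: "\<epsilon>1 > 0" "\<forall>c'. x < c' \<and> c' < x + \<epsilon>1 \<longrightarrow> h c' = R x" using right by blast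
  obtain \<epsilon>2 where \<epsilon>2: "\<epsilon>2 > 0" "\<forall>c'. x - \<epsilon>2 < c' \<and> c' < x \<longrightarrow> h c' = L x" using left by blast
  obtain \<epsilon>3 where \<epsilon>3: "\<epsilon>3 > 0" "\<forall>c\<in>C. c \<noteq> x \<longrightarrow> \<epsilon>3 \<le> dist x c"
    using finite_set_avoid[OF C(1)] by metis
  show "eventually (\<lambda>y. ?\<Phi> x = ?\<Phi> y) (at x within UNIV)"
    unfolding eventually_at
  proof (intro exI[of _ "min \<epsilon>1 (min \<epsilon>2 \<epsilon>3)"] conjI ballI impI)
    fix y assume y: "y \<noteq> x \<and> dist y x < min \<epsilon>1 (min \<epsilon>2 \<epsilon>3)"
    have far: "c = x \<or> c \<le> x - \<epsilon>3 \<or> x + \<epsilon>3 \<le> c" if "c \<in> C" for c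
      using \<epsilon>3(2) that by (force simp: dist_real_def)
    show "?\<Phi> x = ?\<Phi> y"
    proof (cases "x < y")
      case True
      then have "{c. c \<in> C \<and> c \<le> x} = {c. c \<in> C \<and> c \<le> y}"
        using far y by (force simp: dist_real_def)
      moreover have "h y = h x" using True y \<epsilon>1 h by (auto simp: dist_real_def)
      ultimately show ?thesis by simp
    next
      case False
      then have "y < x" using y by simp
      have "{c. c \<in> C \<and> c \<le> y} = {c. c \<in> C \<and> c \<le> x} - {x}"
        using far y \<open>y < x\<close> by (force simp: dist_real_def)
      then have "(\<Sum>c | c \<in> C \<and> c \<le> y. L c - R c) = (\<Sum>c \<in> {c. c \<in> C \<and> c \<le> x} - {x}. L c - R c)"
        by simp
      also have "\<dots> = (\<Sum>c | c \<in> C \<and> c \<le> x. L c - R c) - (L x - R x)"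
        using C by (cases "x \<in> C") (auto simp: sum_diff1)
      moreover have "h y = L x" using \<open>y < x\<close> y \<epsilon>2 by (auto simp: dist_real_def)
      ultimately show ?thesis using h[of x] by simp
    qed
  qed (use \<epsilon>1 \<epsilon>2 \<epsilon>3 in auto)
qed

lemma sum_ord_at_eq_0:
  assumes "compact_space (mtopology_of \<Gamma>)" "pl_function \<Gamma> f"
  shows "(\<Sum>v | v \<in> mspace \<Gamma> \<and> ord_at \<Gamma> f v \<noteq> 0. ord_at \<Gamma> f v) = 0"
proof -
  define S where "S = {v. v \<in> mspace \<Gamma> \<and> ord_at \<Gamma> f v \<noteq> 0}"
  define L where "L = level_flux \<Gamma> f (\<lambda>s. max 0 (- s))"
  define R where "R = level_flux \<Gamma> f (max 0)"
  have "finite S" using finite_ord_at_support[OF assms] by (simp add: S_def)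
  have jump: "L c - R c = (\<Sum>v | v \<in> S \<and> f v = c. ord_at \<Gamma> f v)" for c
    unfolding L_def R_def level_flux_jump[OF assms] S_def by (rule sum.cong) auto
  obtain B where B: "\<forall>x\<in>mspace \<Gamma>. \<bar>f x\<bar> < B" by (rule pl_function_bounded[OF assms])
  have R0: "R c = 0" if "\<bar>c\<bar> \<ge> B" for c
  proof -
    have none: "{x. x \<in> mspace \<Gamma> \<and> f x = c \<and> slope_sum \<Gamma> f (max 0) x \<noteq> 0} = {}"
      using B that by auto
    show ?thesis unfolding R_def level_flux_def none by simp
  qed
  \<comment> \<open>All values of \<open>f\<close> lie strictly between these two levels: the flux
    vanishes at both, no jump lies below the lower level and every jump lies below the upper
    one.\<close>
  have "R (- \<bar>B\<bar>) + (\<Sum>c | c \<in> f ` S \<and> c \<le> - \<bar>B\<bar>. L c - R c) = R \<bar>B\<bar> + (\<Sum>c | c \<in> f ` S \<and> c \<le> \<bar>B\<bar>. L c - R c)"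
  proof (rule jump_balance)
    show "finite (f ` S)" using \<open>finite S\<close> by simp
    show "L c = R c" if "c \<notin> f ` S" for c
    proof -
      have none: "{v. v \<in> S \<and> f v = c} = {}" using that by auto
      show ?thesis using jump[of c] unfolding none by simp
    qed
    show "\<exists>\<epsilon>>0. \<forall>c'. c < c' \<and> c' < c + \<epsilon> \<longrightarrow> R c' = R c" for c
    proof -
      obtain \<epsilon> where \<epsilon>: "0 < \<epsilon>"
        "\<forall>c' \<psi>. c < c' \<and> c' < c + \<epsilon> \<and> (\<forall>z. \<psi> (- z) + \<psi> z = \<bar>z\<bar>) \<longrightarrow>
           level_flux \<Gamma> f \<psi> c' = level_flux \<Gamma> f (max 0) c"
        by (rule level_flux_right[OF assms, of c])
      have "\<forall>z :: int. max 0 (- z) + max 0 z = \<bar>z\<bar>" by auto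
      then show ?thesis using \<epsilon> unfolding R_def by blast
    qed
    show "\<exists>\<epsilon>>0. \<forall>c'. c - \<epsilon> < c' \<and> c' < c \<longrightarrow> R c' = L c" for c
    proof -
      obtain \<epsilon> where \<epsilon>: "0 < \<epsilon>"
        "\<forall>c'. c - \<epsilon> < c' \<and> c' < c \<longrightarrow>
           level_flux \<Gamma> f (max 0) c' = level_flux \<Gamma> f (\<lambda>s. max 0 (- s)) c"
        by (rule level_flux_left[OF assms, of c])
      show ?thesis using \<epsilon> by (intro exI[of _ \<epsilon>]) (auto simp: R_def L_def)
    qed
  qed simp
  moreover have "{c. c \<in> f ` S \<and> c \<le> - \<bar>B\<bar>} = {}" "{c. c \<in> f ` S \<and> c \<le> \<bar>B\<bar>} = f ` S"
    using B by (force simp: S_def)+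
  ultimately have "0 = (\<Sum>c\<in>f ` S. \<Sum>v | v \<in> S \<and> f v = c. ord_at \<Gamma> f v)"
    by (simp add: R0 jump)
  also have "\<dots> = (\<Sum>v\<in>S. ord_at \<Gamma> f v)"
    by (rule sum.image_gen[OF \<open>finite S\<close>, symmetric])
  finally show ?thesis by (simp add: S_def)
qed

section \<open>Divisors\<close>

lemma div_degree_superset:
  assumes "finite A" "Poly_Mapping.keys D \<subseteq> A"
  shows "div_degree D = (\<Sum>x\<in>A. Poly_Mapping.lookup D x)"
  unfolding div_degree_def using assms by (intro sum.mono_neutral_left) (auto simp: in_keys_iff)

lemma div_degree_0 [simp]: "div_degree 0 = 0"
  by (simp add: div_degree_def)

lemma div_degree_frag_of [simp]: "div_degree (frag_of x) = 1"
  by (simp add: div_degree_def)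

lemma div_degree_add [simp]: "div_degree (D + E) = div_degree D + div_degree E"
  using div_degree_superset[of "Poly_Mapping.keys D \<union> Poly_Mapping.keys E" "D + E"]
    div_degree_superset[of "Poly_Mapping.keys D \<union> Poly_Mapping.keys E" D]
    div_degree_superset[of "Poly_Mapping.keys D \<union> Poly_Mapping.keys E" E] keys_add[of D E]
  by (simp add: lookup_add sum.distrib)

lemma div_degree_diff [simp]: "div_degree (D - E) = div_degree D - div_degree E"
  using div_degree_add[of "D - E" E] by simp

lemma effective_0 [simp]: "effective 0"
  by (simp add: effective_def)

lemma effective_frag_of [simp]: "effective (frag_of x)"
  by (simp add: effective_def)

lemma effective_add: "effective D \<Longrightarrow> effective E \<Longrightarrow> effective (D + E)"
  by (simp add: effective_def lookup_add)

lemma div_degree_effective: "effective D \<Longrightarrow> 0 \<le> div_degree D"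
  by (auto simp: effective_def div_degree_def intro: sum_nonneg)

lemma Div_add: "D \<in> Div \<Gamma> \<Longrightarrow> E \<in> Div \<Gamma> \<Longrightarrow> D + E \<in> Div \<Gamma>"
  using keys_add[of D E] by auto

lemma Div_diff: "D \<in> Div \<Gamma> \<Longrightarrow> E \<in> Div \<Gamma> \<Longrightarrow> D - E \<in> Div \<Gamma>"
  using keys_diff[of D E] by auto

lemma lookup_divisor_of:
  assumes "compact_space (mtopology_of \<Gamma>)" "pl_function \<Gamma> f"
  shows "Poly_Mapping.lookup (divisor_of \<Gamma> f) x = (if x \<in> mspace \<Gamma> then ord_at \<Gamma> f x else 0)"
  using finite_ord_at_support[OF assms]
  by (auto simp: divisor_of_def lookup_sum if_distrib[of "(*) _"] sum.delta cong: if_cong)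

lemma divisor_of_in_Div:
  assumes "compact_space (mtopology_of \<Gamma>)" "pl_function \<Gamma> f"
  shows "divisor_of \<Gamma> f \<in> Div \<Gamma>"
  by (auto simp: in_keys_iff lookup_divisor_of[OF assms] split: if_splits)

lemma div_degree_divisor_of:
  assumes "compact_space (mtopology_of \<Gamma>)" "pl_function \<Gamma> f"
  shows "div_degree (divisor_of \<Gamma> f) = 0"
proof -
  have "Poly_Mapping.keys (divisor_of \<Gamma> f) = {v \<in> mspace \<Gamma>. ord_at \<Gamma> f v \<noteq> 0}"
    by (auto simp: in_keys_iff lookup_divisor_of[OF assms] split: if_splits)
  then show ?thesis
    using sum_ord_at_eq_0[OF assms] by (simp add: div_degree_def lookup_divisor_of[OF assms])
qed

text \<open>Comparison by coefficients, free of the finite sum in \<open>divisor_of\<close>. The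
  case distinction is there because \<open>ord_at\<close> is an unspecified \<open>THE\<close> off
  the carrier.\<close>

lemma principal_iff:
  assumes "compact_space (mtopology_of \<Gamma>)"
  shows "principal \<Gamma> D \<longleftrightarrow> (\<exists>f. pl_function \<Gamma> f \<and>
    (\<forall>x. Poly_Mapping.lookup D x = (if x \<in> mspace \<Gamma> then ord_at \<Gamma> f x else 0)))"
  unfolding principal_def
  by (auto simp: lookup_divisor_of[OF assms] poly_mapping_eq_iff fun_eq_iff)

lemma pl_function_const:
  assumes "metric_graph \<Gamma>"
  shows "pl_function \<Gamma> (\<lambda>x. c)" "divisor_of \<Gamma> (\<lambda>x. c) = 0"
proof -
  have *: "locally_linear \<Gamma> (\<lambda>x. c) v \<and> ord_at \<Gamma> (\<lambda>x. c) v = 0" if "v \<in> mspace \<Gamma>" for v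
    using assms that locally_linear_const unfolding metric_graph_def by metis
  then show "pl_function \<Gamma> (\<lambda>x. c)" by (simp add: pl_function_iff)
  have "{v \<in> mspace \<Gamma>. ord_at \<Gamma> (\<lambda>x. c) v \<noteq> 0} = {}" using * by auto
  then show "divisor_of \<Gamma> (\<lambda>x. c) = 0" by (simp only: divisor_of_def sum.empty)
qed

lemma principal_0:
  assumes "metric_graph \<Gamma>"
  shows "principal \<Gamma> 0"
  using pl_function_const[OF assms] unfolding principal_def by metis

lemma metric_graph_compact: "metric_graph \<Gamma> \<Longrightarrow> compact_space (mtopology_of \<Gamma>)"
  by (simp add: metric_graph_def)

lemma principal_add:
  assumes "metric_graph \<Gamma>" "principal \<Gamma> D" "principal \<Gamma> E"
  shows "principal \<Gamma> (D + E)"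
proof -
  note c = metric_graph_compact[OF assms(1)]
  obtain f g where f: "pl_function \<Gamma> f"
      "\<forall>x. Poly_Mapping.lookup D x = (if x \<in> mspace \<Gamma> then ord_at \<Gamma> f x else 0)"
    and g: "pl_function \<Gamma> g"
      "\<forall>x. Poly_Mapping.lookup E x = (if x \<in> mspace \<Gamma> then ord_at \<Gamma> g x else 0)"
    using assms(2,3) unfolding principal_iff[OF c] by auto
  show ?thesis unfolding principal_iff[OF c]
    using f g locally_linear_add[of \<Gamma> f _ g]
    by (intro exI[of _ "\<lambda>x. f x + g x"]) (simp add: pl_function_iff lookup_add)
qed

lemma principal_uminus:
  assumes "metric_graph \<Gamma>" "principal \<Gamma> D"
  shows "principal \<Gamma> (- D)"
proof -
  note c = metric_graph_compact[OF assms(1)]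
  obtain f where f: "pl_function \<Gamma> f"
      "\<forall>x. Poly_Mapping.lookup D x = (if x \<in> mspace \<Gamma> then ord_at \<Gamma> f x else 0)"
    using assms(2) unfolding principal_iff[OF c] by auto
  show ?thesis unfolding principal_iff[OF c]
    using f locally_linear_uminus[of \<Gamma> f]
    by (intro exI[of _ "\<lambda>x. - f x"]) (simp add: pl_function_iff)
qed

lemma div_degree_principal:
  assumes "metric_graph \<Gamma>" "principal \<Gamma> D"
  shows "div_degree D = 0"
  using assms div_degree_divisor_of[OF metric_graph_compact] by (auto simp: principal_def)

section \<open>Pushforward of divisors along maps of points\<close>

definition pushforward :: "('a \<Rightarrow> 'b) \<Rightarrow> ('a \<Rightarrow>\<^sub>0 int) \<Rightarrow> ('b \<Rightarrow>\<^sub>0 int)" where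
  "pushforward h = frag_extend (frag_of \<circ> h)"

lemma pushforward_simps [simp]:
  "pushforward h 0 = 0" "pushforward h (frag_of x) = frag_of (h x)"
  "pushforward h (D + E) = pushforward h D + pushforward h E"
  "pushforward h (D - E) = pushforward h D - pushforward h E"
  by (simp_all add: pushforward_def frag_extend_add frag_extend_diff)

lemma pushforward_compose: "pushforward g (pushforward h D) = pushforward (g \<circ> h) D"
  by (simp add: pushforward_def frag_extend_compose o_assoc)

lemma pushforward_id: "pushforward id D = D"
  by (simp add: pushforward_def frag_expansion[symmetric])

text \<open>Collapsing a divisor to a point remembers only its degree; a part of degree 0
  disappears.\<close>

lemma pushforward_const: "pushforward (\<lambda>x. y) D = frag_cmul (div_degree D) (frag_of y)"
proof (rule poly_mapping_eqI)
  show "Poly_Mapping.lookup (pushforward (\<lambda>x. y) D) z =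
      Poly_Mapping.lookup (frag_cmul (div_degree D) (frag_of y)) z" for z
    by (simp add: pushforward_def frag_extend_def lookup_sum div_degree_def sum_distrib_right)
qed

lemma div_degree_pushforward [simp]: "div_degree (pushforward h D) = div_degree D"
  by (induction D rule: frag_induction[OF subset_UNIV]) simp_all

lemma lookup_pushforward:
  "Poly_Mapping.lookup (pushforward h D) y =
    (\<Sum>x\<in>Poly_Mapping.keys D. Poly_Mapping.lookup D x * (if y = h x then 1 else 0))"
  by (simp add: pushforward_def frag_extend_def lookup_sum)

lemma lookup_pushforward_inj:
  assumes "inj_on h M" "D \<in> carrier (free_Abelian_group M)" "x \<in> M"
  shows "Poly_Mapping.lookup (pushforward h D) (h x) = Poly_Mapping.lookup D x"
proof -
  have "(\<Sum>z\<in>Poly_Mapping.keys D. Poly_Mapping.lookup D z * (if h x = h z then 1 else 0)) =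
     (\<Sum>z\<in>Poly_Mapping.keys D. if z = x then Poly_Mapping.lookup D z else 0)"
    using assms by (intro sum.cong) (auto dest: inj_onD)
  then show ?thesis by (simp add: lookup_pushforward in_keys_iff)
qed

lemma lookup_pushforward_notin:
  "y \<notin> h ` Poly_Mapping.keys D \<Longrightarrow> Poly_Mapping.lookup (pushforward h D) y = 0"
  unfolding lookup_pushforward by (intro sum.neutral) auto

lemma effective_pushforward: "effective D \<Longrightarrow> effective (pushforward h D)"
  unfolding effective_def lookup_pushforward by (auto intro: sum_nonneg)

lemma pushforward_in_Div:
  assumes "D \<in> Div \<Gamma>" "h ` mspace \<Gamma> \<subseteq> mspace \<Gamma>'"
  shows "pushforward h D \<in> Div \<Gamma>'"
proof -
  have "Poly_Mapping.keys (pushforward h D) \<subseteq> h ` Poly_Mapping.keys D"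
    by (rule subsetI) (metis in_keys_iff lookup_pushforward_notin)
  then show ?thesis using assms by (auto simp: image_subset_iff)
qed

section \<open>Wedge sums\<close>

lemma isometric_embedding_continuous:
  assumes "\<And>x. x \<in> mspace \<Gamma> \<Longrightarrow> h x \<in> mspace \<Gamma>'"
    and "\<And>x y. \<lbrakk>x \<in> mspace \<Gamma>; y \<in> mspace \<Gamma>\<rbrakk> \<Longrightarrow> mdist \<Gamma>' (h x) (h y) = mdist \<Gamma> x y"
  shows "continuous_map (mtopology_of \<Gamma>) (mtopology_of \<Gamma>') h"
proof (rule Lipschitz_continuous_imp_continuous_map)
  show "Lipschitz_continuous_map \<Gamma> \<Gamma>' h"
    unfolding Lipschitz_continuous_map_def
    using assms by (intro conjI exI[of _ 1]) auto
qed

locale wedge_sum =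
  fixes \<Gamma>1 :: "'a metric" and p :: 'a and \<Gamma>2 :: "'b metric" and p' :: 'b
  assumes graph1: "metric_graph \<Gamma>1" and graph2: "metric_graph \<Gamma>2"
    and p: "p \<in> mspace \<Gamma>1" and p': "p' \<in> mspace \<Gamma>2"
begin

abbreviation "\<Gamma> \<equiv> wedge \<Gamma>1 p \<Gamma>2 p'"

text \<open>\<open>Inr p'\<close> is not a point of the wedge, so the inclusion of \<Gamma>2 has to
  send \<open>p'\<close> to \<open>Inl p\<close>.\<close>

definition emb2 :: "'b \<Rightarrow> 'a + 'b" where
  "emb2 y = (if y = p' then Inl p else Inr y)"

definition retract1 :: "'a + 'b \<Rightarrow> 'a" where
  "retract1 z = (case z of Inl x \<Rightarrow> x | Inr y \<Rightarrow> p)"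

definition retract2 :: "'a + 'b \<Rightarrow> 'b" where
  "retract2 z = (case z of Inl x \<Rightarrow> p' | Inr y \<Rightarrow> y)"

lemma retract_simps [simp]:
  "retract1 (Inl x) = x" "retract1 (Inr y) = p" "retract2 (Inl x) = p'" "retract2 (Inr y) = y"
  "retract1 (emb2 y) = p" "retract2 (emb2 y) = y"
  by (simp_all add: retract1_def retract2_def emb2_def)

lemmas mspace_\<Gamma> = mspace_wedge[OF p p']
lemmas mdist_\<Gamma> = mdist_wedge[OF p p']

lemma mem_\<Gamma> [simp]:
  "Inl x \<in> mspace \<Gamma> \<longleftrightarrow> x \<in> mspace \<Gamma>1" "Inr y \<in> mspace \<Gamma> \<longleftrightarrow> y \<in> mspace \<Gamma>2 \<and> y \<noteq> p'"
  by (auto simp: mspace_\<Gamma>)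

lemma mspace_\<Gamma>': "mspace \<Gamma> = Inl ` mspace \<Gamma>1 \<union> emb2 ` mspace \<Gamma>2"
  using p p' by (auto simp: mspace_\<Gamma> emb2_def)

lemma \<Gamma>_cases:
  assumes "z \<in> mspace \<Gamma>"
  obtains x where "z = Inl x" "x \<in> mspace \<Gamma>1" "x \<noteq> p"
    | y where "z = Inr y" "y \<in> mspace \<Gamma>2" "y \<noteq> p'" | "z = Inl p"
  using assms by (auto simp: mspace_\<Gamma>)

lemma mdist_emb2:
  assumes "x \<in> mspace \<Gamma>2" "y \<in> mspace \<Gamma>2"
  shows "mdist \<Gamma> (emb2 x) (emb2 y) = mdist \<Gamma>2 x y"
  using assms p p' by (simp add: emb2_def mdist_\<Gamma>)

lemma inj_emb2: "inj emb2"
  by (auto simp: inj_on_def emb2_def split: if_splits)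

text \<open>Points of the other side are at distance at least \<open>mdist \<Gamma>1 x p\<close>
  from \<open>Inl x\<close>, so a ball of this radius never crosses the wedge point.\<close>

lemma ball_chart_Inl:
  assumes b: "ball_chart \<Gamma>1 x n \<delta> \<phi>" and \<delta>: "\<delta> \<le> mdist \<Gamma>1 x p"
  shows "ball_chart \<Gamma> (Inl x) n \<delta> (\<lambda>u. Inl (\<phi> u))"
proof (rule ball_chartI)
  note c = ball_chartD[OF b]
  show "\<exists>k<n. Inl (\<phi> (k, t)) = z" if "z \<in> mspace \<Gamma>" "mdist \<Gamma> (Inl x) z = t" "0 < t" "t < \<delta>" for z t
  proof (cases z)
    case (Inl y)
    then show ?thesis using that c(7)[of y t] by (auto simp: mdist_\<Gamma>)
  next
    case (Inr y)
    then show ?thesis using that \<delta> mdist_nonneg[of \<Gamma>2 p' y] by (simp add: mdist_\<Gamma>)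
  qed
qed (use ball_chartD(1-6)[OF b] in \<open>simp_all add: mdist_\<Gamma>\<close>)

text \<open>As on the other side, but branch points must also avoid \<open>p'\<close>, since
  \<open>Inr p'\<close> lies outside the carrier.\<close>

lemma ball_chart_Inr:
  assumes b: "ball_chart \<Gamma>2 y n \<delta> \<phi>" and \<delta>: "\<delta> \<le> mdist \<Gamma>2 y p'" and y: "y \<noteq> p'"
  shows "ball_chart \<Gamma> (Inr y) n \<delta> (\<lambda>u. Inr (\<phi> u))"
    and "\<And>k t. \<lbrakk>k < n; 0 < t; t < \<delta>\<rbrakk> \<Longrightarrow> \<phi> (k, t) \<noteq> p'"
proof -
  note c = ball_chartD[OF b]
  show ne: "\<phi> (k, t) \<noteq> p'" if "k < n" "0 < t" "t < \<delta>" for k t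
    using c(5)[OF that] that(3) \<delta> by auto
  show "ball_chart \<Gamma> (Inr y) n \<delta> (\<lambda>u. Inr (\<phi> u))"
  proof (rule ball_chartI)
    show "\<exists>k<n. Inr (\<phi> (k, t)) = z"
      if "z \<in> mspace \<Gamma>" "mdist \<Gamma> (Inr y) z = t" "0 < t" "t < \<delta>" for z t
    proof (cases z)
      case (Inr w)
      then show ?thesis using that c(7)[of w t] by (auto simp: mdist_\<Gamma>)
    next
      case (Inl w)
      then show ?thesis using that \<delta> mdist_nonneg[of \<Gamma>1 p w] by (simp add: mdist_\<Gamma>)
    qed
  qed (use c(1-6) y ne in \<open>simp_all add: mdist_\<Gamma>\<close>)
qed

text \<open>Branches of \<Gamma>1 come first, those of \<Gamma>2 are shifted by \<open>n\<close>.
  Parameter 0 is separate because every branch starts at \<open>Inl p\<close>, those of \<Gamma>2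
  included.\<close>

definition wedge_chart :: "nat \<Rightarrow> (nat \<times> real \<Rightarrow> 'a) \<Rightarrow> (nat \<times> real \<Rightarrow> 'b) \<Rightarrow> nat \<times> real \<Rightarrow> 'a + 'b" where
  "wedge_chart n \<phi>1 \<phi>2 = (\<lambda>(k, t). if t = 0 then Inl p
     else if k < n then Inl (\<phi>1 (k, t)) else Inr (\<phi>2 (k - n, t)))"

text \<open>The wedge distance between the sides is the sum of the distances to the wedge point,
  which is precisely the star distance between different branches.\<close>

lemma ball_chart_wedge:
  assumes b1: "ball_chart \<Gamma>1 p n1 \<delta> \<phi>1" and b2: "ball_chart \<Gamma>2 p' n2 \<delta> \<phi>2"
  shows "ball_chart \<Gamma> (Inl p) (n1 + n2) \<delta> (wedge_chart n1 \<phi>1 \<phi>2)"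
    and "\<And>k t. \<lbrakk>k < n2; 0 < t; t < \<delta>\<rbrakk> \<Longrightarrow> \<phi>2 (k, t) \<noteq> p'"
proof -
  note c1 = ball_chartD[OF b1] and c2 = ball_chartD[OF b2]
  show ne: "\<phi>2 (k, t) \<noteq> p'" if "k < n2" "0 < t" "t < \<delta>" for k t
    using c2(5)[OF that] that(2) p' by auto
  show "ball_chart \<Gamma> (Inl p) (n1 + n2) \<delta> (wedge_chart n1 \<phi>1 \<phi>2)"
  proof (rule ball_chartI)
    show "wedge_chart n1 \<phi>1 \<phi>2 (k, t) \<in> mspace \<Gamma>" if "k < n1 + n2" "0 < t" "t < \<delta>" for k t
      using that c1(4)[of k t] c2(4)[of "k - n1" t] ne[of "k - n1" t] by (simp add: wedge_chart_def)
    show "mdist \<Gamma> (Inl p) (wedge_chart n1 \<phi>1 \<phi>2 (k, t)) = t" if "k < n1 + n2" "0 < t" "t < \<delta>" for k t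
      using that c1(5)[of k t] c2(5)[of "k - n1" t] p by (simp add: wedge_chart_def mdist_\<Gamma>)
    show "mdist \<Gamma> (wedge_chart n1 \<phi>1 \<phi>2 (k, t)) (wedge_chart n1 \<phi>1 \<phi>2 (j, u)) =
        (if k = j then \<bar>t - u\<bar> else t + u)"
      if h: "k < n1 + n2" "0 < t" "t < \<delta>" "j < n1 + n2" "0 < u" "u < \<delta>" for k t j u
    proof (cases "k < n1"; cases "j < n1")
      assume "k < n1" "j < n1"
      then show ?thesis using h c1(6)[of k t j u] by (simp add: wedge_chart_def mdist_\<Gamma>)
    next
      assume "\<not> k < n1" "\<not> j < n1"
      moreover from this have "k - n1 = j - n1 \<longleftrightarrow> k = j" by auto
      ultimately show ?thesis
        using h c2(6)[of "k - n1" t "j - n1" u] by (simp add: wedge_chart_def mdist_\<Gamma>)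
    next
      assume "k < n1" "\<not> j < n1"
      then show ?thesis
        using h c1(5)[of k t] c2(5)[of "j - n1" u] mdist_commute[of \<Gamma>1 p]
        by (auto simp: wedge_chart_def mdist_\<Gamma>)
    next
      assume "\<not> k < n1" "j < n1"
      then show ?thesis
        using h c1(5)[of j u] c2(5)[of "k - n1" t] mdist_commute[of \<Gamma>2 p']
        by (auto simp: wedge_chart_def mdist_\<Gamma>)
    qed
    show "\<exists>k<n1 + n2. wedge_chart n1 \<phi>1 \<phi>2 (k, t) = z"
      if z: "z \<in> mspace \<Gamma>" "mdist \<Gamma> (Inl p) z = t" "0 < t" "t < \<delta>" for z t
    proof (cases z)
      case (Inl x)
      then obtain k where "k < n1" "\<phi>1 (k, t) = x" using z c1(7)[of x t] by (auto simp: mdist_\<Gamma>)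
      then show ?thesis using Inl z(3) by (intro exI[of _ k]) (simp add: wedge_chart_def)
    next
      case (Inr y)
      then obtain k where "k < n2" "\<phi>2 (k, t) = y" using z c2(7)[of y t] p by (auto simp: mdist_\<Gamma>)
      then show ?thesis using Inr z(3) by (intro exI[of _ "n1 + k"]) (simp add: wedge_chart_def)
    qed
  qed (use c1(1) p in \<open>simp_all add: wedge_chart_def\<close>)
qed

lemma metric_graph_wedge: "metric_graph \<Gamma>"
  unfolding metric_graph_def
proof (intro conjI ballI)
  have cont1: "continuous_map (mtopology_of \<Gamma>1) (mtopology_of \<Gamma>) Inl"
    by (rule isometric_embedding_continuous) (simp_all add: mdist_\<Gamma>)
  have cont2: "continuous_map (mtopology_of \<Gamma>2) (mtopology_of \<Gamma>) emb2"
    by (rule isometric_embedding_continuous) (use mdist_emb2 mspace_\<Gamma>' in auto)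
  have comp: "compactin (mtopology_of \<Gamma>1) (mspace \<Gamma>1)" "compactin (mtopology_of \<Gamma>2) (mspace \<Gamma>2)"
    using graph1 graph2 by (simp_all add: metric_graph_def compact_space_def)
  have conn: "connectedin (mtopology_of \<Gamma>1) (mspace \<Gamma>1)" "connectedin (mtopology_of \<Gamma>2) (mspace \<Gamma>2)"
    using graph1 graph2 by (metis connectedin_topspace metric_graph_def topspace_mtopology_of)+
  show "compact_space (mtopology_of \<Gamma>)"
    unfolding compact_space_def topspace_mtopology_of mspace_\<Gamma>'
    by (intro compactin_Un image_compactin[OF comp(1) cont1] image_compactin[OF comp(2) cont2])
  \<comment> \<open>The two connected images share the wedge point, so their union is
    connected.\<close>
  have "Inl p \<in> Inl ` mspace \<Gamma>1 \<inter> emb2 ` mspace \<Gamma>2" using p p' by (auto simp: emb2_def)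
  then have "connectedin (mtopology_of \<Gamma>) (mspace \<Gamma>)"
    unfolding mspace_\<Gamma>'
    by (intro connectedin_Un connectedin_continuous_map_image[OF cont1 conn(1)]
        connectedin_continuous_map_image[OF cont2 conn(2)]) auto
  then show "connected_space (mtopology_of \<Gamma>)"
    by (metis connectedin_topspace topspace_mtopology_of)
  show "mspace \<Gamma> \<noteq> {}" using p by (auto simp: mspace_\<Gamma>)
  fix z assume "z \<in> mspace \<Gamma>"
  then show "\<exists>n \<rho> \<phi>. star_chart \<Gamma> z n \<rho> \<phi>"
  proof (cases rule: \<Gamma>_cases)
    case (1 x)
    obtain n \<delta> \<phi> where b: "ball_chart \<Gamma>1 x n \<delta> \<phi>" using metric_graph_ball_chart[OF graph1 1(2)] .
    have "ball_chart \<Gamma>1 x n (min \<delta> (mdist \<Gamma>1 x p)) \<phi>"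
      by (rule ball_chart_shrink[OF b]) (use ball_chartD(1)[OF b] mdist_pos[OF 1(2) p 1(3)] in auto)
    from ball_chart_Inl[OF this] show ?thesis
      using ball_chart_imp_star_chart unfolding 1(1) by fastforce
  next
    case (2 y)
    obtain n \<delta> \<phi> where b: "ball_chart \<Gamma>2 y n \<delta> \<phi>" using metric_graph_ball_chart[OF graph2 2(2)] .
    have "ball_chart \<Gamma>2 y n (min \<delta> (mdist \<Gamma>2 y p')) \<phi>"
      by (rule ball_chart_shrink[OF b]) (use ball_chartD(1)[OF b] mdist_pos[OF 2(2) p' 2(3)] in auto)
    from ball_chart_Inr(1)[OF this _ 2(3)] show ?thesis
      using ball_chart_imp_star_chart unfolding 2(1) by fastforce
  next
    case 3
    obtain n1 \<delta>1 \<phi>1 where b1: "ball_chart \<Gamma>1 p n1 \<delta>1 \<phi>1" using metric_graph_ball_chart[OF graph1 p] .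
    obtain n2 \<delta>2 \<phi>2 where b2: "ball_chart \<Gamma>2 p' n2 \<delta>2 \<phi>2" using metric_graph_ball_chart[OF graph2 p'] .
    have "ball_chart \<Gamma>1 p n1 (min \<delta>1 \<delta>2) \<phi>1" "ball_chart \<Gamma>2 p' n2 (min \<delta>1 \<delta>2) \<phi>2"
      using ball_chart_shrink[OF b1] ball_chart_shrink[OF b2] ball_chartD(1)[OF b1] ball_chartD(1)[OF b2]
      by auto
    from ball_chart_imp_star_chart[OF ball_chart_wedge(1)[OF this]] show ?thesis
      unfolding 3 by blast
  qed
qed

text \<open>Away from the wedge point, small balls of the wedge and of \<Gamma>1 are the same, so
  one chart serves both.\<close>

lemma locally_linear_Inl:
  assumes x: "x \<in> mspace \<Gamma>1" "x \<noteq> p"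
  shows "locally_linear \<Gamma> f (Inl x) \<longleftrightarrow> locally_linear \<Gamma>1 (f \<circ> Inl) x"
    and "locally_linear \<Gamma> f (Inl x) \<Longrightarrow> ord_at \<Gamma> f (Inl x) = ord_at \<Gamma>1 (f \<circ> Inl) x"
proof -
  obtain n \<delta>0 \<phi> where b0: "ball_chart \<Gamma>1 x n \<delta>0 \<phi>" using metric_graph_ball_chart[OF graph1 x(1)] .
  define \<delta> where "\<delta> = min \<delta>0 (mdist \<Gamma>1 x p)"
  have b: "ball_chart \<Gamma>1 x n \<delta> \<phi>"
    unfolding \<delta>_def by (rule ball_chart_shrink[OF b0]) (use ball_chartD(1)[OF b0] mdist_pos[OF x(1) p x(2)] in auto)
  have \<delta>: "\<delta> \<le> mdist \<Gamma>1 x p" by (simp add: \<delta>_def)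
  note b' = ball_chart_Inl[OF b \<delta>]
  have iff: "linear_on_chart \<Gamma> f (Inl x) n \<epsilon> (\<lambda>u. Inl (\<phi> u)) s \<longleftrightarrow> linear_on_chart \<Gamma>1 (f \<circ> Inl) x n \<epsilon> \<phi> s"
    if "0 < \<epsilon>" "\<epsilon> \<le> \<delta>" for \<epsilon> s
    by (simp add: linear_on_ball_chart[OF ball_chart_shrink[OF b that]]
        linear_on_ball_chart[OF ball_chart_shrink[OF b' that]])
  have 1: "locally_linear \<Gamma>1 (f \<circ> Inl) x \<and> ord_at \<Gamma> f (Inl x) = ord_at \<Gamma>1 (f \<circ> Inl) x"
    if ll: "locally_linear \<Gamma> f (Inl x)"
  proof -
    obtain \<epsilon> s where \<epsilon>: "0 < \<epsilon>" "\<epsilon> \<le> \<delta>" and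
      "\<forall>\<eta>\<in>{0<..\<epsilon>}. ball_chart \<Gamma> (Inl x) n \<eta> (\<lambda>u. Inl (\<phi> u)) \<and>
        linear_on_chart \<Gamma> f (Inl x) n \<eta> (\<lambda>u. Inl (\<phi> u)) s"
      by (rule locally_linear_on_ball_chart[OF ll b'])
    then have l: "linear_on_chart \<Gamma> f (Inl x) n \<epsilon> (\<lambda>u. Inl (\<phi> u)) s" by simp
    with iff[OF \<epsilon>] have l': "linear_on_chart \<Gamma>1 (f \<circ> Inl) x n \<epsilon> \<phi> s" by simp
    then show ?thesis using ord_at_eq[OF l] ord_at_eq[OF l'] by (auto simp: locally_linear_def)
  qed
  have 2: "locally_linear \<Gamma> f (Inl x)" if ll: "locally_linear \<Gamma>1 (f \<circ> Inl) x"
  proof -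
    obtain \<epsilon> s where \<epsilon>: "0 < \<epsilon>" "\<epsilon> \<le> \<delta>" and
      "\<forall>\<eta>\<in>{0<..\<epsilon>}. ball_chart \<Gamma>1 x n \<eta> \<phi> \<and> linear_on_chart \<Gamma>1 (f \<circ> Inl) x n \<eta> \<phi> s"
      by (rule locally_linear_on_ball_chart[OF ll b])
    then have "linear_on_chart \<Gamma>1 (f \<circ> Inl) x n \<epsilon> \<phi> s" by simp
    then show ?thesis using iff[OF \<epsilon>] unfolding locally_linear_def by blast
  qed
  show "locally_linear \<Gamma> f (Inl x) \<longleftrightarrow> locally_linear \<Gamma>1 (f \<circ> Inl) x"
    "locally_linear \<Gamma> f (Inl x) \<Longrightarrow> ord_at \<Gamma> f (Inl x) = ord_at \<Gamma>1 (f \<circ> Inl) x"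
    using 1 2 by blast+
qed

text \<open>Small charts around \<open>y\<close> avoid \<open>p'\<close>, and there
  \<open>emb2\<close> agrees with \<open>Inr\<close>.\<close>

lemma locally_linear_Inr:
  assumes y: "y \<in> mspace \<Gamma>2" "y \<noteq> p'"
  shows "locally_linear \<Gamma> f (Inr y) \<longleftrightarrow> locally_linear \<Gamma>2 (f \<circ> emb2) y"
    and "locally_linear \<Gamma> f (Inr y) \<Longrightarrow> ord_at \<Gamma> f (Inr y) = ord_at \<Gamma>2 (f \<circ> emb2) y"
proof -
  obtain n \<delta>0 \<phi> where b0: "ball_chart \<Gamma>2 y n \<delta>0 \<phi>" using metric_graph_ball_chart[OF graph2 y(1)] .
  define \<delta> where "\<delta> = min \<delta>0 (mdist \<Gamma>2 y p')"
  have b: "ball_chart \<Gamma>2 y n \<delta> \<phi>"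
    unfolding \<delta>_def by (rule ball_chart_shrink[OF b0]) (use ball_chartD(1)[OF b0] mdist_pos[OF y(1) p' y(2)] in auto)
  have \<delta>: "\<delta> \<le> mdist \<Gamma>2 y p'" by (simp add: \<delta>_def)
  note b' = ball_chart_Inr(1)[OF b \<delta> y(2)] and ne = ball_chart_Inr(2)[OF b \<delta> y(2)]
  have iff: "linear_on_chart \<Gamma> f (Inr y) n \<epsilon> (\<lambda>u. Inr (\<phi> u)) s \<longleftrightarrow> linear_on_chart \<Gamma>2 (f \<circ> emb2) y n \<epsilon> \<phi> s"
    if "0 < \<epsilon>" "\<epsilon> \<le> \<delta>" for \<epsilon> s
    using y(2) ne that
    by (simp add: linear_on_ball_chart[OF ball_chart_shrink[OF b that]]
        linear_on_ball_chart[OF ball_chart_shrink[OF b' that]] emb2_def cong: imp_cong conj_cong)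
  have 1: "locally_linear \<Gamma>2 (f \<circ> emb2) y \<and> ord_at \<Gamma> f (Inr y) = ord_at \<Gamma>2 (f \<circ> emb2) y"
    if ll: "locally_linear \<Gamma> f (Inr y)"
  proof -
    obtain \<epsilon> s where \<epsilon>: "0 < \<epsilon>" "\<epsilon> \<le> \<delta>" and
      "\<forall>\<eta>\<in>{0<..\<epsilon>}. ball_chart \<Gamma> (Inr y) n \<eta> (\<lambda>u. Inr (\<phi> u)) \<and>
        linear_on_chart \<Gamma> f (Inr y) n \<eta> (\<lambda>u. Inr (\<phi> u)) s"
      by (rule locally_linear_on_ball_chart[OF ll b'])
    then have l: "linear_on_chart \<Gamma> f (Inr y) n \<epsilon> (\<lambda>u. Inr (\<phi> u)) s" by simp
    with iff[OF \<epsilon>] have l': "linear_on_chart \<Gamma>2 (f \<circ> emb2) y n \<epsilon> \<phi> s" by simp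
    then show ?thesis using ord_at_eq[OF l] ord_at_eq[OF l'] by (auto simp: locally_linear_def)
  qed
  have 2: "locally_linear \<Gamma> f (Inr y)" if ll: "locally_linear \<Gamma>2 (f \<circ> emb2) y"
  proof -
    obtain \<epsilon> s where \<epsilon>: "0 < \<epsilon>" "\<epsilon> \<le> \<delta>" and
      "\<forall>\<eta>\<in>{0<..\<epsilon>}. ball_chart \<Gamma>2 y n \<eta> \<phi> \<and> linear_on_chart \<Gamma>2 (f \<circ> emb2) y n \<eta> \<phi> s"
      by (rule locally_linear_on_ball_chart[OF ll b])
    then have "linear_on_chart \<Gamma>2 (f \<circ> emb2) y n \<epsilon> \<phi> s" by simp
    then show ?thesis using iff[OF \<epsilon>] unfolding locally_linear_def by blast
  qed
  show "locally_linear \<Gamma> f (Inr y) \<longleftrightarrow> locally_linear \<Gamma>2 (f \<circ> emb2) y"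
    "locally_linear \<Gamma> f (Inr y) \<Longrightarrow> ord_at \<Gamma> f (Inr y) = ord_at \<Gamma>2 (f \<circ> emb2) y"
    using 1 2 by blast+
qed

lemma linear_on_wedge_chart:
  assumes b1: "ball_chart \<Gamma>1 p n1 \<delta> \<phi>1" and b2: "ball_chart \<Gamma>2 p' n2 \<delta> \<phi>2"
  shows "linear_on_chart \<Gamma> f (Inl p) (n1 + n2) \<delta> (wedge_chart n1 \<phi>1 \<phi>2) s \<longleftrightarrow>
    linear_on_chart \<Gamma>1 (f \<circ> Inl) p n1 \<delta> \<phi>1 s \<and>
    linear_on_chart \<Gamma>2 (f \<circ> emb2) p' n2 \<delta> \<phi>2 (\<lambda>k. s (n1 + k))"
  (is "?L \<longleftrightarrow> ?R1 \<and> ?R2")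
proof -
  note b = ball_chart_wedge(1)[OF b1 b2] and ne = ball_chart_wedge(2)[OF b1 b2]
  have w1: "f (wedge_chart n1 \<phi>1 \<phi>2 (k, t)) = (f \<circ> Inl) (\<phi>1 (k, t))" if "k < n1" "0 < t" for k t
    using that by (simp add: wedge_chart_def)
  have w2: "f (wedge_chart n1 \<phi>1 \<phi>2 (n1 + k, t)) = (f \<circ> emb2) (\<phi>2 (k, t))"
    if "k < n2" "0 < t" "t < \<delta>" for k t
    using that ne[OF that] by (simp add: wedge_chart_def emb2_def)
  have e: "(f \<circ> emb2) p' = f (Inl p)" "(f \<circ> Inl) p = f (Inl p)" by (simp_all add: emb2_def)
  have "?L \<longleftrightarrow> (\<forall>k<n1. \<forall>t. 0 < t \<longrightarrow> t < \<delta> \<longrightarrow>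
        f (wedge_chart n1 \<phi>1 \<phi>2 (k, t)) = f (Inl p) + of_int (s k) * t) \<and>
      (\<forall>k<n2. \<forall>t. 0 < t \<longrightarrow> t < \<delta> \<longrightarrow>
        f (wedge_chart n1 \<phi>1 \<phi>2 (n1 + k, t)) = f (Inl p) + of_int (s (n1 + k)) * t)"
    (is "_ \<longleftrightarrow> (\<forall>k<n1. ?P k) \<and> (\<forall>k<n2. ?P (n1 + k))")
  proof -
    have "(\<forall>k<n1 + n2. Q k) \<longleftrightarrow> (\<forall>k<n1. Q k) \<and> (\<forall>k<n2. Q (n1 + k))" for Q
      by (metis add_less_cancel_left le_add_diff_inverse linorder_not_less trans_less_add1)
    from this[of ?P] show ?thesis unfolding linear_on_ball_chart[OF b] .
  qed
  also have "\<dots> \<longleftrightarrow> ?R1 \<and> ?R2"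
    unfolding linear_on_ball_chart[OF b1] linear_on_ball_chart[OF b2] e
    using w1 w2 by (simp cong: imp_cong conj_cong)
  finally show ?thesis .
qed

text \<open>The star at the wedge point is the union of the stars at \<open>p\<close> and
  \<open>p'\<close>, so the incoming slopes of both sides add.\<close>

lemma locally_linear_wedge_point:
  shows "locally_linear \<Gamma> f (Inl p) \<longleftrightarrow>
      locally_linear \<Gamma>1 (f \<circ> Inl) p \<and> locally_linear \<Gamma>2 (f \<circ> emb2) p'"
    and "locally_linear \<Gamma> f (Inl p) \<Longrightarrow>
      ord_at \<Gamma> f (Inl p) = ord_at \<Gamma>1 (f \<circ> Inl) p + ord_at \<Gamma>2 (f \<circ> emb2) p'"
proof -
  obtain n1 \<delta>1 \<phi>1 where b1': "ball_chart \<Gamma>1 p n1 \<delta>1 \<phi>1" using metric_graph_ball_chart[OF graph1 p] .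
  obtain n2 \<delta>2 \<phi>2 where b2': "ball_chart \<Gamma>2 p' n2 \<delta>2 \<phi>2" using metric_graph_ball_chart[OF graph2 p'] .
  define \<delta> where "\<delta> = min \<delta>1 \<delta>2"
  have "0 < \<delta>" using ball_chartD(1)[OF b1'] ball_chartD(1)[OF b2'] by (simp add: \<delta>_def)
  have b1: "ball_chart \<Gamma>1 p n1 \<delta> \<phi>1" and b2: "ball_chart \<Gamma>2 p' n2 \<delta> \<phi>2"
    using ball_chart_shrink[OF b1' \<open>0 < \<delta>\<close>] ball_chart_shrink[OF b2' \<open>0 < \<delta>\<close>] by (simp_all add: \<delta>_def)
  note b = ball_chart_wedge(1)[OF b1 b2]
  have 1: "locally_linear \<Gamma>1 (f \<circ> Inl) p \<and> locally_linear \<Gamma>2 (f \<circ> emb2) p' \<and>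
      ord_at \<Gamma> f (Inl p) = ord_at \<Gamma>1 (f \<circ> Inl) p + ord_at \<Gamma>2 (f \<circ> emb2) p'"
    if ll: "locally_linear \<Gamma> f (Inl p)"
  proof -
    obtain \<epsilon> s where \<epsilon>: "0 < \<epsilon>" "\<epsilon> \<le> \<delta>" and
      "\<forall>\<eta>\<in>{0<..\<epsilon>}. ball_chart \<Gamma> (Inl p) (n1 + n2) \<eta> (wedge_chart n1 \<phi>1 \<phi>2) \<and>
        linear_on_chart \<Gamma> f (Inl p) (n1 + n2) \<eta> (wedge_chart n1 \<phi>1 \<phi>2) s"
      by (rule locally_linear_on_ball_chart[OF ll b])
    then have l: "linear_on_chart \<Gamma> f (Inl p) (n1 + n2) \<epsilon> (wedge_chart n1 \<phi>1 \<phi>2) s" by simp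
    then have l1: "linear_on_chart \<Gamma>1 (f \<circ> Inl) p n1 \<epsilon> \<phi>1 s"
      and l2: "linear_on_chart \<Gamma>2 (f \<circ> emb2) p' n2 \<epsilon> \<phi>2 (\<lambda>k. s (n1 + k))"
      using linear_on_wedge_chart[OF ball_chart_shrink[OF b1 \<epsilon>] ball_chart_shrink[OF b2 \<epsilon>]] by simp_all
    have "(\<Sum>k<n1 + n2. - s k) = (\<Sum>k<n1. - s k) + (\<Sum>k<n2. - s (n1 + k))"
      by (induction n2) simp_all
    then show ?thesis
      using ord_at_eq[OF l] ord_at_eq[OF l1] ord_at_eq[OF l2] l1 l2 by (auto simp: locally_linear_def)
  qed
  have 2: "locally_linear \<Gamma> f (Inl p)"
    if ll: "locally_linear \<Gamma>1 (f \<circ> Inl) p" "locally_linear \<Gamma>2 (f \<circ> emb2) p'"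
  proof -
    obtain \<epsilon>1 s1 where \<epsilon>1: "0 < \<epsilon>1" "\<epsilon>1 \<le> \<delta>"
      "\<forall>\<eta>\<in>{0<..\<epsilon>1}. ball_chart \<Gamma>1 p n1 \<eta> \<phi>1 \<and> linear_on_chart \<Gamma>1 (f \<circ> Inl) p n1 \<eta> \<phi>1 s1"
      by (rule locally_linear_on_ball_chart[OF ll(1) b1])
    obtain \<epsilon>2 s2 where \<epsilon>2: "0 < \<epsilon>2" "\<epsilon>2 \<le> \<delta>"
      "\<forall>\<eta>\<in>{0<..\<epsilon>2}. ball_chart \<Gamma>2 p' n2 \<eta> \<phi>2 \<and> linear_on_chart \<Gamma>2 (f \<circ> emb2) p' n2 \<eta> \<phi>2 s2"
      by (rule locally_linear_on_ball_chart[OF ll(2) b2])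
    define \<epsilon> where "\<epsilon> = min \<epsilon>1 \<epsilon>2"
    have \<epsilon>: "\<epsilon> \<in> {0<..\<epsilon>1}" "\<epsilon> \<in> {0<..\<epsilon>2}" using \<epsilon>1(1) \<epsilon>2(1) by (auto simp: \<epsilon>_def)
    \<comment> \<open>The slopes are concatenated in the branch order of
      \<open>wedge_chart\<close>.\<close>
    define s where "s k = (if k < n1 then s1 k else s2 (k - n1))" for k
    have c1: "ball_chart \<Gamma>1 p n1 \<epsilon> \<phi>1" and c2: "ball_chart \<Gamma>2 p' n2 \<epsilon> \<phi>2"
      using \<epsilon>1(3) \<epsilon>2(3) \<epsilon> by blast+
    have "linear_on_chart \<Gamma>1 (f \<circ> Inl) p n1 \<epsilon> \<phi>1 s1" "linear_on_chart \<Gamma>2 (f \<circ> emb2) p' n2 \<epsilon> \<phi>2 s2"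
      using \<epsilon>1(3) \<epsilon>2(3) \<epsilon> by blast+
    then have "linear_on_chart \<Gamma>1 (f \<circ> Inl) p n1 \<epsilon> \<phi>1 s"
      "linear_on_chart \<Gamma>2 (f \<circ> emb2) p' n2 \<epsilon> \<phi>2 (\<lambda>k. s (n1 + k))"
      by (simp_all add: linear_on_chart_def s_def)
    then show ?thesis
      using linear_on_wedge_chart[OF c1 c2] unfolding locally_linear_def by blast
  qed
  show "locally_linear \<Gamma> f (Inl p) \<longleftrightarrow>
      locally_linear \<Gamma>1 (f \<circ> Inl) p \<and> locally_linear \<Gamma>2 (f \<circ> emb2) p'"
    "locally_linear \<Gamma> f (Inl p) \<Longrightarrow>
      ord_at \<Gamma> f (Inl p) = ord_at \<Gamma>1 (f \<circ> Inl) p + ord_at \<Gamma>2 (f \<circ> emb2) p'"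
    using 1 2 by blast+
qed

section \<open>Functions and principal divisors on the wedge\<close>

lemma pl_function_wedge:
  "pl_function \<Gamma> f \<longleftrightarrow> pl_function \<Gamma>1 (f \<circ> Inl) \<and> pl_function \<Gamma>2 (f \<circ> emb2)"
proof -
  have "pl_function \<Gamma> f \<longleftrightarrow> (\<forall>x\<in>mspace \<Gamma>1 - {p}. locally_linear \<Gamma> f (Inl x)) \<and>
      (\<forall>y\<in>mspace \<Gamma>2 - {p'}. locally_linear \<Gamma> f (Inr y)) \<and> locally_linear \<Gamma> f (Inl p)"
    using p unfolding pl_function_iff mspace_\<Gamma> by blast
  also have "\<dots> \<longleftrightarrow> (\<forall>x\<in>mspace \<Gamma>1 - {p}. locally_linear \<Gamma>1 (f \<circ> Inl) x) \<and>
      (\<forall>y\<in>mspace \<Gamma>2 - {p'}. locally_linear \<Gamma>2 (f \<circ> emb2) y) \<and>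
      locally_linear \<Gamma>1 (f \<circ> Inl) p \<and> locally_linear \<Gamma>2 (f \<circ> emb2) p'"
    using locally_linear_Inl(1) locally_linear_Inr(1) locally_linear_wedge_point(1) by simp
  also have "\<dots> \<longleftrightarrow> pl_function \<Gamma>1 (f \<circ> Inl) \<and> pl_function \<Gamma>2 (f \<circ> emb2)"
    using p p' unfolding pl_function_iff by blast
  finally show ?thesis .
qed

text \<open>The two pushforwards overlap only at the wedge point, where the order is additive; any
  other point is reached from one side only.\<close>

lemma divisor_of_wedge:
  assumes f: "pl_function \<Gamma> f"
  shows "divisor_of \<Gamma> f =
    pushforward Inl (divisor_of \<Gamma>1 (f \<circ> Inl)) + pushforward emb2 (divisor_of \<Gamma>2 (f \<circ> emb2))"
    (is "_ = pushforward Inl ?D1 + pushforward emb2 ?D2")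
proof (rule poly_mapping_eqI)
  fix z
  note c1 = metric_graph_compact[OF graph1] and c2 = metric_graph_compact[OF graph2]
    and c = metric_graph_compact[OF metric_graph_wedge]
  have f1: "pl_function \<Gamma>1 (f \<circ> Inl)" and f2: "pl_function \<Gamma>2 (f \<circ> emb2)"
    using f pl_function_wedge by blast+
  have D1: "?D1 \<in> Div \<Gamma>1" and D2: "?D2 \<in> Div \<Gamma>2"
    by (rule divisor_of_in_Div[OF c1 f1], rule divisor_of_in_Div[OF c2 f2])
  have l1: "Poly_Mapping.lookup (pushforward Inl ?D1) (Inl x :: 'a + 'b) = ord_at \<Gamma>1 (f \<circ> Inl) x"
    if "x \<in> mspace \<Gamma>1" for x
    using lookup_pushforward_inj[OF _ D1 that, of "Inl :: _ \<Rightarrow> 'a + 'b"] that by (simp add: lookup_divisor_of[OF c1 f1])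
  have l2: "Poly_Mapping.lookup (pushforward emb2 ?D2) (emb2 y) = ord_at \<Gamma>2 (f \<circ> emb2) y"
    if "y \<in> mspace \<Gamma>2" for y
    using lookup_pushforward_inj[OF inj_on_subset[OF inj_emb2 subset_UNIV] D2 that] that
    by (simp add: lookup_divisor_of[OF c2 f2])
  have n1: "Poly_Mapping.lookup (pushforward Inl ?D1) (z :: 'a + 'b) = 0" if "z \<notin> Inl ` mspace \<Gamma>1" for z
    using D1 that by (intro lookup_pushforward_notin) auto
  have n2: "Poly_Mapping.lookup (pushforward emb2 ?D2) z = 0" if "z \<notin> emb2 ` mspace \<Gamma>2" for z
    using D2 that by (intro lookup_pushforward_notin) auto
  have ll: "locally_linear \<Gamma> f z" if "z \<in> mspace \<Gamma>" for z
    using f that by (simp add: pl_function_iff)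
  show "Poly_Mapping.lookup (divisor_of \<Gamma> f) z =
      Poly_Mapping.lookup (pushforward Inl ?D1 + pushforward emb2 ?D2) z"
  proof (cases "z \<in> mspace \<Gamma>")
    case True
    then show ?thesis
    proof (cases rule: \<Gamma>_cases)
      case (1 x)
      have "z \<notin> emb2 ` mspace \<Gamma>2" using 1 by (auto simp: emb2_def)
      then show ?thesis
        using 1 l1[OF 1(2)] n2 ll[OF True] locally_linear_Inl(2)[OF 1(2,3)]
        by (simp add: lookup_add lookup_divisor_of[OF c f])
    next
      case (2 y)
      have "z \<notin> Inl ` mspace \<Gamma>1" "emb2 y = z" using 2 by (auto simp: emb2_def)
      then show ?thesis
        using 2 l2[OF 2(2)] n1 ll[OF True] locally_linear_Inr(2)[OF 2(2,3)]
        by (simp add: lookup_add lookup_divisor_of[OF c f])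
    next
      case 3
      have "emb2 p' = z" using 3 by (simp add: emb2_def)
      then show ?thesis
        using 3 l1[OF p] l2[OF p'] ll[OF True] locally_linear_wedge_point(2) True
        by (simp add: lookup_add lookup_divisor_of[OF c f])
    qed
  next
    case False
    then show ?thesis
      using n1[of z] n2[of z] by (auto simp: lookup_add lookup_divisor_of[OF c f] mspace_\<Gamma>')
  qed
qed

text \<open>Extend \<open>f\<close> by its value at \<open>p\<close>, that is, compose with
  \<open>retract1\<close>; the constant part contributes nothing to the divisor.\<close>

lemma principal_pushforward_Inl:
  assumes "principal \<Gamma>1 D"
  shows "principal \<Gamma> (pushforward Inl D)"
proof -
  obtain f where f: "pl_function \<Gamma>1 f" "D = divisor_of \<Gamma>1 f" using assms by (auto simp: principal_def)
  define g where "g = f \<circ> retract1"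
  have g: "g \<circ> Inl = f" "g \<circ> emb2 = (\<lambda>y. f p)" by (auto simp: g_def)
  have "pl_function \<Gamma> g"
    unfolding pl_function_wedge g using f pl_function_const[OF graph2] by blast
  then show ?thesis
    using divisor_of_wedge[of g] unfolding g pl_function_const(2)[OF graph2] f(2)[symmetric]
    by (auto simp: principal_def)
qed

lemma principal_pushforward_emb2:
  assumes "principal \<Gamma>2 D"
  shows "principal \<Gamma> (pushforward emb2 D)"
proof -
  obtain f where f: "pl_function \<Gamma>2 f" "D = divisor_of \<Gamma>2 f" using assms by (auto simp: principal_def)
  define g where "g = f \<circ> retract2"
  have g: "g \<circ> Inl = (\<lambda>x. f p')" "g \<circ> emb2 = f" by (auto simp: g_def)
  have "pl_function \<Gamma> g"
    unfolding pl_function_wedge g using f pl_function_const[OF graph1] by blast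
  then show ?thesis
    using divisor_of_wedge[of g] unfolding g pl_function_const(2)[OF graph1] f(2)[symmetric]
    by (auto simp: principal_def)
qed

text \<open>The retraction fixes the part from \<Gamma>1 and collapses the part from \<Gamma>2 to a
  multiple of \<open>p\<close>. The multiple is the degree of a principal divisor on \<Gamma>2,
  hence 0.\<close>

lemma principal_pushforward_retract1:
  assumes "principal \<Gamma> D"
  shows "principal \<Gamma>1 (pushforward retract1 D)"
proof -
  obtain f where f: "pl_function \<Gamma> f" "D = divisor_of \<Gamma> f" using assms by (auto simp: principal_def)
  then have f1: "pl_function \<Gamma>1 (f \<circ> Inl)" and f2: "pl_function \<Gamma>2 (f \<circ> emb2)"
    using pl_function_wedge by blast+
  have "retract1 \<circ> Inl = id" "retract1 \<circ> emb2 = (\<lambda>y. p)" by auto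
  then have "pushforward retract1 D = divisor_of \<Gamma>1 (f \<circ> Inl)"
    using div_degree_divisor_of[OF metric_graph_compact[OF graph2] f2]
    unfolding f(2) divisor_of_wedge[OF f(1)]
    by (simp add: pushforward_compose pushforward_id pushforward_const)
  then show ?thesis using f1 by (auto simp: principal_def)
qed

text \<open>By linearity a single point suffices: one retraction keeps it and the other sends it to
  the wedge point, which accounts for the degree term.\<close>

lemma pushforward_retract_decomposition:
  assumes "D \<in> Div \<Gamma>"
  shows "pushforward Inl (pushforward retract1 D) + pushforward emb2 (pushforward retract2 D) =
    D + frag_cmul (div_degree D) (frag_of (Inl p))"
proof -
  have "Poly_Mapping.keys D \<subseteq> mspace \<Gamma>" using assms by simp
  then show ?thesis
  proof (induction D rule: frag_induction)
    case (one z)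
    then show ?case by (cases z rule: sum.exhaust) (simp_all add: emb2_def)
  next
    case (diff D E)
    then show ?case by (simp add: frag_cmul_diff_distrib algebra_simps)
  qed simp
qed

end

section \<open>Divisors on a loop\<close>

text \<open>A kink at \<open>\<theta>\<close> itself already bends the function on its right, so the
  right slope counts all \<open>x\<close> with \<open>a x \<le> \<theta>\<close>.\<close>

lemma kink_sum_right:
  fixes a :: "'a \<Rightarrow> real" and m :: "'a \<Rightarrow> int"
  assumes "finite S"
  shows "\<exists>\<epsilon>>0. \<forall>t. 0 < t \<and> t < \<epsilon> \<longrightarrow> (\<Sum>x\<in>S. of_int (m x) * max 0 (\<theta> + t - a x)) =
    (\<Sum>x\<in>S. of_int (m x) * max 0 (\<theta> - a x)) + of_int (\<Sum>x | x \<in> S \<and> a x \<le> \<theta>. m x) * t"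
proof -
  have "\<forall>x\<in>S. eventually (\<lambda>t. max 0 (\<theta> + t - a x) = max 0 (\<theta> - a x) + (if a x \<le> \<theta> then t else 0)) (at_right 0)"
  proof
    fix x
    show "eventually (\<lambda>t. max 0 (\<theta> + t - a x) = max 0 (\<theta> - a x) + (if a x \<le> \<theta> then t else 0)) (at_right 0)"
      unfolding eventually_at_right_field
      by (rule exI[of _ "if a x \<le> \<theta> then 1 else a x - \<theta>"]) auto
  qed
  then have "eventually (\<lambda>t. \<forall>x\<in>S. max 0 (\<theta> + t - a x) = max 0 (\<theta> - a x) + (if a x \<le> \<theta> then t else 0)) (at_right 0)"
    using assms by (simp add: eventually_ball_finite)
  then obtain \<epsilon> where \<epsilon>: "0 < \<epsilon>"
    "\<forall>t>0. t < \<epsilon> \<longrightarrow> (\<forall>x\<in>S. max 0 (\<theta> + t - a x) = max 0 (\<theta> - a x) + (if a x \<le> \<theta> then t else 0))"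
    unfolding eventually_at_right_field by blast
  have "(\<Sum>x\<in>S. of_int (m x) * max 0 (\<theta> + t - a x)) =
    (\<Sum>x\<in>S. of_int (m x) * max 0 (\<theta> - a x)) + of_int (\<Sum>x | x \<in> S \<and> a x \<le> \<theta>. m x) * t"
    if t: "0 < t" "t < \<epsilon>" for t
  proof -
    have "(\<Sum>x\<in>S. of_int (m x) * max 0 (\<theta> + t - a x)) =
        (\<Sum>x\<in>S. of_int (m x) * max 0 (\<theta> - a x) + (if a x \<le> \<theta> then of_int (m x) * t else 0))"
      using \<epsilon>(2) t by (intro sum.cong) (auto simp: distrib_left)
    also have "\<dots> = (\<Sum>x\<in>S. of_int (m x) * max 0 (\<theta> - a x)) +
        (\<Sum>x | x \<in> S \<and> a x \<le> \<theta>. of_int (m x) * t)"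
      using assms by (simp add: sum.distrib sum.inter_filter)
    finally show ?thesis by (simp add: sum_distrib_right)
  qed
  then show ?thesis using \<epsilon>(1) by blast
qed

text \<open>To the left, a kink at \<open>\<theta>\<close> is not yet felt, hence the strict
  inequality; the two slopes differ by the kinks at \<open>\<theta>\<close>.\<close>

lemma kink_sum_left:
  fixes a :: "'a \<Rightarrow> real" and m :: "'a \<Rightarrow> int"
  assumes "finite S"
  shows "\<exists>\<epsilon>>0. \<forall>t. 0 < t \<and> t < \<epsilon> \<longrightarrow> (\<Sum>x\<in>S. of_int (m x) * max 0 (\<theta> - t - a x)) =
    (\<Sum>x\<in>S. of_int (m x) * max 0 (\<theta> - a x)) - of_int (\<Sum>x | x \<in> S \<and> a x < \<theta>. m x) * t"
proof -
  have "\<forall>x\<in>S. eventually (\<lambda>t. max 0 (\<theta> - t - a x) = max 0 (\<theta> - a x) - (if a x < \<theta> then t else 0)) (at_right 0)"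
  proof
    fix x
    show "eventually (\<lambda>t. max 0 (\<theta> - t - a x) = max 0 (\<theta> - a x) - (if a x < \<theta> then t else 0)) (at_right 0)"
      unfolding eventually_at_right_field
      by (rule exI[of _ "if a x < \<theta> then \<theta> - a x else 1"]) auto
  qed
  then have "eventually (\<lambda>t. \<forall>x\<in>S. max 0 (\<theta> - t - a x) = max 0 (\<theta> - a x) - (if a x < \<theta> then t else 0)) (at_right 0)"
    using assms by (simp add: eventually_ball_finite)
  then obtain \<epsilon> where \<epsilon>: "0 < \<epsilon>"
    "\<forall>t>0. t < \<epsilon> \<longrightarrow> (\<forall>x\<in>S. max 0 (\<theta> - t - a x) = max 0 (\<theta> - a x) - (if a x < \<theta> then t else 0))"
    unfolding eventually_at_right_field by blast
  have "(\<Sum>x\<in>S. of_int (m x) * max 0 (\<theta> - t - a x)) =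
    (\<Sum>x\<in>S. of_int (m x) * max 0 (\<theta> - a x)) - of_int (\<Sum>x | x \<in> S \<and> a x < \<theta>. m x) * t"
    if t: "0 < t" "t < \<epsilon>" for t
  proof -
    have "(\<Sum>x\<in>S. of_int (m x) * max 0 (\<theta> - t - a x)) =
        (\<Sum>x\<in>S. of_int (m x) * max 0 (\<theta> - a x) - (if a x < \<theta> then of_int (m x) * t else 0))"
      using \<epsilon>(2) t by (intro sum.cong) (auto simp: right_diff_distrib)
    also have "\<dots> = (\<Sum>x\<in>S. of_int (m x) * max 0 (\<theta> - a x)) -
        (\<Sum>x | x \<in> S \<and> a x < \<theta>. of_int (m x) * t)"
      using assms by (simp add: sum_subtractf sum.inter_filter)
    finally show ?thesis by (simp add: sum_distrib_right)
  qed
  then show ?thesis using \<epsilon>(1) by blast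
qed

text \<open>\<open>arg\<close> cuts the circle open at the point of coordinate 0, which is why that
  point is treated separately below.\<close>

locale circle_coordinate =
  fixes \<Gamma> :: "'a metric" and L :: real and arg :: "'a \<Rightarrow> real"
  assumes graph: "metric_graph \<Gamma>" and L: "0 < L"
    and arg_image: "arg ` mspace \<Gamma> = {0..<L}"
    and mdist_arg: "\<And>x y. \<lbrakk>x \<in> mspace \<Gamma>; y \<in> mspace \<Gamma>\<rbrakk> \<Longrightarrow> mdist \<Gamma> x y = circle_dist L (arg x) (arg y)"
begin

lemma arg_range: "x \<in> mspace \<Gamma> \<Longrightarrow> 0 \<le> arg x \<and> arg x < L"
  using arg_image by (metis atLeastLessThan_iff image_eqI)

lemma inj_arg: "inj_on arg (mspace \<Gamma>)"
proof (rule inj_onI)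
  fix x y assume "x \<in> mspace \<Gamma>" "y \<in> mspace \<Gamma>" "arg x = arg y"
  then have "mdist \<Gamma> x y = 0" by (simp add: mdist_arg circle_dist_def)
  then show "x = y" using \<open>x \<in> mspace \<Gamma>\<close> \<open>y \<in> mspace \<Gamma>\<close> by simp
qed

definition pt :: "real \<Rightarrow> 'a" where
  "pt = inv_into (mspace \<Gamma>) arg"

lemma pt: "0 \<le> u \<Longrightarrow> u < L \<Longrightarrow> pt u \<in> mspace \<Gamma> \<and> arg (pt u) = u"
  using arg_image unfolding pt_def by (metis atLeastLessThan_iff f_inv_into_f inv_into_into)

lemma pt_arg: "x \<in> mspace \<Gamma> \<Longrightarrow> pt (arg x) = x"
  unfolding pt_def by (rule inv_into_f_f[OF inj_arg])

text \<open>Branch 1 runs with the coordinate, branch 0 against it. The last case wraps around the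
  cut; with the radii used below it occurs only for \<open>\<theta> = 0\<close>.\<close>

definition coord :: "real \<Rightarrow> nat \<Rightarrow> real \<Rightarrow> real" where
  "coord \<theta> j t = (if j = 1 then \<theta> + t else if t \<le> \<theta> then \<theta> - t else L + \<theta> - t)"

text \<open>The bounds by \<open>arg y\<close> and \<open>L - arg y\<close> keep branches from
  crossing the cut, except backwards from coordinate 0. The bound \<open>L / 4\<close> keeps each
  \<open>t + u\<close> below half the circumference, so that it is the shorter arc.\<close>

lemma ball_chart_circle:
  assumes y: "y \<in> mspace \<Gamma>" and \<delta>: "0 < \<delta>" "\<delta> \<le> L / 4" "\<delta> \<le> L - arg y" "0 < arg y \<Longrightarrow> \<delta> \<le> arg y"
  shows "ball_chart \<Gamma> y 2 \<delta> (\<lambda>(j, t). pt (coord (arg y) j t))"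
proof (rule ball_chartI)
  define \<theta> where "\<theta> = arg y"
  have \<theta>: "0 \<le> \<theta>" "\<theta> < L" "\<delta> \<le> L - \<theta>" "\<theta> = 0 \<or> \<delta> \<le> \<theta>"
    using arg_range[OF y] \<delta>(3) \<delta>(4) unfolding \<theta>_def by (auto simp: less_eq_real_def)
  have ran: "0 \<le> coord \<theta> j t \<and> coord \<theta> j t < L" if "0 < t" "t < \<delta>" for j t
    using that \<theta> \<delta> by (auto simp: coord_def)
  show "(case (j, t) of (j, t) \<Rightarrow> pt (coord (arg y) j t)) \<in> mspace \<Gamma>" if "0 < t" "t < \<delta>" for j t
    using pt ran[OF that] by (simp add: \<theta>_def)
  show "mdist \<Gamma> y (case (j, t) of (j, t) \<Rightarrow> pt (coord (arg y) j t)) = t" if "0 < t" "t < \<delta>" for j t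
  proof -
    have "circle_dist L \<theta> (coord \<theta> j t) = t"
      using that \<theta> \<delta> by (auto simp: coord_def circle_dist_def)
    then show ?thesis using mdist_arg[OF y] pt ran[OF that] by (simp add: \<theta>_def)
  qed
  show "mdist \<Gamma> (case (k, t) of (j, t) \<Rightarrow> pt (coord (arg y) j t))
      (case (j, u) of (j, t) \<Rightarrow> pt (coord (arg y) j t)) = (if k = j then \<bar>t - u\<bar> else t + u)"
    if "k < 2" "0 < t" "t < \<delta>" "j < 2" "0 < u" "u < \<delta>" for k t j u
  proof -
    have "k = 0 \<or> k = 1" "j = 0 \<or> j = 1" using that by auto
    then have "circle_dist L (coord \<theta> k t) (coord \<theta> j u) = (if k = j then \<bar>t - u\<bar> else t + u)"
      using that \<theta> \<delta> by (elim disjE) (simp_all add: coord_def circle_dist_def min_def abs_if)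
    then show ?thesis
      using mdist_arg pt ran[OF that(2,3), of k] ran[OF that(5,6), of j] by (simp add: \<theta>_def)
  qed
  show "\<exists>j<2. (case (j, t) of (j, t) \<Rightarrow> pt (coord (arg y) j t)) = x"
    if x: "x \<in> mspace \<Gamma>" "mdist \<Gamma> y x = t" "0 < t" "t < \<delta>" for x t
  proof -
    have "circle_dist L \<theta> (arg x) = t" using mdist_arg[OF y x(1)] x(2) by (simp add: \<theta>_def)
    then have "arg x = coord \<theta> 0 t \<or> arg x = coord \<theta> 1 t"
      using arg_range[OF x(1)] x \<theta> \<delta> by (auto simp: coord_def circle_dist_def min_def abs_if split: if_splits)
    then show ?thesis
      using pt_arg[OF x(1)] by (auto simp: \<theta>_def intro: exI[of _ 0] exI[of _ 1])
  qed
  show "(case (0, 0) of (j, t) \<Rightarrow> pt (coord (arg y) j t)) = y"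
    using pt_arg[OF y] \<theta> by (simp add: coord_def \<theta>_def)
qed (use y \<delta> in auto)

text \<open>The function \<open>f\<close> below is \<open>T \<circ> arg\<close> for the piecewise linear \<open>T\<close> on \<open>[0,L]\<close> with a kink of
  size \<open>D x\<close> at every \<open>arg x\<close>; the hypotheses say that \<open>T\<close> has equal values and, up to the kink
  at \<open>0\<close>, equal slopes at the two ends.\<close>

lemma principal_circle:
  assumes D: "D \<in> Div \<Gamma>" and deg: "div_degree D = 0"
    and period: "(\<Sum>x\<in>Poly_Mapping.keys D. of_int (Poly_Mapping.lookup D x) * arg x) = of_int j * L"
  shows "principal \<Gamma> D"
proof -
  define S where "S = Poly_Mapping.keys D"
  define m where "m = Poly_Mapping.lookup D"
  define K where "K u = (\<Sum>x\<in>S. of_int (m x) * max 0 (u - arg x))" for u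
  \<comment> \<open>With degree 0 and the period condition, \<open>K L\<close> equals minus
    \<open>j\<close> times \<open>L\<close>. The linear term cancels this, so \<open>T\<close>
    agrees at 0 and \<open>L\<close>.\<close>
  define T where "T u = of_int j * u + K u" for u
  define f where "f = T \<circ> arg"
  have S: "finite S" "S \<subseteq> mspace \<Gamma>" using D by (auto simp: S_def)
  have m_S: "m x = 0" if "x \<notin> S" for x using that by (simp add: S_def m_def in_keys_iff)
  have sum_m: "(\<Sum>x\<in>S. m x) = 0" using deg by (simp add: div_degree_def S_def m_def)
  have sum_m': "(\<Sum>x\<in>S. of_int (m x) :: real) = 0"
    using sum_m by (metis of_int_0 of_int_sum)
  have T0: "T 0 = 0"
  proof -
    have "K 0 = 0"
      unfolding K_def using arg_range S(2) by (intro sum.neutral) auto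
    then show ?thesis by (simp add: T_def)
  qed
  have TL: "T L = 0"
  proof -
    have "of_int (m x) * max 0 (L - arg x) = of_int (m x) * L - of_int (m x) * arg x" if "x \<in> S" for x
      using arg_range[of x] S(2) that by (auto simp: right_diff_distrib)
    then have "K L = (\<Sum>x\<in>S. of_int (m x)) * L - (\<Sum>x\<in>S. of_int (m x) * arg x)"
      by (simp add: K_def sum_subtractf sum_distrib_right)
    then show ?thesis using sum_m' period by (simp add: T_def S_def m_def)
  qed
  have local: "locally_linear \<Gamma> f y \<and> ord_at \<Gamma> f y = - m y" if y: "y \<in> mspace \<Gamma>" for y
  proof -
    define \<theta> where "\<theta> = arg y"
    \<comment> \<open>Just before coordinate 0 lies the end \<open>L\<close> of the interval, so the
      left slope at the base point is read there.\<close>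
    define \<theta>' where "\<theta>' = (if \<theta> = 0 then L else \<theta>)"
    have \<theta>: "0 \<le> \<theta>" "\<theta> < L" using arg_range[OF y] by (auto simp: \<theta>_def)
    have T\<theta>': "T \<theta>' = T \<theta>" using T0 TL by (simp add: \<theta>'_def)
    define r where "r = (\<Sum>x | x \<in> S \<and> arg x \<le> \<theta>. m x)"
    define l where "l = (\<Sum>x | x \<in> S \<and> arg x < \<theta>'. m x)"
    obtain \<epsilon>1 where \<epsilon>1: "0 < \<epsilon>1" "\<forall>t. 0 < t \<and> t < \<epsilon>1 \<longrightarrow> K (\<theta> + t) = K \<theta> + of_int r * t"
      using kink_sum_right[OF S(1), of m \<theta> arg] unfolding K_def r_def by blast
    obtain \<epsilon>2 where \<epsilon>2: "0 < \<epsilon>2" "\<forall>t. 0 < t \<and> t < \<epsilon>2 \<longrightarrow> K (\<theta>' - t) = K \<theta>' - of_int l * t"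
      using kink_sum_left[OF S(1), of m \<theta>' arg] unfolding K_def l_def by blast
    define \<delta> where "\<delta> = Min {\<epsilon>1, \<epsilon>2, L / 4, L - \<theta>, \<theta>'}"
    have \<delta>: "0 < \<delta>" "\<delta> \<le> \<epsilon>1" "\<delta> \<le> \<epsilon>2" "\<delta> \<le> L / 4" "\<delta> \<le> L - \<theta>" "\<delta> \<le> \<theta>'"
    proof -
      show "0 < \<delta>" unfolding \<delta>_def using \<epsilon>1(1) \<epsilon>2(1) L \<theta> by (auto simp: \<theta>'_def)
    qed (unfold \<delta>_def, rule Min_le; simp)+
    have b: "ball_chart \<Gamma> y 2 \<delta> (\<lambda>(j, t). pt (coord \<theta> j t))"
      unfolding \<theta>_def by (rule ball_chart_circle[OF y]) (use \<delta> in \<open>auto simp: \<theta>_def \<theta>'_def split: if_splits\<close>)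
    \<comment> \<open>Outgoing slopes: branch 0 runs against the coordinate, hence the sign.\<close>
    define s where "s k = (if k = (0::nat) then - (j + l) else j + r)" for k
    have lin: "linear_on_chart \<Gamma> f y 2 \<delta> (\<lambda>(j, t). pt (coord \<theta> j t)) s"
      unfolding linear_on_ball_chart[OF b]
    proof (intro allI impI)
      fix k :: nat and t :: real assume k: "k < 2" and t: "0 < t" "t < \<delta>"
      have ran: "0 \<le> coord \<theta> k t \<and> coord \<theta> k t < L"
        using t \<theta> \<delta> by (auto simp: coord_def \<theta>'_def split: if_splits)
      have "T (coord \<theta> k t) = T \<theta> + of_int (s k) * t"
      proof (cases "k = 0")
        case True
        then have "coord \<theta> k t = \<theta>' - t" using t \<delta> \<theta> by (auto simp: coord_def \<theta>'_def split: if_splits)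
        moreover have "T (\<theta>' - t) = T \<theta>' + of_int (s k) * t"
          using \<epsilon>2(2)[rule_format, of t] t \<delta>(3) True by (simp add: T_def s_def algebra_simps)
        ultimately show ?thesis using T\<theta>' by simp
      next
        case False
        then have "coord \<theta> k t = \<theta> + t" using k by (simp add: coord_def)
        moreover have "T (\<theta> + t) = T \<theta> + of_int (s k) * t"
          using \<epsilon>1(2)[rule_format, of t] t \<delta>(2) False by (simp add: T_def s_def algebra_simps)
        ultimately show ?thesis by simp
      qed
      then show "f (case (k, t) of (j, t) \<Rightarrow> pt (coord \<theta> j t)) = f y + of_int (s k) * t"
        using pt ran by (simp add: f_def \<theta>_def)
    qed
    have arg_eq: "arg x = \<theta> \<longleftrightarrow> x = y" if "x \<in> S" for x
      using inj_on_eq_iff[OF inj_arg _ y] subsetD[OF S(2) that] by (simp add: \<theta>_def)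
    have "r - l = m y"
    proof (cases "\<theta> = 0")
      case True
      \<comment> \<open>At the base point the left slope counts all kinks, and these sum to the
        degree of \<open>D\<close>, which is 0.\<close>
      have "{x. x \<in> S \<and> arg x < \<theta>'} = S" using True S(2) arg_range by (auto simp: \<theta>'_def)
      then have "l = 0" using sum_m by (simp add: l_def)
      have "arg x \<le> \<theta> \<longleftrightarrow> x = y" if "x \<in> S" for x
        using True arg_eq[OF that] arg_range[OF subsetD[OF S(2) that]] by auto
      then have "{x. x \<in> S \<and> arg x \<le> \<theta>} = S \<inter> {y}" by auto
      then have "r = m y" using m_S by (simp add: r_def Int_insert_right)
      with \<open>l = 0\<close> show ?thesis by simp
    next
      case False
      have split: "{x. x \<in> S \<and> arg x \<le> \<theta>} = {x. x \<in> S \<and> arg x < \<theta>} \<union> (S \<inter> {y})"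
        using arg_eq by (auto simp: less_eq_real_def)
      have "r = (\<Sum>x | x \<in> S \<and> arg x < \<theta>. m x) + (\<Sum>x\<in>S \<inter> {y}. m x)"
        unfolding r_def split using S(1) by (intro sum.union_disjoint) (auto simp: \<theta>_def)
      then show ?thesis using m_S False by (simp add: l_def \<theta>'_def Int_insert_right)
    qed
    moreover have "(\<Sum>k<2. - s k) = l - r" by (simp add: s_def numeral_2_eq_2)
    ultimately show ?thesis using ord_at_eq[OF lin] lin by (auto simp: locally_linear_def)
  qed
  \<comment> \<open>Orders count incoming slopes, so a positive kink gives a negative order and
    \<open>f\<close> has divisor \<open>- D\<close>.\<close>
  have "principal \<Gamma> (- D)"
    unfolding principal_iff[OF metric_graph_compact[OF graph]]
    using local S(2) m_S by (intro exI[of _ f]) (auto simp: pl_function_iff m_def[symmetric])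
  then show ?thesis using principal_uminus[OF graph] by fastforce
qed

text \<open>Abel-Jacobi on the circle: the coordinate of \<open>x\<close> is the weighted sum of the
  coordinates of \<open>D\<close>, reduced modulo \<open>L\<close>.\<close>

lemma degree_one_equiv_point:
  assumes D: "D \<in> Div \<Gamma>" "div_degree D = 1"
  obtains x where "x \<in> mspace \<Gamma>" "principal \<Gamma> (D - frag_of x)"
proof -
  define w where "w E = (\<Sum>x\<in>Poly_Mapping.keys E. of_int (Poly_Mapping.lookup E x) * arg x)" for E
  have w_superset: "w E = (\<Sum>x\<in>A. of_int (Poly_Mapping.lookup E x) * arg x)"
    if "finite A" "Poly_Mapping.keys E \<subseteq> A" for E A
    unfolding w_def using that by (intro sum.mono_neutral_left) (auto simp: in_keys_iff)
  \<comment> \<open>The number of full turns; it also serves as the integer in the period condition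
    of \<open>principal_circle\<close>.\<close>
  define j where "j = \<lfloor>w D / L\<rfloor>"
  define u where "u = w D - of_int j * L"
  have "of_int j \<le> w D / L" "w D / L < of_int j + 1" by (auto simp: j_def)
  then have u: "0 \<le> u" "u < L" using L by (simp_all add: u_def field_simps)
  define x where "x = pt u"
  have x: "x \<in> mspace \<Gamma>" "arg x = u" using pt[OF u] by (simp_all add: x_def)
  show thesis
  proof (rule that[OF x(1)], rule principal_circle)
    show "D - frag_of x \<in> Div \<Gamma>" using Div_diff[OF D(1), of "frag_of x"] x(1) by simp
    show "div_degree (D - frag_of x) = 0" using D(2) by simp
    define A where "A = insert x (Poly_Mapping.keys D)"
    have A: "finite A" "x \<in> A" "Poly_Mapping.keys D \<subseteq> A" by (auto simp: A_def)
    have wD: "w D = (\<Sum>z\<in>A. of_int (Poly_Mapping.lookup D z) * arg z)"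
      by (rule w_superset[OF A(1,3)])
    have "w (D - frag_of x) = (\<Sum>z\<in>A. of_int (Poly_Mapping.lookup (D - frag_of x) z) * arg z)"
      using keys_diff[of D "frag_of x"] A by (intro w_superset) auto
    also have "\<dots> = (\<Sum>z\<in>A. of_int (Poly_Mapping.lookup D z) * arg z - (if z = x then arg z else 0))"
      by (intro sum.cong) (auto simp: lookup_minus algebra_simps)
    also have "\<dots> = w D - arg x"
      using A by (simp add: wD sum_subtractf)
    finally show "(\<Sum>z\<in>Poly_Mapping.keys (D - frag_of x).
        of_int (Poly_Mapping.lookup (D - frag_of x) z) * arg z) = of_int j * L"
      by (simp add: w_def[symmetric] x(2)) (simp add: u_def)
  qed
qed

end

lemma loop_degree_one_equiv_point:
  assumes "loop \<Gamma>" "D \<in> Div \<Gamma>" "div_degree D = 1"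
  obtains x where "x \<in> mspace \<Gamma>" "principal \<Gamma> (D - frag_of x)"
proof -
  obtain L \<phi> where L: "0 < L" and \<phi>: "is_isometry \<Gamma> (circle L) \<phi>"
    using assms(1) by (auto simp: loop_def isometric_def)
  interpret circle_coordinate \<Gamma> L \<phi>
    using assms(1) L \<phi> by unfold_locales (auto simp: loop_def is_isometry_def mspace_circle mdist_circle)
  show thesis using degree_one_equiv_point[OF assms(2,3)] that by blast
qed

section \<open>Ranks\<close>

lemma equiv_effective_iff:
  "equiv_effective \<Gamma> D \<longleftrightarrow>
     D \<in> Div \<Gamma> \<and> (\<exists>F\<in>Div \<Gamma>. effective F \<and> principal \<Gamma> (D - F))"
  by (auto simp: equiv_effective_def lin_equiv_def)

lemma equiv_effectiveI:
  "\<lbrakk>D \<in> Div \<Gamma>; F \<in> Div \<Gamma>; effective F; principal \<Gamma> (D - F)\<rbrakk> \<Longrightarrow> equiv_effective \<Gamma> D"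
  unfolding equiv_effective_iff by blast

lemma equiv_effective_add:
  assumes "equiv_effective \<Gamma> D" "E \<in> Div \<Gamma>" "effective E"
  shows "equiv_effective \<Gamma> (D + E)"
proof -
  obtain F where F: "D \<in> Div \<Gamma>" "F \<in> Div \<Gamma>" "effective F" "principal \<Gamma> (D - F)"
    using assms(1) unfolding equiv_effective_iff by blast
  show ?thesis
    by (rule equiv_effectiveI[OF Div_add[OF F(1) assms(2)] Div_add[OF F(2) assms(2)]
          effective_add[OF F(3) assms(3)]]) (use F(4) in simp)
qed

lemma effective_degree_0:
  assumes "effective D" "div_degree D = 0"
  shows "D = 0"
proof -
  have "\<forall>x\<in>Poly_Mapping.keys D. Poly_Mapping.lookup D x = 0"
    using assms unfolding div_degree_def effective_def by (simp add: sum_nonneg_eq_0_iff)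
  then show ?thesis by (intro poly_mapping_eqI) (metis in_keys_iff lookup_zero)
qed

lemma ex_effective_of_degree:
  assumes "x \<in> mspace \<Gamma>"
  obtains E where "E \<in> Div \<Gamma>" "effective E" "div_degree E = int n"
proof (rule that[of "frag_cmul (int n) (frag_of x)"])
  show "frag_cmul (int n) (frag_of x) \<in> Div \<Gamma>" using assms by (auto split: if_splits)
  show "effective (frag_cmul (int n) (frag_of x))" by (simp add: effective_def)
  show "div_degree (frag_cmul (int n) (frag_of x)) = int n"
    using div_degree_superset[of "{x}" "frag_cmul (int n) (frag_of x)"] keys_cmul[of "int n" "frag_of x"]
    by simp
qed

definition rank_cond :: "'a metric \<Rightarrow> ('a \<Rightarrow>\<^sub>0 int) \<Rightarrow> nat \<Rightarrow> bool" where
  "rank_cond \<Gamma> D r \<longleftrightarrow>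
     (\<forall>E\<in>Div \<Gamma>. effective E \<and> div_degree E = int r \<longrightarrow> equiv_effective \<Gamma> (D - E))"

text \<open>A test divisor of degree \<open>r\<close> is enlarged by one point; giving the point
  back afterwards preserves equivalence to an effective divisor.\<close>

lemma rank_cond_Suc:
  assumes "metric_graph \<Gamma>" "rank_cond \<Gamma> D (Suc r)"
  shows "rank_cond \<Gamma> D r"
  unfolding rank_cond_def
proof (intro ballI impI)
  fix E assume E: "E \<in> Div \<Gamma>" "effective E \<and> div_degree E = int r"
  obtain x where x: "x \<in> mspace \<Gamma>" using assms(1) by (auto simp: metric_graph_def)
  then have xD: "frag_of x \<in> Div \<Gamma>" by simp
  have "equiv_effective \<Gamma> (D - (E + frag_of x))"
    using assms(2) Div_add[OF E(1) xD] E(2) by (simp add: rank_cond_def effective_add)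
  from equiv_effective_add[OF this xD] show "equiv_effective \<Gamma> (D - E)"
    by (simp add: algebra_simps)
qed

lemma rank_cond_mono:
  assumes "metric_graph \<Gamma>" "rank_cond \<Gamma> D r" "q \<le> r"
  shows "rank_cond \<Gamma> D q"
  using assms(3,2) by (induction rule: inc_induct) (auto intro: rank_cond_Suc[OF assms(1)])

text \<open>Equivalence preserves degree, so \<open>D - E\<close> has nonnegative degree. This bound
  is what makes the \<open>GREATEST\<close> in \<open>div_rank\<close> exist.\<close>

lemma rank_cond_le_degree:
  assumes "metric_graph \<Gamma>" "rank_cond \<Gamma> D r"
  shows "int r \<le> div_degree D"
proof -
  obtain x where "x \<in> mspace \<Gamma>" using assms(1) by (auto simp: metric_graph_def)
  then obtain E where E: "E \<in> Div \<Gamma>" "effective E" "div_degree E = int r"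
    by (rule ex_effective_of_degree)
  then obtain F where "effective F" "principal \<Gamma> (D - E - F)"
    using assms(2) unfolding rank_cond_def equiv_effective_iff by blast
  then show ?thesis
    using div_degree_principal[OF assms(1)] div_degree_effective E(3) by fastforce
qed

text \<open>The \<open>r\<close> satisfying \<open>rank_cond\<close> form an initial segment bounded
  by the degree, so comparing with the largest one is the same as satisfying the condition.\<close>

lemma le_div_rank_iff:
  assumes "metric_graph \<Gamma>"
  shows "int r \<le> div_rank \<Gamma> D \<longleftrightarrow> rank_cond \<Gamma> D r"
proof (cases "equiv_effective \<Gamma> D")
  case True
  then have 0: "rank_cond \<Gamma> D 0"
    using effective_degree_0 by (fastforce simp: rank_cond_def)
  have bound: "q \<le> nat (div_degree D)" if "rank_cond \<Gamma> D q" for q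
    using rank_cond_le_degree[OF assms that] by simp
  define q where "q = (GREATEST q. rank_cond \<Gamma> D q)"
  have "div_rank \<Gamma> D = int q"
    using True by (simp add: div_rank_def rank_cond_def q_def)
  moreover have "rank_cond \<Gamma> D q"
    unfolding q_def by (rule GreatestI_nat[where P = "rank_cond \<Gamma> D", OF 0 bound])
  moreover have "r \<le> q" if "rank_cond \<Gamma> D r"
    unfolding q_def by (rule Greatest_le_nat[where P = "rank_cond \<Gamma> D", OF that bound])
  moreover have "rank_cond \<Gamma> D r" if "r \<le> q"
    using rank_cond_mono[OF assms \<open>rank_cond \<Gamma> D q\<close> that] .
  ultimately show ?thesis by auto
next
  case False
  \<comment> \<open>Here \<open>div_rank\<close> is -1; any \<open>rank_cond\<close>, lowered to 0
    and tested with the zero divisor, would make \<open>D\<close> equivalent to an effective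
    divisor.\<close>
  have "equiv_effective \<Gamma> D" if "rank_cond \<Gamma> D r"
    using bspec[OF rank_cond_mono[OF assms that, of 0, unfolded rank_cond_def], of 0] by simp
  then show ?thesis using False by (auto simp: div_rank_def)
qed

lemma W_nonempty_iff:
  assumes "metric_graph \<Gamma>"
  shows "W \<Gamma> r d \<noteq> {} \<longleftrightarrow>
    (\<exists>D\<in>Div \<Gamma>. div_degree D = int d \<and> int r \<le> div_rank \<Gamma> D)"
proof
  assume "W \<Gamma> r d \<noteq> {}"
  then show "\<exists>D\<in>Div \<Gamma>. div_degree D = int d \<and> int r \<le> div_rank \<Gamma> D"
    unfolding W_def Pic_def lin_class_def lin_equiv_def by blast
next
  assume "\<exists>D\<in>Div \<Gamma>. div_degree D = int d \<and> int r \<le> div_rank \<Gamma> D"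
  then obtain D where D: "D \<in> Div \<Gamma>" "div_degree D = int d" "int r \<le> div_rank \<Gamma> D" by blast
  then have "D \<in> lin_class \<Gamma> D"
    using principal_0[OF assms] unfolding lin_class_def lin_equiv_def by simp
  then have "lin_class \<Gamma> D \<in> W \<Gamma> r d" using D unfolding W_def Pic_def by blast
  then show "W \<Gamma> r d \<noteq> {}" by blast
qed

section \<open>Existence of the maximum in the Brill-Noether rank\<close>

definition bn_cond :: "'a metric \<Rightarrow> nat \<Rightarrow> nat \<Rightarrow> int \<Rightarrow> bool" where
  "bn_cond \<Gamma> r d k \<longleftrightarrow> (\<forall>E\<in>Div \<Gamma>. effective E \<and> div_degree E = int r + k \<longrightarrow>
     (\<exists>D\<in>Div \<Gamma>. div_degree D = int d \<and> int r \<le> div_rank \<Gamma> D \<and> effective (D - E)))"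

text \<open>A divisor of degree \<open>d\<close> that contains a test divisor of degree
  \<open>r + k\<close> forces \<open>k \<le> d - r\<close>, so a largest integer \<open>k\<close>
  exists.\<close>

lemma bn_rank_greatest:
  assumes "metric_graph \<Gamma>" "W \<Gamma> r d \<noteq> {}"
  shows "bn_cond \<Gamma> r d (bn_rank \<Gamma> r d)" "\<And>k. bn_cond \<Gamma> r d k \<Longrightarrow> k \<le> bn_rank \<Gamma> r d"
proof -
  have bound: "k \<le> int d - int r" if k: "bn_cond \<Gamma> r d k" for k
  proof (cases "0 \<le> int r + k")
    case True
    obtain x where "x \<in> mspace \<Gamma>" using assms(1) by (auto simp: metric_graph_def)
    then obtain E where E: "E \<in> Div \<Gamma>" "effective E" "div_degree E = int (nat (int r + k))"
      by (rule ex_effective_of_degree)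
    then obtain D where "div_degree D = int d" "effective (D - E)"
      using k True unfolding bn_cond_def by auto
    then show ?thesis using div_degree_effective[of "D - E"] E(3) True by simp
  qed simp
  \<comment> \<open>The condition holds vacuously at \<open>- int r - 1\<close>, where test divisors
    would have degree -1. Cutting off there leaves a nonempty finite set whose maximum is the
    \<open>GREATEST\<close>.\<close>
  define N where "N = {k. bn_cond \<Gamma> r d k \<and> - int r - 1 \<le> k}"
  have "bn_cond \<Gamma> r d (- int r - 1)"
    using div_degree_effective unfolding bn_cond_def by fastforce
  then have "- int r - 1 \<in> N" by (simp add: N_def)
  moreover have "finite N"
    by (rule finite_subset[of _ "{- int r - 1..int d - int r}"]) (auto simp: N_def bound)
  ultimately have M: "Max N \<in> N" "\<forall>k\<in>N. k \<le> Max N"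
    by (blast intro: Max_in, simp)
  have le: "k \<le> Max N" if "bn_cond \<Gamma> r d k" for k
    using M that by (cases "- int r - 1 \<le> k") (auto simp: N_def)
  have "bn_rank \<Gamma> r d = (GREATEST k. bn_cond \<Gamma> r d k)"
    using assms(2) by (simp add: bn_rank_def bn_cond_def)
  also have "\<dots> = Max N"
    by (rule Greatest_equality) (use M le in \<open>auto simp: N_def\<close>)
  finally show "bn_cond \<Gamma> r d (bn_rank \<Gamma> r d)" "\<And>k. bn_cond \<Gamma> r d k \<Longrightarrow> k \<le> bn_rank \<Gamma> r d"
    using M le by (auto simp: N_def)
qed

section \<open>Wedging with a loop\<close>

context wedge_sum
begin

lemma retract_in_Div:
  "D \<in> Div \<Gamma> \<Longrightarrow> pushforward retract1 D \<in> Div \<Gamma>1"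
  "D \<in> Div \<Gamma> \<Longrightarrow> pushforward retract2 D \<in> Div \<Gamma>2"
  by (erule pushforward_in_Div; use p p' in \<open>auto simp: mspace_\<Gamma>\<close>)+

lemma Inl_in_Div: "D \<in> Div \<Gamma>1 \<Longrightarrow> pushforward Inl D \<in> Div \<Gamma>"
  by (rule pushforward_in_Div) auto

lemma frag_of_wedge_point_in_Div: "frag_of (Inl p) \<in> Div \<Gamma>"
  using p by simp

text \<open>Test \<open>D\<close> against \<open>F\<close> plus the wedge point. The retraction
  sends that point to \<open>p\<close>, so removing \<open>p\<close> costs exactly one unit of
  rank.\<close>

lemma le_div_rank_retract:
  assumes D: "D \<in> Div \<Gamma>" and r: "int (Suc r) \<le> div_rank \<Gamma> D"
  shows "int r \<le> div_rank \<Gamma>1 (pushforward retract1 D - frag_of p)"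
  unfolding le_div_rank_iff[OF graph1] rank_cond_def
proof (intro ballI impI)
  fix F assume F: "F \<in> Div \<Gamma>1" "effective F \<and> div_degree F = int r"
  let ?F = "pushforward Inl F + frag_of (Inl p)"
  have "?F \<in> Div \<Gamma>" by (rule Div_add[OF Inl_in_Div[OF F(1)] frag_of_wedge_point_in_Div])
  moreover have "effective ?F" using F(2) by (simp add: effective_add effective_pushforward)
  moreover have "div_degree ?F = int (Suc r)" using F(2) by simp
  ultimately have "equiv_effective \<Gamma> (D - ?F)"
    using r unfolding le_div_rank_iff[OF metric_graph_wedge] rank_cond_def by blast
  then obtain G where G: "G \<in> Div \<Gamma>" "effective G" "principal \<Gamma> (D - ?F - G)"
    unfolding equiv_effective_iff by blast
  have "retract1 \<circ> Inl = id" by auto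
  then have "principal \<Gamma>1 (pushforward retract1 D - frag_of p - F - pushforward retract1 G)"
    using principal_pushforward_retract1[OF G(3)]
    by (simp add: pushforward_compose pushforward_id algebra_simps)
  moreover have "pushforward retract1 D - frag_of p - F \<in> Div \<Gamma>1"
    by (intro Div_diff retract_in_Div(1) D F(1)) (use p in simp)
  ultimately show "equiv_effective \<Gamma>1 (pushforward retract1 D - frag_of p - F)"
    using retract_in_Div(1)[OF G(1)] effective_pushforward[OF G(2)] by (intro equiv_effectiveI)
qed

text \<open>Making \<open>D\<close> contain the wedge point besides \<open>E\<close> pays for the
  \<open>p\<close> removed from its retraction. The extra point is offset by the step from
  \<open>Suc r\<close> to \<open>r\<close>, so \<open>k\<close> is unchanged.\<close>

lemma bn_cond_retract:
  assumes "bn_cond \<Gamma> (Suc r) (d + 1) k"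
  shows "bn_cond \<Gamma>1 r d k"
  unfolding bn_cond_def
proof (intro ballI impI)
  fix E assume E: "E \<in> Div \<Gamma>1" "effective E \<and> div_degree E = int r + k"
  let ?E = "pushforward Inl E + frag_of (Inl p)"
  have "?E \<in> Div \<Gamma>" by (rule Div_add[OF Inl_in_Div[OF E(1)] frag_of_wedge_point_in_Div])
  moreover have "effective ?E" using E(2) by (simp add: effective_add effective_pushforward)
  moreover have "div_degree ?E = int (Suc r) + k" using E(2) by simp
  ultimately obtain D where D: "D \<in> Div \<Gamma>" "div_degree D = int (d + 1)"
      "int (Suc r) \<le> div_rank \<Gamma> D" "effective (D - ?E)"
    using assms unfolding bn_cond_def by blast
  have id: "retract1 \<circ> Inl = id" by auto
  have "effective (pushforward retract1 D - frag_of p - E)"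
    using effective_pushforward[OF D(4), of retract1]
    by (simp add: pushforward_compose id pushforward_id algebra_simps)
  moreover have "pushforward retract1 D - frag_of p \<in> Div \<Gamma>1"
    by (intro Div_diff retract_in_Div(1) D(1)) (use p in simp)
  moreover have "div_degree (pushforward retract1 D - frag_of p) = int d" using D(2) by simp
  ultimately show "\<exists>D'\<in>Div \<Gamma>1. div_degree D' = int d \<and> int r \<le> div_rank \<Gamma>1 D' \<and> effective (D' - E)"
    using le_div_rank_retract[OF D(1,3)] by blast
qed

end

locale loop_wedge = wedge_sum +
  assumes loop2: "loop \<Gamma>2"
begin

text \<open>By \<open>pushforward_retract_decomposition\<close>, the expression before subtracting
  \<open>x\<close> is the image of a divisor of degree 1 on the loop. That divisor is equivalent to
  a point there, hence its image is equivalent to a point in the wedge.\<close>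

lemma retract_equiv:
  assumes A: "A \<in> Div \<Gamma>"
  obtains x where "x \<in> mspace \<Gamma>"
    "principal \<Gamma> (pushforward Inl (pushforward retract1 A) - A + frag_of (Inl p) - frag_of x)"
proof -
  \<comment> \<open>The loop divisor behind the retraction minus \<open>A\<close> plus the wedge
    point; the single \<open>frag_of p'\<close> raises its degree from 0 to 1.\<close>
  define B where "B = frag_cmul (div_degree A) (frag_of p') + frag_of p' - pushforward retract2 A"
  have cmul: "div_degree (frag_cmul n (frag_of y)) = n" for n y
    using div_degree_superset[of "{y}" "frag_cmul n (frag_of y)"] keys_cmul[of n "frag_of y"] by simp
  have "B \<in> Div \<Gamma>2"
    unfolding B_def using p' by (intro Div_diff Div_add retract_in_Div(2) A) (auto split: if_splits)
  moreover have "div_degree B = 1" by (simp add: B_def cmul)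
  ultimately obtain y where y: "y \<in> mspace \<Gamma>2" "principal \<Gamma>2 (B - frag_of y)"
    by (rule loop_degree_one_equiv_point[OF loop2])
  have "pushforward emb2 (frag_cmul n (frag_of p')) = frag_cmul n (frag_of (Inl p))" for n
    by (simp add: pushforward_def frag_extend_cmul emb2_def)
  then have "pushforward emb2 (B - frag_of y) =
      frag_cmul (div_degree A) (frag_of (Inl p)) + frag_of (Inl p)
        - pushforward emb2 (pushforward retract2 A) - frag_of (emb2 y)"
    by (simp add: B_def emb2_def)
  also have "\<dots> = pushforward Inl (pushforward retract1 A) - A + frag_of (Inl p) - frag_of (emb2 y)"
    using pushforward_retract_decomposition[OF A] by (simp add: algebra_simps)
  finally have "principal \<Gamma> (pushforward Inl (pushforward retract1 A) - A + frag_of (Inl p) - frag_of (emb2 y))"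
    using principal_pushforward_emb2[OF y(2)] by simp
  moreover have "emb2 y \<in> mspace \<Gamma>" using y(1) by (auto simp: mspace_\<Gamma>')
  ultimately show thesis using that by blast
qed

text \<open>Testing \<open>D\<close> against \<open>F\<close> reduces to testing \<open>D1\<close>
  against the retraction of \<open>F\<close>; what remains is \<open>G\<close> from \<Gamma>1 and
  the point for which the wedge point is traded. Working up to equivalence serves both
  \<open>bn_cond_extend\<close> and \<open>W_nonempty_extend\<close>.\<close>

lemma le_div_rank_extend:
  assumes D1: "D1 \<in> Div \<Gamma>1" "int r \<le> div_rank \<Gamma>1 D1" and D: "D \<in> Div \<Gamma>"
    and equiv: "principal \<Gamma> (D - (pushforward Inl D1 + frag_of (Inl p)))"
  shows "int r \<le> div_rank \<Gamma> D"
  unfolding le_div_rank_iff[OF metric_graph_wedge] rank_cond_def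
proof (intro ballI impI)
  fix F assume F: "F \<in> Div \<Gamma>" "effective F \<and> div_degree F = int r"
  let ?F = "pushforward retract1 F"
  have "effective ?F" "div_degree ?F = int r" "?F \<in> Div \<Gamma>1"
    using F(2) effective_pushforward retract_in_Div(1)[OF F(1)] by auto
  then obtain G where G: "G \<in> Div \<Gamma>1" "effective G" "principal \<Gamma>1 (D1 - ?F - G)"
    using D1(2) unfolding le_div_rank_iff[OF graph1] rank_cond_def equiv_effective_iff by blast
  obtain x where x: "x \<in> mspace \<Gamma>" "principal \<Gamma> (pushforward Inl ?F - F + frag_of (Inl p) - frag_of x)"
    by (rule retract_equiv[OF F(1)])
  \<comment> \<open>The sum telescopes: from \<open>D\<close> to \<open>D1\<close> plus the wedge
    point, from \<open>D1\<close> minus the retracted \<open>F\<close> to \<open>G\<close>, and from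
    the retracted \<open>F\<close> plus the wedge point to \<open>F\<close> plus
    \<open>x\<close>.\<close>
  have "principal \<Gamma> ((D - (pushforward Inl D1 + frag_of (Inl p))) + pushforward Inl (D1 - ?F - G)
      + (pushforward Inl ?F - F + frag_of (Inl p) - frag_of x))"
    by (intro principal_add metric_graph_wedge equiv principal_pushforward_Inl G(3) x(2))
  then have "principal \<Gamma> (D - F - (pushforward Inl G + frag_of x))"
    by (simp add: algebra_simps)
  moreover have "pushforward Inl G + frag_of x \<in> Div \<Gamma>"
    by (rule Div_add[OF Inl_in_Div[OF G(1)]]) (use x(1) in simp)
  moreover have "effective (pushforward Inl G + frag_of x)"
    using G(2) by (simp add: effective_add effective_pushforward)
  ultimately show "equiv_effective \<Gamma> (D - F)"
    using Div_diff[OF D F(1)] by (intro equiv_effectiveI)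
qed

text \<open>If \<open>D1\<close> contains the retraction of \<open>E\<close>, keep the rest of
  \<open>D1\<close> and replace the retracted \<open>E\<close> by \<open>E\<close> itself; the wedge
  point turns into \<open>x\<close> in exchange.\<close>

lemma bn_cond_extend:
  assumes "bn_cond \<Gamma>1 r d k"
  shows "bn_cond \<Gamma> r (d + 1) k"
  unfolding bn_cond_def
proof (intro ballI impI)
  fix E assume E: "E \<in> Div \<Gamma>" "effective E \<and> div_degree E = int r + k"
  let ?E = "pushforward retract1 E"
  have "effective ?E" "div_degree ?E = int r + k" "?E \<in> Div \<Gamma>1"
    using E(2) effective_pushforward retract_in_Div(1)[OF E(1)] by auto
  then obtain D1 where D1: "D1 \<in> Div \<Gamma>1" "div_degree D1 = int d" "int r \<le> div_rank \<Gamma>1 D1"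
      "effective (D1 - ?E)"
    using assms unfolding bn_cond_def by blast
  obtain x where x: "x \<in> mspace \<Gamma>" "principal \<Gamma> (pushforward Inl ?E - E + frag_of (Inl p) - frag_of x)"
    by (rule retract_equiv[OF E(1)])
  \<comment> \<open>Contains \<open>E\<close> by construction, and by the choice of \<open>x\<close>
    is equivalent to the image of \<open>D1\<close> plus the wedge point.\<close>
  define D where "D = pushforward Inl (D1 - ?E) + E + frag_of x"
  have D: "D \<in> Div \<Gamma>"
    unfolding D_def by (intro Div_add Inl_in_Div Div_diff D1(1) retract_in_Div(1) E(1)) (use x(1) in simp)
  have "D - (pushforward Inl D1 + frag_of (Inl p)) =
      - (pushforward Inl ?E - E + frag_of (Inl p) - frag_of x)"
    by (simp add: D_def algebra_simps)
  then have "principal \<Gamma> (D - (pushforward Inl D1 + frag_of (Inl p)))"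
    using principal_uminus[OF metric_graph_wedge x(2)] by metis
  then have "int r \<le> div_rank \<Gamma> D" by (rule le_div_rank_extend[OF D1(1,3) D])
  moreover have "D - E = pushforward Inl (D1 - ?E) + frag_of x" by (simp add: D_def)
  then have "effective (D - E)"
    using effective_add[OF effective_pushforward[OF D1(4)] effective_frag_of] by metis
  moreover have "div_degree D = int (d + 1)" using D1(2) by (simp add: D_def)
  ultimately show "\<exists>D\<in>Div \<Gamma>. div_degree D = int (d + 1) \<and> int r \<le> div_rank \<Gamma> D \<and> effective (D - E)"
    using D by blast
qed

text \<open>Rules out the default value -1 of \<open>bn_rank\<close> on the wedge, so that
  \<open>bn_rank_greatest\<close> applies there.\<close>

lemma W_nonempty_extend:
  assumes "W \<Gamma>1 r d \<noteq> {}"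
  shows "W \<Gamma> r (d + 1) \<noteq> {}"
proof -
  obtain D where D: "D \<in> Div \<Gamma>1" "div_degree D = int d" "int r \<le> div_rank \<Gamma>1 D"
    using assms unfolding W_nonempty_iff[OF graph1] by blast
  let ?D = "pushforward Inl D + frag_of (Inl p)"
  have "?D \<in> Div \<Gamma>" by (rule Div_add[OF Inl_in_Div[OF D(1)] frag_of_wedge_point_in_Div])
  moreover from this have "int r \<le> div_rank \<Gamma> ?D"
    by (rule le_div_rank_extend[OF D(1,3)]) (simp add: principal_0[OF metric_graph_wedge])
  moreover have "div_degree ?D = int (d + 1)" using D(2) by simp
  ultimately show ?thesis unfolding W_nonempty_iff[OF metric_graph_wedge] by blast
qed

end

theorem theorem5p4:
  fixes \<Gamma>1 :: "'a metric" and \<Gamma>2 :: "'b metric" and p :: 'a and p' :: 'b and r d :: nat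
  assumes "metric_graph \<Gamma>1" and "loop \<Gamma>2"
    and "p \<in> mspace \<Gamma>1" and "p' \<in> mspace \<Gamma>2"
    and "W \<Gamma>1 r d \<noteq> {}"
  shows "bn_rank \<Gamma>1 r d \<le> bn_rank (wedge \<Gamma>1 p \<Gamma>2 p') r (d + 1)
    \<and> (1 \<le> r \<longrightarrow> bn_rank (wedge \<Gamma>1 p \<Gamma>2 p') r (d + 1) \<le> bn_rank \<Gamma>1 (r - 1) d)"
proof -
  interpret loop_wedge \<Gamma>1 p \<Gamma>2 p'
    using assms by unfold_locales (auto simp: loop_def)
  have W: "W \<Gamma> r (d + 1) \<noteq> {}" by (rule W_nonempty_extend[OF assms(5)])
  have "bn_rank \<Gamma>1 r d \<le> bn_rank \<Gamma> r (d + 1)"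
    by (rule bn_rank_greatest(2)[OF metric_graph_wedge W bn_cond_extend[OF bn_rank_greatest(1)[OF graph1 assms(5)]]])
  moreover have "bn_rank \<Gamma> r (d + 1) \<le> bn_rank \<Gamma>1 (r - 1) d" if "1 \<le> r"
  proof -
    obtain q where q: "r = Suc q" using \<open>1 \<le> r\<close> by (cases r) auto
    \<comment> \<open>A divisor of rank at least \<open>Suc q\<close> also has rank at least
      \<open>q\<close>, so the right-hand rank is a genuine maximum as well.\<close>
    have "W \<Gamma>1 q d \<noteq> {}"
      using assms(5) unfolding W_nonempty_iff[OF graph1] q by force
    moreover have "bn_cond \<Gamma>1 q d (bn_rank \<Gamma> r (d + 1))"
      using bn_rank_greatest(1)[OF metric_graph_wedge W] bn_cond_retract unfolding q by blast
    ultimately show ?thesis using bn_rank_greatest(2)[OF graph1] by (simp add: q)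
  qed
  ultimately show ?thesis by blast
qed

end
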